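(* For any ordinal $\alpha$, if $G$ and $H$ are groups such that $G\equiv^{\mathrm{bf}}_{1+\alpha}H$, then for any weak modulus $\Omega$ we have $L(G)\equiv^{\mathrm{bf},\Omega}_\alpha L(H)$.
   Context: Classical back-and-forth relations. Groups are (discrete) first-order structures in the language of groups (multiplication, inverse, identity). Given structures $M,N$ in the same classical language, finite tuples $\vec a$ from $M$ and $\vec b$ from $N$ of the same length, and an ordinal $\alpha$, define $(M,\vec a)\equiv^{\mathrm{bf}}_\alpha(N,\vec b)$ by recursion. For $\alpha=0$: for every quantifier-free formula $\varphi(\vec x)$, $M\models\varphi(\vec a)\Leftrightarrow N\models\varphi(\vec b)$. For $\alpha>0$: for every $\beta<\alpha$ and every finite tuple $\vec c$ from $M$ (of arbitrary length) there is a finite tuple $\vec d$ from $N$ with $(M,\vec a,\vec c)\equiv^{\mathrm{bf}}_\beta(N,\vec b,\vec d)$, and for every $\beta<\alpha$ and every finite tuple $\vec d$ from $N$ there is a finite tuple $\vec c$ from $M$ with $(M,\vec a,\vec c)\equiv^{\mathrm{bf}}_\beta(N,\vec b,\vec d)$. Write $M\equiv^{\mathrm{bf}}_\alpha N$ if $(M,\varnothing)\equiv^{\mathrm{bf}}_\alpha(N,\varnothing)$. Group von Neumann algebra. For $g\in G$ let $u_g$ be the unitary on $\ell^2(G)$ with $u_g(\delta_h)=\delta_{gh}$. $\mathbb C[G]$ is identified with the span of the $u_g$ in $\mathcal B(\ell^2(G))$; $L(G)$ is its closure in the strong operator topology, with trace $\operatorname{tr}(x)=\langle x\delta_e,\delta_e\rangle$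 and $\|x\|_2=\sqrt{\operatorname{tr}(x^*x)}$. A tracial von Neumann algebra is viewed as a many-sorted metric structure: its sorts are the operator norm balls of integer radius, with metric induced by $\|\cdot\|_2$ (the metric counts as a predicate symbol); the function symbols are the restrictions to these balls of addition, multiplication, scalar multiplication (by each complex scalar) and adjoint, together with the inclusion maps between balls; there are constants $0,1$ in the unit ball. Moduli. A modulus of arity $n$ is a continuous function $\Delta:[0,\infty)^n\to[0,\infty)$ that is non-decreasing, subadditive and vanishes at $0$. A function $f:\prod_{i\le n}X_i\to Y$ between metric spaces obeys (respects) $\Delta$ if $d(f(\vec a),f(\vec b))\le\Delta(d(a_1,b_1),\dots,d(a_n,b_n))$ always. For $f:K\to\mathbb R$ continuous with $K$ a product of compact intervals, $\Delta_f(\delta_1,\dots,\delta_n)=\sup\{|f(\vec x)-f(\vec y)|:|x_i-y_i|\le\delta_i\}$. A weak modulus is a function $\Omega:[0,\infty)^{\mathbb N}\to[0,\infty]$ that is non-decreasing, subadditive, vanishing at zero, lower semicontinuous for the product topology, and continuous in each argument; its truncations are the moduli $\Omega\restriction_n(\delta_1,\dots,\delta_n)=\Omega(\delta_1,\dots,\delta_n,0,0,\dots)$. Basic formulas. Each predicate symbol $P$ of a metric language has a modulus $\Delta_P$ and a compact interval $I_P$ of values; each function symbol $F$ has a modulus $\Delta_F$. Terms in the variables $x_1,x_2,\dots$ carry moduli: the variable $x_i$ has modulus $\Delta_{x_i}(\delta)=\delta_i$, and $F(\tau_1,\dots,\tau_n)$ has modulus $\Delta_F\circ(\Delta_{\tau_1},\dots,\Delta_{\tau_n})$.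 An atomic formula $P(\tau_1,\dots,\tau_n)$ has modulus $\Delta_P\circ(\Delta_{\tau_1},\dots,\Delta_{\tau_n})$ and bound $I_P$. A basic formula is $\psi=f(\phi_1,\dots,\phi_k)$ with $\phi_j$ atomic and $f:\prod I_{\phi_j}\to\mathbb R$ continuous; it has modulus $\Delta_f\circ(\Delta_{\phi_1},\dots,\Delta_{\phi_k})$. A basic $\Omega$-formula of arity $n$ is a basic formula depending only on $x_1,\dots,x_n$ that respects $\Omega\restriction_n$ (its modulus is bounded by $\Omega\restriction_n$). Metric back-and-forth. For metric structures $M,N$ in the same language and $\vec a\in M^n$, $\vec b\in N^n$ (corresponding entries in the same sorts), let $r_0^{M,N}(\vec a,\vec b)=\sup_\phi|\phi^M(\vec a)-\phi^N(\vec b)|$ over all basic $\Omega$-formulas $\phi$ of arity $n$, and for $\alpha>0$ $$r_\alpha^{M,N}(\vec a,\vec b)=\max\Bigl\{\sup_{\beta<\alpha}\sup_{\vec c\in M}\inf_{\vec d\in N}r_\beta^{M,N}(\vec a\vec c,\vec b\vec d),\ \sup_{\beta<\alpha}\sup_{\vec d\in N}\inf_{\vec c\in M}r_\beta^{M,N}(\vec a\vec c,\vec b\vec d)\Bigr\},$$ where $\vec c,\vec d$ range over finite tuples (arbitrary length, matching lengths and sorts). Write $(M,\vec a)\equiv^{\mathrm{bf},\Omega}_\alpha(N,\vec b)$ if $r_\alpha^{M,N}(\vec a,\vec b)=0$, and $M\equiv^{\mathrm{bf},\Omega}_\alpha N$ for the case of empty tuples. *)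

theory Defs
  imports
    "HOL-Analysis.Analysis"
    "HOL-Algebra.Group"
    "HOL-Library.Option_ord"
begin

section \<open>Ordinals\<close>

text \<open>
  An ordinal is given as an element \<open>\<alpha>\<close> of an arbitrary type of class \<^class>\<open>wellorder\<close>; it
  stands for the order type of \<open>{..<\<alpha>}\<close>. Every ordinal is of this form, and the recursions
  below only use the order type of \<open>{..<\<alpha>}\<close>. In particular the ordinal 0 is the case in
  which \<open>\<alpha>\<close> has no predecessor.

  In the well-order on \<^typ>\<open>'o option\<close>, the element \<open>None\<close> lies below all \<open>Some \<beta>\<close>, so that
  \<open>Some \<alpha>\<close> represents \<open>1 + \<alpha>\<close> (one new point, followed by a copy of \<open>{..<\<alpha>}\<close>).
\<close>

definition is_zero :: "'o::wellorder \<Rightarrow> bool"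
  where "is_zero \<alpha> \<longleftrightarrow> (\<forall>\<beta>. \<not> \<beta> < \<alpha>)"

definition one_plus :: "'o::wellorder \<Rightarrow> 'o option"
  where "one_plus \<alpha> = Some \<alpha>"

lemma lessThan_one_plus: "{..<one_plus \<alpha>} = insert None (Some ` {..<\<alpha>})"
proof (rule Set.set_eqI)
  fix x :: "'a option"
  show "x \<in> {..<one_plus \<alpha>} \<longleftrightarrow> x \<in> insert None (Some ` {..<\<alpha>})"
    by (cases x) (auto simp: one_plus_def)
qed


section \<open>Classical back-and-forth relations between groups\<close>

datatype gterm = GVar nat | GOne | GInv gterm | GMult gterm gterm

datatype gform = GEq gterm gterm | GNot gform | GAnd gform gform | GOr gform gform

primrec gterm_vars :: "gterm \<Rightarrow> nat set" where
  "gterm_vars (GVar i) = {i}"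
| "gterm_vars GOne = {}"
| "gterm_vars (GInv s) = gterm_vars s"
| "gterm_vars (GMult s t) = gterm_vars s \<union> gterm_vars t"

primrec gform_vars :: "gform \<Rightarrow> nat set" where
  "gform_vars (GEq s t) = gterm_vars s \<union> gterm_vars t"
| "gform_vars (GNot \<phi>) = gform_vars \<phi>"
| "gform_vars (GAnd \<phi> \<psi>) = gform_vars \<phi> \<union> gform_vars \<psi>"
| "gform_vars (GOr \<phi> \<psi>) = gform_vars \<phi> \<union> gform_vars \<psi>"

primrec gterm_val :: "('a, 'm) monoid_scheme \<Rightarrow> 'a list \<Rightarrow> gterm \<Rightarrow> 'a" where
  "gterm_val G a (GVar i) = a ! i"
| "gterm_val G a GOne = \<one>\<^bsub>G\<^esub>"
| "gterm_val G a (GInv s) = inv\<^bsub>G\<^esub> (gterm_val G a s)"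
| "gterm_val G a (GMult s t) = gterm_val G a s \<otimes>\<^bsub>G\<^esub> gterm_val G a t"

primrec gform_sat :: "('a, 'm) monoid_scheme \<Rightarrow> 'a list \<Rightarrow> gform \<Rightarrow> bool" where
  "gform_sat G a (GEq s t) \<longleftrightarrow> gterm_val G a s = gterm_val G a t"
| "gform_sat G a (GNot \<phi>) \<longleftrightarrow> \<not> gform_sat G a \<phi>"
| "gform_sat G a (GAnd \<phi> \<psi>) \<longleftrightarrow> gform_sat G a \<phi> \<and> gform_sat G a \<psi>"
| "gform_sat G a (GOr \<phi> \<psi>) \<longleftrightarrow> gform_sat G a \<phi> \<or> gform_sat G a \<psi>"

definition qf_equiv ::
    "('a, 'm) monoid_scheme \<Rightarrow> 'a list \<Rightarrow> ('b, 'n) monoid_scheme \<Rightarrow> 'b list \<Rightarrow> bool"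
  where "qf_equiv G a H b \<longleftrightarrow>
    (\<forall>\<phi>. gform_vars \<phi> \<subseteq> {..<length a} \<longrightarrow> (gform_sat G a \<phi> \<longleftrightarrow> gform_sat H b \<phi>))"

function bf_equiv_tuple ::
    "'o::wellorder \<Rightarrow> ('a, 'm) monoid_scheme \<Rightarrow> 'a list \<Rightarrow> ('b, 'n) monoid_scheme \<Rightarrow> 'b list \<Rightarrow> bool"
  where "bf_equiv_tuple \<alpha> G a H b \<longleftrightarrow>
    (if is_zero \<alpha> then qf_equiv G a H b
     else
       (\<forall>\<beta>\<in>{..<\<alpha>}. \<forall>c\<in>lists (carrier G). \<exists>d\<in>lists (carrier H).
          length d = length c \<and> bf_equiv_tuple \<beta> G (a @ c) H (b @ d)) \<and>
       (\<forall>\<beta>\<in>{..<\<alpha>}. \<forall>d\<in>lists (carrier H). \<exists>c\<in>lists (carrier G).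
          length c = length d \<and> bf_equiv_tuple \<beta> G (a @ c) H (b @ d)))"
  by pat_completeness auto
termination
  by (relation "inv_image {(x, y). x < y} fst") (auto intro: wf)

declare bf_equiv_tuple.simps [simp del]

definition bf_equiv :: "'o::wellorder \<Rightarrow> ('a, 'm) monoid_scheme \<Rightarrow> ('b, 'n) monoid_scheme \<Rightarrow> bool"
  where "bf_equiv \<alpha> G H \<longleftrightarrow> bf_equiv_tuple \<alpha> G [] H []"


section \<open>Weak moduli\<close>

definition nonneg_seqs :: "(nat \<Rightarrow> real) set"
  where "nonneg_seqs = {\<delta>. \<forall>i. 0 \<le> \<delta> i}"

text \<open>
  Only the values on \<^const>\<open>nonneg_seqs\<close> matter. The topology on \<^typ>\<open>nat \<Rightarrow> real\<close> is the product
  topology, and lower semicontinuity is openness of all strict superlevel sets.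
\<close>

definition weak_modulus :: "((nat \<Rightarrow> real) \<Rightarrow> ennreal) \<Rightarrow> bool"
  where "weak_modulus \<Omega> \<longleftrightarrow>
    (\<forall>\<delta>\<in>nonneg_seqs. \<forall>\<epsilon>\<in>nonneg_seqs. (\<forall>i. \<delta> i \<le> \<epsilon> i) \<longrightarrow> \<Omega> \<delta> \<le> \<Omega> \<epsilon>) \<and>
    (\<forall>\<delta>\<in>nonneg_seqs. \<forall>\<epsilon>\<in>nonneg_seqs. \<Omega> (\<lambda>i. \<delta> i + \<epsilon> i) \<le> \<Omega> \<delta> + \<Omega> \<epsilon>) \<and>
    \<Omega> (\<lambda>_. 0) = 0 \<and>
    (\<forall>t. openin (top_of_set nonneg_seqs) {\<delta> \<in> nonneg_seqs. t < \<Omega> \<delta>}) \<and>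
    (\<forall>\<delta>\<in>nonneg_seqs. \<forall>i. continuous_on {0..} (\<lambda>t. \<Omega> (\<delta>(i := t))))"

definition truncation :: "((nat \<Rightarrow> real) \<Rightarrow> ennreal) \<Rightarrow> nat \<Rightarrow> (nat \<Rightarrow> real) \<Rightarrow> ennreal"
  where "truncation \<Omega> n \<delta> = \<Omega> (\<lambda>i. if i < n then \<delta> i else 0)"


section \<open>Many-sorted metric structures and their basic formulas\<close>

record ('s, 'f, 'p) metric_language =
  fun_dom :: "'f \<Rightarrow> 's list"
  fun_cod :: "'f \<Rightarrow> 's"
  fun_mod :: "'f \<Rightarrow> real list \<Rightarrow> real"
  pred_dom :: "'p \<Rightarrow> 's list"
  pred_mod :: "'p \<Rightarrow> real list \<Rightarrow> real"
  pred_bound :: "'p \<Rightarrow> real set"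

text \<open>The metric of each sort is one of the predicate symbols.\<close>

record ('s, 'f, 'p, 'x) metric_structure =
  sort_of :: "'s \<Rightarrow> 'x set"
  fun_interp :: "'f \<Rightarrow> 'x list \<Rightarrow> 'x"
  pred_interp :: "'p \<Rightarrow> 'x list \<Rightarrow> real"

text \<open>Variables are numbered from 0.\<close>

datatype 'f mterm = Var nat | App 'f "'f mterm list"

datatype ('f, 'p) atomic = Atom (atom_pred: 'p) (atom_args: "'f mterm list")

datatype ('f, 'p) basic = Basic "(nat \<Rightarrow> real) \<Rightarrow> real" "('f, 'p) atomic list"

text \<open>Well-sortedness when \<open>x\<^sub>i\<close> has sort \<open>ss ! i\<close> for \<open>i < length ss\<close> and no other variables occur.\<close>

inductive has_sort :: "('s, 'f, 'p) metric_language \<Rightarrow> 's list \<Rightarrow> 'f mterm \<Rightarrow> 's \<Rightarrow> bool"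
  for L ss where
  "i < length ss \<Longrightarrow> has_sort L ss (Var i) (ss ! i)"
| "list_all2 (has_sort L ss) ts (fun_dom L F) \<Longrightarrow> has_sort L ss (App F ts) (fun_cod L F)"

definition atomic_wf :: "('s, 'f, 'p) metric_language \<Rightarrow> 's list \<Rightarrow> ('f, 'p) atomic \<Rightarrow> bool"
  where "atomic_wf L ss \<phi> \<longleftrightarrow> list_all2 (has_sort L ss) (atom_args \<phi>) (pred_dom L (atom_pred \<phi>))"

definition atomic_bound :: "('s, 'f, 'p) metric_language \<Rightarrow> ('f, 'p) atomic \<Rightarrow> real set"
  where "atomic_bound L \<phi> = pred_bound L (atom_pred \<phi>)"

text \<open>
  In \<open>Basic f \<phi>s\<close> with \<open>k = length \<phi>s\<close>, the connective \<open>f\<close> is a function on the product of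
  the intervals \<open>I\<^bsub>\<phi>\<^sub>j\<^esub>\<close>, the points of which are the extensional functions on \<open>{..<k}\<close>.
\<close>

definition bounds_prod :: "('s, 'f, 'p) metric_language \<Rightarrow> ('f, 'p) atomic list \<Rightarrow> (nat \<Rightarrow> real) set"
  where "bounds_prod L \<phi>s = (\<Pi>\<^sub>E j\<in>{..<length \<phi>s}. atomic_bound L (\<phi>s ! j))"

primrec basic_wf :: "('s, 'f, 'p) metric_language \<Rightarrow> 's list \<Rightarrow> ('f, 'p) basic \<Rightarrow> bool" where
  "basic_wf L ss (Basic f \<phi>s) \<longleftrightarrow>
     (\<forall>\<phi>\<in>set \<phi>s. atomic_wf L ss \<phi>) \<and> continuous_on (bounds_prod L \<phi>s) f"

primrec mterm_val :: "('s, 'f, 'p, 'x) metric_structure \<Rightarrow> 'x list \<Rightarrow> 'f mterm \<Rightarrow> 'x" where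
  "mterm_val M a (Var i) = a ! i"
| "mterm_val M a (App F ts) = fun_interp M F (map (mterm_val M a) ts)"

definition atomic_val :: "('s, 'f, 'p, 'x) metric_structure \<Rightarrow> 'x list \<Rightarrow> ('f, 'p) atomic \<Rightarrow> real"
  where "atomic_val M a \<phi> = pred_interp M (atom_pred \<phi>) (map (mterm_val M a) (atom_args \<phi>))"

primrec basic_val :: "('s, 'f, 'p, 'x) metric_structure \<Rightarrow> 'x list \<Rightarrow> ('f, 'p) basic \<Rightarrow> real" where
  "basic_val M a (Basic f \<phi>s) = f (\<lambda>j\<in>{..<length \<phi>s}. atomic_val M a (\<phi>s ! j))"

primrec mterm_mod :: "('s, 'f, 'p) metric_language \<Rightarrow> 'f mterm \<Rightarrow> (nat \<Rightarrow> real) \<Rightarrow> real" where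
  "mterm_mod L (Var i) = (\<lambda>\<delta>. \<delta> i)"
| "mterm_mod L (App F ts) = (\<lambda>\<delta>. fun_mod L F (map (\<lambda>\<Delta>. \<Delta> \<delta>) (map (mterm_mod L) ts)))"

definition atomic_mod ::
    "('s, 'f, 'p) metric_language \<Rightarrow> ('f, 'p) atomic \<Rightarrow> (nat \<Rightarrow> real) \<Rightarrow> real"
  where "atomic_mod L \<phi> \<delta> = pred_mod L (atom_pred \<phi>) (map (\<lambda>t. mterm_mod L t \<delta>) (atom_args \<phi>))"

text \<open>\<open>\<Delta>\<^sub>f(\<delta>\<^sub>0, \<dots>, \<delta>\<^bsub>k-1\<^esub>)\<close> for \<open>f\<close> defined on \<open>K \<subseteq> \<real>\<^sup>k\<close>\<close>

definition modulus_of ::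
    "nat \<Rightarrow> (nat \<Rightarrow> real) set \<Rightarrow> ((nat \<Rightarrow> real) \<Rightarrow> real) \<Rightarrow> (nat \<Rightarrow> real) \<Rightarrow> ennreal"
  where "modulus_of k K f \<delta> =
    (SUP (x, y) \<in> {(x, y). x \<in> K \<and> y \<in> K \<and> (\<forall>j<k. \<bar>x j - y j\<bar> \<le> \<delta> j)}. ennreal \<bar>f x - f y\<bar>)"

primrec basic_mod :: "('s, 'f, 'p) metric_language \<Rightarrow> ('f, 'p) basic \<Rightarrow> (nat \<Rightarrow> real) \<Rightarrow> ennreal" where
  "basic_mod L (Basic f \<phi>s) =
     (\<lambda>\<delta>. modulus_of (length \<phi>s) (bounds_prod L \<phi>s) f (\<lambda>j. atomic_mod L (\<phi>s ! j) \<delta>))"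

text \<open>The basic \<open>\<Omega>\<close>-formulas of arity \<open>length ss\<close> in variables of sorts \<open>ss\<close>.\<close>

definition Omega_formulas ::
    "('s, 'f, 'p) metric_language \<Rightarrow> ((nat \<Rightarrow> real) \<Rightarrow> ennreal) \<Rightarrow> 's list \<Rightarrow> ('f, 'p) basic set"
  where "Omega_formulas L \<Omega> ss =
    {\<psi>. basic_wf L ss \<psi> \<and> (\<forall>\<delta>\<in>nonneg_seqs. basic_mod L \<psi> \<delta> \<le> truncation \<Omega> (length ss) \<delta>)}"


section \<open>Metric back-and-forth\<close>

text \<open>
  Since the carriers of different sorts may overlap, each entry of a tuple is tagged with its
  sort; \<open>map fst a\<close> is the list of sorts and \<open>map snd a\<close> the list of elements of a tuple \<open>a\<close>.
\<close>

definition tuples :: "('s, 'f, 'p, 'x) metric_structure \<Rightarrow> ('s \<times> 'x) list set"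
  where "tuples M = lists {(s, x). x \<in> sort_of M s}"

definition tuples_of_sorts :: "('s, 'f, 'p, 'x) metric_structure \<Rightarrow> 's list \<Rightarrow> ('s \<times> 'x) list set"
  where "tuples_of_sorts M ss = {a \<in> tuples M. map fst a = ss}"

definition r_zero ::
    "('s, 'f, 'p) metric_language \<Rightarrow> ((nat \<Rightarrow> real) \<Rightarrow> ennreal) \<Rightarrow>
     ('s, 'f, 'p, 'x) metric_structure \<Rightarrow> ('s, 'f, 'p, 'y) metric_structure \<Rightarrow>
     ('s \<times> 'x) list \<Rightarrow> ('s \<times> 'y) list \<Rightarrow> ennreal"
  where "r_zero L \<Omega> M N a b =
    (SUP \<phi> \<in> Omega_formulas L \<Omega> (map fst a).
       ennreal \<bar>basic_val M (map snd a) \<phi> - basic_val N (map snd b) \<phi>\<bar>)"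

function r_dist ::
    "('s, 'f, 'p) metric_language \<Rightarrow> ((nat \<Rightarrow> real) \<Rightarrow> ennreal) \<Rightarrow> 'o::wellorder \<Rightarrow>
     ('s, 'f, 'p, 'x) metric_structure \<Rightarrow> ('s, 'f, 'p, 'y) metric_structure \<Rightarrow>
     ('s \<times> 'x) list \<Rightarrow> ('s \<times> 'y) list \<Rightarrow> ennreal"
  where "r_dist L \<Omega> \<alpha> M N a b =
    (if is_zero \<alpha> then r_zero L \<Omega> M N a b
     else max
       (SUP \<beta>\<in>{..<\<alpha>}. SUP c\<in>tuples M. INF d\<in>tuples_of_sorts N (map fst c).
          r_dist L \<Omega> \<beta> M N (a @ c) (b @ d))
       (SUP \<beta>\<in>{..<\<alpha>}. SUP d\<in>tuples N. INF c\<in>tuples_of_sorts M (map fst d).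
          r_dist L \<Omega> \<beta> M N (a @ c) (b @ d)))"
  by pat_completeness auto
termination
  by (relation "inv_image {(x, y). x < y} (\<lambda>(L, \<Omega>, \<alpha>, _). \<alpha>)") (auto intro: wf)

declare r_dist.simps [simp del]

definition metric_bf_equiv ::
    "('s, 'f, 'p) metric_language \<Rightarrow> ((nat \<Rightarrow> real) \<Rightarrow> ennreal) \<Rightarrow> 'o::wellorder \<Rightarrow>
     ('s, 'f, 'p, 'x) metric_structure \<Rightarrow> ('s, 'f, 'p, 'y) metric_structure \<Rightarrow> bool"
  where "metric_bf_equiv L \<Omega> \<alpha> M N \<longleftrightarrow> r_dist L \<Omega> \<alpha> M N [] [] = 0"


section \<open>The language of tracial von Neumann algebras\<close>

text \<open>
  The sort \<open>n\<close> is the operator norm ball of radius \<open>n\<close>. The index of a function symbol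
  determines the balls between which it acts: addition \<open>B\<^sub>m \<times> B\<^sub>n \<rightarrow> B\<^bsub>m+n\<^esub>\<close>, multiplication
  \<open>B\<^sub>m \<times> B\<^sub>n \<rightarrow> B\<^bsub>mn\<^esub>\<close>, multiplication by the scalar \<open>c\<close> from \<open>B\<^sub>n\<close> to the smallest ball of
  integer radius containing \<open>c B\<^sub>n\<close>, adjoint \<open>B\<^sub>n \<rightarrow> B\<^sub>n\<close>, and inclusion \<open>B\<^sub>n \<rightarrow> B\<^bsub>n+k\<^esub>\<close>.
\<close>

datatype vna_fun =
  VZero | VOne | VAdd nat nat | VMult nat nat | VScale complex nat | VAdj nat | VIncl nat nat

datatype vna_pred = VDist nat

primrec vna_fun_dom :: "vna_fun \<Rightarrow> nat list" where
  "vna_fun_dom VZero = []"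
| "vna_fun_dom VOne = []"
| "vna_fun_dom (VAdd m n) = [m, n]"
| "vna_fun_dom (VMult m n) = [m, n]"
| "vna_fun_dom (VScale c n) = [n]"
| "vna_fun_dom (VAdj n) = [n]"
| "vna_fun_dom (VIncl n k) = [n]"

primrec vna_fun_cod :: "vna_fun \<Rightarrow> nat" where
  "vna_fun_cod VZero = 1"
| "vna_fun_cod VOne = 1"
| "vna_fun_cod (VAdd m n) = m + n"
| "vna_fun_cod (VMult m n) = m * n"
| "vna_fun_cod (VScale c n) = nat \<lceil>cmod c * real n\<rceil>"
| "vna_fun_cod (VAdj n) = n"
| "vna_fun_cod (VIncl n k) = n + k"

text \<open>
  The moduli are the Lipschitz estimates valid for the 2-norm in every tracial von Neumann algebra;
  for multiplication,
  \<open>\<parallel>xy - x'y'\<parallel>\<^sub>2 \<le> \<parallel>x - x'\<parallel>\<^sub>2 \<parallel>y\<parallel> + \<parallel>x'\<parallel> \<parallel>y - y'\<parallel>\<^sub>2\<close>.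
\<close>

primrec vna_fun_mod :: "vna_fun \<Rightarrow> real list \<Rightarrow> real" where
  "vna_fun_mod VZero \<delta> = 0"
| "vna_fun_mod VOne \<delta> = 0"
| "vna_fun_mod (VAdd m n) \<delta> = \<delta> ! 0 + \<delta> ! 1"
| "vna_fun_mod (VMult m n) \<delta> = real n * \<delta> ! 0 + real m * \<delta> ! 1"
| "vna_fun_mod (VScale c n) \<delta> = cmod c * \<delta> ! 0"
| "vna_fun_mod (VAdj n) \<delta> = \<delta> ! 0"
| "vna_fun_mod (VIncl n k) \<delta> = \<delta> ! 0"

definition vna_language :: "(nat, vna_fun, vna_pred) metric_language"
  where "vna_language =
    \<lparr> fun_dom = vna_fun_dom,
      fun_cod = vna_fun_cod,
      fun_mod = vna_fun_mod,
      pred_dom = (\<lambda>P. case P of VDist n \<Rightarrow> [n, n]),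
      pred_mod = (\<lambda>P \<delta>. \<delta> ! 0 + \<delta> ! 1),
      pred_bound = (\<lambda>P. case P of VDist n \<Rightarrow> {0..2 * real n}) \<rparr>"


section \<open>The Hilbert space of square-summable functions\<close>

typedef 'a ell2 = "{f :: 'a \<Rightarrow> complex. (\<lambda>x. (cmod (f x))\<^sup>2) summable_on UNIV}"
  morphisms ell2_coeff Abs_ell2
  by (rule exI [of _ "\<lambda>_. 0"]) simp

setup_lifting type_definition_ell2

lemma ell2_sum_summable:
  assumes "(\<lambda>x. (cmod (f x))\<^sup>2) summable_on A" "(\<lambda>x. (cmod (g x))\<^sup>2) summable_on A"
  shows "(\<lambda>x. (cmod (f x + g x))\<^sup>2) summable_on A"
proof (rule summable_on_comparison_test)
  show "(\<lambda>x. 2 * (cmod (f x))\<^sup>2 + 2 * (cmod (g x))\<^sup>2) summable_on A"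
    by (intro summable_on_add summable_on_cmult_right assms)
  show "(cmod (f x + g x))\<^sup>2 \<le> 2 * (cmod (f x))\<^sup>2 + 2 * (cmod (g x))\<^sup>2" for x
  proof -
    have "(cmod (f x + g x))\<^sup>2 \<le> (cmod (f x) + cmod (g x))\<^sup>2"
      by (simp add: norm_triangle_ineq power_mono)
    also have "\<dots> \<le> 2 * (cmod (f x))\<^sup>2 + 2 * (cmod (g x))\<^sup>2"
      using sum_squares_bound [of "cmod (f x)" "cmod (g x)"]
      by (simp add: power2_sum)
    finally show ?thesis .
  qed
qed auto

lemma ell2_prod_summable:
  assumes "(\<lambda>x. (cmod (f x))\<^sup>2) summable_on A" "(\<lambda>x. (cmod (g x))\<^sup>2) summable_on A"
  shows "(\<lambda>x. f x * cnj (g x)) summable_on A"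
proof (rule abs_summable_summable, rule summable_on_comparison_test)
  show "(\<lambda>x. (cmod (f x))\<^sup>2 + (cmod (g x))\<^sup>2) summable_on A"
    by (intro summable_on_add assms)
  show "norm (f x * cnj (g x)) \<le> (cmod (f x))\<^sup>2 + (cmod (g x))\<^sup>2" for x
  proof -
    have "0 \<le> cmod (f x) * cmod (g x)" by simp
    then have "cmod (f x) * cmod (g x) \<le> (cmod (f x))\<^sup>2 + (cmod (g x))\<^sup>2"
      using sum_squares_bound [of "cmod (f x)" "cmod (g x)"] by linarith
    then show ?thesis by (simp add: norm_mult)
  qed
qed auto

lemma ell2_scale_summable:
  assumes "(\<lambda>x. (cmod (f x))\<^sup>2) summable_on A"
  shows "(\<lambda>x. (cmod (c * f x))\<^sup>2) summable_on A"
  using summable_on_cmult_right [OF assms, of "(cmod c)\<^sup>2"]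
  by (simp add: norm_mult power_mult_distrib)

lift_definition scaleC :: "complex \<Rightarrow> 'a ell2 \<Rightarrow> 'a ell2" is "\<lambda>c f x. c * f x"
  by (simp add: ell2_scale_summable)

lift_definition cinner :: "'a ell2 \<Rightarrow> 'a ell2 \<Rightarrow> complex" is "\<lambda>f g. \<Sum>\<^sub>\<infinity>x. f x * cnj (g x)" .

lift_definition delta :: "'a \<Rightarrow> 'a ell2" is "\<lambda>a x. if x = a then 1 else 0"
proof -
  fix a :: 'a
  have "(\<lambda>x. (cmod (if x = a then 1 else 0))\<^sup>2) summable_on {a}"
    by simp
  then have "(\<lambda>x. (cmod (if x = a then 1 else 0))\<^sup>2) summable_on UNIV"
    by (rule summable_on_cong_neutral [THEN iffD1, rotated 3]) auto
  then show "?thesis a" by simp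
qed

lemma cinner_self: "cinner f f = complex_of_real (\<Sum>\<^sub>\<infinity>x. (cmod (ell2_coeff f x))\<^sup>2)"
proof -
  have "((\<lambda>x. (cmod (ell2_coeff f x))\<^sup>2) has_sum (\<Sum>\<^sub>\<infinity>x. (cmod (ell2_coeff f x))\<^sup>2)) UNIV"
    by (rule has_sum_infsum) (use ell2_coeff [of f] in simp)
  then have "((\<lambda>x. complex_of_real ((cmod (ell2_coeff f x))\<^sup>2)) has_sum
      complex_of_real (\<Sum>\<^sub>\<infinity>x. (cmod (ell2_coeff f x))\<^sup>2)) UNIV"
    by (rule has_sum_of_real_iff [THEN iffD2])
  then show ?thesis
    unfolding cinner.rep_eq complex_norm_square by (rule infsumI)
qed

text \<open>
  The library's normed spaces are real; the real inner product is the real part of \<^const>\<open>cinner\<close>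
  and induces the same norm.
\<close>

instantiation ell2 :: (type) real_inner
begin

lift_definition zero_ell2 :: "'a ell2" is "\<lambda>_. 0" by simp
lift_definition plus_ell2 :: "'a ell2 \<Rightarrow> 'a ell2 \<Rightarrow> 'a ell2" is "\<lambda>f g x. f x + g x"
  by (simp add: ell2_sum_summable)
lift_definition uminus_ell2 :: "'a ell2 \<Rightarrow> 'a ell2" is "\<lambda>f x. - f x"
  by simp
definition minus_ell2 :: "'a ell2 \<Rightarrow> 'a ell2 \<Rightarrow> 'a ell2"
  where "minus_ell2 f g = f + (- g)"
definition scaleR_ell2 :: "real \<Rightarrow> 'a ell2 \<Rightarrow> 'a ell2"
  where "scaleR_ell2 r f = scaleC (complex_of_real r) f"
definition inner_ell2 :: "'a ell2 \<Rightarrow> 'a ell2 \<Rightarrow> real"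
  where "inner_ell2 f g = Re (cinner f g)"
definition norm_ell2 :: "'a ell2 \<Rightarrow> real"
  where "norm_ell2 f = sqrt (inner f f)"
definition dist_ell2 :: "'a ell2 \<Rightarrow> 'a ell2 \<Rightarrow> real"
  where "dist_ell2 f g = norm (f - g)"
definition sgn_ell2 :: "'a ell2 \<Rightarrow> 'a ell2"
  where "sgn_ell2 f = scaleR (inverse (norm f)) f"
definition uniformity_ell2 :: "('a ell2 \<times> 'a ell2) filter"
  where "uniformity_ell2 = (INF e\<in>{0<..}. principal {(x, y). dist x y < e})"
definition open_ell2 :: "'a ell2 set \<Rightarrow> bool"
  where "open_ell2 U = (\<forall>x\<in>U. eventually (\<lambda>(x', y). x' = x \<longrightarrow> y \<in> U) uniformity)"

instance
proof
  fix f g h :: "'a ell2" and r s :: real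
  show "f + g + h = f + (g + h)" "f + g = g + f" "0 + f = f" "- f + f = 0"
    by (transfer; simp add: algebra_simps fun_eq_iff)+
  show "f - g = f + - g" by (simp add: minus_ell2_def)
  show "r *\<^sub>R (f + g) = r *\<^sub>R f + r *\<^sub>R g" "(r + s) *\<^sub>R f = r *\<^sub>R f + s *\<^sub>R f"
    "r *\<^sub>R s *\<^sub>R f = (r * s) *\<^sub>R f" "1 *\<^sub>R f = f"
    unfolding scaleR_ell2_def by (transfer; simp add: algebra_simps)+
  show "dist f g = norm (f - g)" by (simp add: dist_ell2_def)
  show "sgn f = scaleR (inverse (norm f)) f" by (simp add: sgn_ell2_def)
  show "uniformity = (INF e\<in>{0<..}. principal {(x :: 'a ell2, y). dist x y < e})"
    by (simp add: uniformity_ell2_def)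
  show "open U = (\<forall>x\<in>U. eventually (\<lambda>(x', y). x' = x \<longrightarrow> y \<in> U) uniformity)" for U :: "'a ell2 set"
    by (simp add: open_ell2_def)
  have "cinner g f = cnj (cinner f g)"
    by transfer (simp flip: infsum_cnj add: mult.commute)
  then show "f \<bullet> g = g \<bullet> f" by (simp add: inner_ell2_def)
  have "cinner (f + g) h = cinner f h + cinner g h"
    by transfer (simp add: distrib_right infsum_add ell2_prod_summable)
  then show "(f + g) \<bullet> h = f \<bullet> h + g \<bullet> h" by (simp add: inner_ell2_def)
  have "cinner (scaleC (complex_of_real r) f) g = complex_of_real r * cinner f g"
    by transfer (simp add: mult.assoc infsum_cmult_right')
  then show "(r *\<^sub>R f) \<bullet> g = r * (f \<bullet> g)" by (simp add: inner_ell2_def scaleR_ell2_def)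
  note self = cinner_self [of f]
  show "0 \<le> f \<bullet> f"
    unfolding inner_ell2_def self by (simp add: infsum_nonneg)
  show "f \<bullet> f = 0 \<longleftrightarrow> f = 0"
  proof
    assume "f \<bullet> f = 0"
    then have z: "(\<Sum>\<^sub>\<infinity>x. (cmod (ell2_coeff f x))\<^sup>2) \<le> 0"
      unfolding inner_ell2_def self by simp
    have "(cmod (ell2_coeff f x))\<^sup>2 = 0" for x
      by (rule nonneg_infsum_le_0D [OF z]) (use ell2_coeff [of f] in auto)
    then show "f = 0" by (simp add: ell2_coeff_inject [symmetric] fun_eq_iff zero_ell2.rep_eq)
  next
    assume "f = 0"
    then have "ell2_coeff f x = 0" for x by (simp add: zero_ell2.rep_eq)
    then show "f \<bullet> f = 0" unfolding inner_ell2_def self by simp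
  qed
  show "norm f = sqrt (f \<bullet> f)" by (simp add: norm_ell2_def)
qed

end

lemma cinner_scaleC_left: "cinner (scaleC c f) g = c * cinner f g"
  by transfer (simp add: mult.assoc infsum_cmult_right')

lemma norm_ell2_eq: "norm f = sqrt (\<Sum>\<^sub>\<infinity>x. (cmod (ell2_coeff f x))\<^sup>2)"
  by (simp add: norm_ell2_def inner_ell2_def cinner_self)

lemma norm_scaleC: "norm (scaleC c f) = cmod c * norm f"
  by (simp add: norm_ell2_eq scaleC.rep_eq norm_mult power_mult_distrib infsum_cmult_right'
      real_sqrt_mult)

lemma bounded_linear_scaleC: "bounded_linear (scaleC c)"
proof (rule bounded_linear_intro [where K = "cmod c"])
  show "scaleC c (\<xi> + \<eta>) = scaleC c \<xi> + scaleC c \<eta>" for \<xi> \<eta> :: "'a ell2"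
    by transfer (simp add: algebra_simps)
  show "scaleC c (r *\<^sub>R \<xi>) = r *\<^sub>R scaleC c \<xi>" for r and \<xi> :: "'a ell2"
    unfolding scaleR_ell2_def by transfer (simp add: algebra_simps)
qed (simp add: norm_scaleC mult.commute)

definition scaleC_op :: "complex \<Rightarrow> 'a ell2 \<Rightarrow>\<^sub>L 'a ell2 \<Rightarrow> 'a ell2 \<Rightarrow>\<^sub>L 'a ell2"
  where "scaleC_op c x = Blinfun (\<lambda>\<xi>. scaleC c (x \<xi>))"

lemma scaleC_op_apply: "scaleC_op c x \<xi> = scaleC c (x \<xi>)"
  unfolding scaleC_op_def
  by (simp add: bounded_linear_Blinfun_apply bounded_linear_compose [OF bounded_linear_scaleC]
      blinfun.bounded_linear_right)

definition adj :: "'a ell2 \<Rightarrow>\<^sub>L 'a ell2 \<Rightarrow> 'a ell2 \<Rightarrow>\<^sub>L 'a ell2"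
  where "adj x = (THE y :: 'a ell2 \<Rightarrow>\<^sub>L 'a ell2. \<forall>\<xi> \<eta>. cinner (x \<xi>) \<eta> = cinner \<xi> (y \<eta>))"


section \<open>The group von Neumann algebra\<close>

text \<open>
  The elements of a group \<open>G\<close> form a subset \<open>carrier G\<close> of a type \<open>'a\<close>. The space \<open>\<ell>\<^sup>2(G)\<close> is
  identified with the closed subspace of \<^typ>\<open>'a ell2\<close> of vectors supported on \<open>carrier G\<close>, and an
  operator on \<open>\<ell>\<^sup>2(G)\<close> with its extension by 0 on the orthogonal complement. This preserves
  sums, products, scalar multiples, adjoints, operator norms, and closures in the strong operator
  topology. The unit of \<open>L(G)\<close> is thus \<open>u\<^sub>e\<close>, the projection onto \<open>\<ell>\<^sup>2(G)\<close>.
\<close>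

definition translate :: "('a, 'm) monoid_scheme \<Rightarrow> 'a \<Rightarrow> 'a ell2 \<Rightarrow> 'a ell2"
  where "translate G g \<xi> =
    Abs_ell2 (\<lambda>h. if h \<in> carrier G then ell2_coeff \<xi> (inv\<^bsub>G\<^esub> g \<otimes>\<^bsub>G\<^esub> h) else 0)"

definition left_regular :: "('a, 'm) monoid_scheme \<Rightarrow> 'a \<Rightarrow> 'a ell2 \<Rightarrow>\<^sub>L 'a ell2"
  where "left_regular G g = Blinfun (translate G g)"

lemma translate:
  assumes "group G" "g \<in> carrier G"
  shows ell2_coeff_translate: "ell2_coeff (translate G g \<xi>) h =
      (if h \<in> carrier G then ell2_coeff \<xi> (inv\<^bsub>G\<^esub> g \<otimes>\<^bsub>G\<^esub> h) else 0)"
    and norm_translate: "norm (translate G g \<xi>) \<le> norm \<xi>"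
proof -
  interpret group G by fact
  define f where "f = (\<lambda>h. if h \<in> carrier G then ell2_coeff \<xi> (inv\<^bsub>G\<^esub> g \<otimes>\<^bsub>G\<^esub> h) else 0)"
  have bij: "bij_betw (\<lambda>h. inv\<^bsub>G\<^esub> g \<otimes>\<^bsub>G\<^esub> h) (carrier G) (carrier G)"
    by (rule bij_betwI [where g = "\<lambda>h. g \<otimes>\<^bsub>G\<^esub> h"]) (use assms in \<open>auto simp: m_assoc [symmetric]\<close>)
  have sum: "(\<lambda>h. (cmod (ell2_coeff \<xi> h))\<^sup>2) summable_on UNIV"
    using ell2_coeff [of \<xi>] by simp
  then have sumG: "(\<lambda>h. (cmod (ell2_coeff \<xi> h))\<^sup>2) summable_on carrier G"
    by (rule summable_on_subset_banach) simp
  then have "(\<lambda>h. (cmod (ell2_coeff \<xi> (inv\<^bsub>G\<^esub> g \<otimes>\<^bsub>G\<^esub> h)))\<^sup>2) summable_on carrier G"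
    using summable_on_reindex_bij_betw [OF bij, of "\<lambda>h. (cmod (ell2_coeff \<xi> h))\<^sup>2"] by simp
  then have "(\<lambda>h. (cmod (f h))\<^sup>2) summable_on UNIV"
    by (rule summable_on_cong_neutral [THEN iffD1, rotated 3]) (auto simp: f_def)
  then have rep: "ell2_coeff (translate G g \<xi>) = f"
    unfolding translate_def f_def [symmetric] by (simp add: Abs_ell2_inverse)
  then show "ell2_coeff (translate G g \<xi>) h =
      (if h \<in> carrier G then ell2_coeff \<xi> (inv\<^bsub>G\<^esub> g \<otimes>\<^bsub>G\<^esub> h) else 0)"
    by (simp add: f_def)
  have "(\<Sum>\<^sub>\<infinity>h. (cmod (f h))\<^sup>2) = (\<Sum>\<^sub>\<infinity>h\<in>carrier G. (cmod (ell2_coeff \<xi> (inv\<^bsub>G\<^esub> g \<otimes>\<^bsub>G\<^esub> h)))\<^sup>2)"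
    by (rule infsum_cong_neutral) (auto simp: f_def)
  also have "\<dots> = (\<Sum>\<^sub>\<infinity>h\<in>carrier G. (cmod (ell2_coeff \<xi> h))\<^sup>2)"
    by (rule infsum_reindex_bij_betw [OF bij])
  also have "\<dots> \<le> (\<Sum>\<^sub>\<infinity>h. (cmod (ell2_coeff \<xi> h))\<^sup>2)"
    by (rule infsum_mono_neutral) (use sum sumG in auto)
  finally show "norm (translate G g \<xi>) \<le> norm \<xi>"
    by (simp add: norm_ell2_eq rep)
qed

lemma left_regular_apply:
  assumes "group G" "g \<in> carrier G"
  shows "left_regular G g \<xi> = translate G g \<xi>"
proof -
  have "bounded_linear (translate G g)"
  proof (rule bounded_linear_intro [where K = 1])
    show "translate G g (\<xi> + \<eta>) = translate G g \<xi> + translate G g \<eta>" for \<xi> \<eta>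
      by (simp add: ell2_coeff_inject [symmetric] fun_eq_iff ell2_coeff_translate [OF assms]
          plus_ell2.rep_eq)
    show "translate G g (r *\<^sub>R \<xi>) = r *\<^sub>R translate G g \<xi>" for r \<xi>
      by (simp add: ell2_coeff_inject [symmetric] fun_eq_iff ell2_coeff_translate [OF assms]
          scaleR_ell2_def scaleC.rep_eq)
  qed (simp add: norm_translate [OF assms])
  then show ?thesis
    by (simp add: left_regular_def bounded_linear_Blinfun_apply)
qed

lemma left_regular_delta:
  assumes "group G" "g \<in> carrier G" "h \<in> carrier G"
  shows "left_regular G g (delta h) = delta (g \<otimes>\<^bsub>G\<^esub> h)"
proof -
  interpret group G by fact
  have "inv\<^bsub>G\<^esub> g \<otimes>\<^bsub>G\<^esub> k = h \<longleftrightarrow> k = g \<otimes>\<^bsub>G\<^esub> h" if "k \<in> carrier G" for k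
    using assms that inv_solve_left' by auto
  then show ?thesis
    using assms by (auto simp: left_regular_apply ell2_coeff_inject [symmetric] fun_eq_iff
        ell2_coeff_translate delta.rep_eq)
qed

definition group_algebra :: "('a, 'm) monoid_scheme \<Rightarrow> ('a ell2 \<Rightarrow>\<^sub>L 'a ell2) set"
  where "group_algebra G =
    {\<Sum>g\<in>F. scaleC_op (c g) (left_regular G g) | F c. finite F \<and> F \<subseteq> carrier G}"

definition group_vna :: "('a, 'm) monoid_scheme \<Rightarrow> ('a ell2 \<Rightarrow>\<^sub>L 'a ell2) set"
  where "group_vna G = Abstract_Topology.closure_of strong_operator_topology (group_algebra G)"

definition tr :: "('a, 'm) monoid_scheme \<Rightarrow> 'a ell2 \<Rightarrow>\<^sub>L 'a ell2 \<Rightarrow> complex"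
  where "tr G x = cinner (x (delta \<one>\<^bsub>G\<^esub>)) (delta \<one>\<^bsub>G\<^esub>)"

definition norm2 :: "('a, 'm) monoid_scheme \<Rightarrow> 'a ell2 \<Rightarrow>\<^sub>L 'a ell2 \<Rightarrow> real"
  where "norm2 G x = sqrt (Re (tr G (adj x o\<^sub>L x)))"

primrec vna_fun_interp ::
    "('a, 'm) monoid_scheme \<Rightarrow> vna_fun \<Rightarrow> ('a ell2 \<Rightarrow>\<^sub>L 'a ell2) list \<Rightarrow> 'a ell2 \<Rightarrow>\<^sub>L 'a ell2" where
  "vna_fun_interp G VZero xs = 0"
| "vna_fun_interp G VOne xs = left_regular G \<one>\<^bsub>G\<^esub>"
| "vna_fun_interp G (VAdd m n) xs = xs ! 0 + xs ! 1"
| "vna_fun_interp G (VMult m n) xs = xs ! 0 o\<^sub>L xs ! 1"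
| "vna_fun_interp G (VScale c n) xs = scaleC_op c (xs ! 0)"
| "vna_fun_interp G (VAdj n) xs = adj (xs ! 0)"
| "vna_fun_interp G (VIncl n k) xs = xs ! 0"

definition group_vna_structure ::
    "('a, 'm) monoid_scheme \<Rightarrow> (nat, vna_fun, vna_pred, 'a ell2 \<Rightarrow>\<^sub>L 'a ell2) metric_structure"
  where "group_vna_structure G =
    \<lparr> sort_of = (\<lambda>n. {x \<in> group_vna G. norm x \<le> real n}),
      fun_interp = vna_fun_interp G,
      pred_interp = (\<lambda>P xs. case P of VDist n \<Rightarrow> norm2 G (xs ! 0 - xs ! 1)) \<rparr>"

end

theory Submission
  imports Defs
begin

text \<open>
  An element of the group algebra \<open>\<complex>[G]\<close> is the value \<open>p(g) = \<Sum>\<^sub>j c\<^sub>j u\<^bsub>w\<^sub>j(g)\<^esub>\<close> of a formal linear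
  combination \<open>p\<close> of group words at a finite tuple \<open>g\<close> from \<open>G\<close>. The idea of the proof is to play the
  metric game on \<open>L(G)\<close> and \<open>L(H)\<close> with such elements only: a tuple \<open>e\<close> of new group elements in
  \<open>G\<close> is answered by a tuple \<open>f\<close> in \<open>H\<close> according to the classical game, and then \<open>p(g,e)\<close> is
  answered by \<open>p(h,f)\<close>.

  This works for the following reasons. The trace of \<open>p(g)\<close>, and hence the 2-norm of any *-polynomial
  in such elements, is determined by the quantifier-free type of \<open>g\<close> (\<open>norm2_gpoly_eq\<close>). So the basic
  formulas agree at tuples \<open>p(g)\<close> and \<open>p(h)\<close> (\<open>r_zero_gpoly_tuple\<close>). The answer must lie in
  the same operator norm ball. The operator norm is a supremum over finitely supported vectors,
  and one further classical round, the summand 1 in \<open>1 + \<alpha>\<close>, matches their supports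
  (\<open>norm_gpoly_transfer\<close>). Finally, an arbitrary element of a ball of \<open>L(G)\<close> is approximated in the 2-norm by
  elements of \<open>\<complex>[G]\<close> in the same ball, by the density theorem of Kaplansky (\<open>kaplansky\<close>). The distances
  \<open>r\<^sub>\<alpha>\<close> tolerate this because they are uniformly continuous with modulus \<open>\<Omega>\<close>
  (\<open>r_dist_obeys_modulus\<close>).

  The density theorem is proved directly for the algebra of operators commuting with right
  translations, which contains \<open>L(G)\<close>. In this algebra \<open>\<parallel>x\<parallel>\<^sub>2 = \<parallel>x\<^sup>*\<parallel>\<^sub>2\<close>, and approximation in the
  2-norm without control of the operator norm is trivial, since finitely supported vectors are
  dense in \<open>\<ell>\<^sup>2(G)\<close>. The operator norm is then controlled by means of the function \<open>2 y (1 + y\<^sup>*y)\<^sup>-\<^sup>1\<close>. Only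
  polynomial approximations of it are used, which avoids the continuous functional calculus.
\<close>

section \<open>Square-summable functions\<close>

lemma cinner_eq_inner: "cinner f g = Complex (f \<bullet> g) (scaleC (- \<i>) f \<bullet> g)"
  by (simp add: complex_eq_iff inner_ell2_def cinner_scaleC_left)

lemma cinner_add_left: "cinner (f + g) h = cinner f h + cinner g h"
proof -
  have "scaleC (- \<i>) (f + g) = scaleC (- \<i>) f + scaleC (- \<i>) g"
    by (rule bounded_linear_scaleC [THEN bounded_linear.linear, THEN linear_add])
  then show ?thesis
    by (simp add: cinner_eq_inner inner_add_left complex_eq_iff)
qed

lemma cinner_commute: "cinner g f = cnj (cinner f g)"
  by transfer (simp flip: infsum_cnj add: mult.commute)

lemma cinner_scaleC_right: "cinner f (scaleC c g) = cnj c * cinner f g"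
  by (subst (1 2) cinner_commute) (simp add: cinner_scaleC_left)

lemma cinner_delta_right: "cinner f (delta a) = ell2_coeff f a"
proof -
  have "cinner f (delta a) = (\<Sum>\<^sub>\<infinity>x. ell2_coeff f x * cnj (if x = a then 1 else 0))"
    by transfer simp
  also have "\<dots> = (\<Sum>\<^sub>\<infinity>x\<in>{a}. ell2_coeff f x)"
    by (rule infsum_cong_neutral) auto
  finally show ?thesis by simp
qed

lemma cinner_delta_left: "cinner (delta a) f = cnj (ell2_coeff f a)"
  by (subst cinner_commute) (simp add: cinner_delta_right)

lemma ell2_eqI: "(\<And>x. ell2_coeff f x = ell2_coeff g x) \<Longrightarrow> f = g"
  by (simp add: ell2_coeff_inject [symmetric] fun_eq_iff)

lemma ell2_coeff_add: "ell2_coeff (f + g) x = ell2_coeff f x + ell2_coeff g x"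
  and ell2_coeff_zero: "ell2_coeff 0 x = 0"
  and ell2_coeff_scaleC: "ell2_coeff (scaleC c f) x = c * ell2_coeff f x"
  and ell2_coeff_delta: "ell2_coeff (delta a) x = (if x = a then 1 else 0)"
  and ell2_coeff_uminus: "ell2_coeff (- f) x = - ell2_coeff f x"
  by (simp_all only: plus_ell2.rep_eq zero_ell2.rep_eq scaleC.rep_eq delta.rep_eq uminus_ell2.rep_eq)

lemma ell2_coeff_diff: "ell2_coeff (f - g) x = ell2_coeff f x - ell2_coeff g x"
  unfolding minus_ell2_def ell2_coeff_add ell2_coeff_uminus by simp

lemma ell2_coeff_scaleR: "ell2_coeff (r *\<^sub>R f) x = r * ell2_coeff f x"
  by (simp add: scaleR_ell2_def ell2_coeff_scaleC)

lemma ell2_coeff_sum: "ell2_coeff (\<Sum>i\<in>I. f i) x = (\<Sum>i\<in>I. ell2_coeff (f i) x)"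
  by (induction I rule: infinite_finite_induct) (auto simp: ell2_coeff_zero ell2_coeff_add)

lemmas ell2_coeff_simps = ell2_coeff_add ell2_coeff_zero ell2_coeff_scaleC ell2_coeff_delta
  ell2_coeff_uminus ell2_coeff_diff ell2_coeff_scaleR ell2_coeff_sum

lemma scaleC_add: "scaleC c (f + g) = scaleC c f + scaleC c g"
  and scaleC_diff: "scaleC c (f - g) = scaleC c f - scaleC c g"
  and scaleC_scaleC: "scaleC c (scaleC d f) = scaleC (c * d) f"
  and scaleC_zero: "scaleC c 0 = 0"
  by (rule ell2_eqI; simp add: ell2_coeff_simps algebra_simps)+

lemma summable_ell2_coeff: "(\<lambda>x. (cmod (ell2_coeff f x))\<^sup>2) summable_on A"
  using ell2_coeff [of f] summable_on_subset_banach by blast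

lemma norm_ell2_square: "(norm f)\<^sup>2 = (\<Sum>\<^sub>\<infinity>x. (cmod (ell2_coeff f x))\<^sup>2)"
  by (simp add: norm_ell2_eq infsum_nonneg)

lemma norm_delta: "norm (delta a) = 1"
proof -
  have "Re (cinner (delta a) (delta a)) = 1"
    by (simp add: cinner_delta_right ell2_coeff_simps)
  then show ?thesis by (simp add: norm_ell2_def inner_ell2_def)
qed

lemma ell2_coeff_truncate:
  "ell2_coeff (\<Sum>h\<in>F. scaleC (c h) (delta h)) x = (if finite F \<and> x \<in> F then c x else 0)"
  by (cases "finite F") (auto simp: ell2_coeff_simps if_distrib sum.delta cong: if_cong)

lemma norm_finite_support:
  assumes "finite F"
  shows "(norm (\<Sum>h\<in>F. scaleC (c h) (delta h)))\<^sup>2 = (\<Sum>h\<in>F. (cmod (c h))\<^sup>2)"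
proof -
  have "(norm (\<Sum>h\<in>F. scaleC (c h) (delta h)))\<^sup>2 = (\<Sum>\<^sub>\<infinity>x\<in>F. (cmod (c x))\<^sup>2)"
    unfolding norm_ell2_square ell2_coeff_truncate
    by (rule infsum_cong_neutral) (use assms in auto)
  then show ?thesis using assms by simp
qed

text \<open>The vectors \<open>\<delta>\<^sub>h\<close> form an orthonormal basis.\<close>

lemma has_sum_deltas: "((\<lambda>h. scaleC (ell2_coeff f h) (delta h)) has_sum f) UNIV"
  unfolding has_sum_def tendsto_iff eventually_finite_subsets_at_top
proof (intro allI impI)
  fix e :: real assume "e > 0"
  let ?s = "\<lambda>F. \<Sum>h\<in>F. scaleC (ell2_coeff f h) (delta h)"
  have "((\<lambda>x. (cmod (ell2_coeff f x))\<^sup>2) has_sum (norm f)\<^sup>2) UNIV"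
    unfolding norm_ell2_square by (rule has_sum_infsum [OF summable_ell2_coeff])
  then obtain X where X: "finite X"
    and close: "\<And>Y. finite Y \<Longrightarrow> X \<subseteq> Y \<Longrightarrow> dist (\<Sum>x\<in>Y. (cmod (ell2_coeff f x))\<^sup>2) ((norm f)\<^sup>2) < e\<^sup>2"
    unfolding has_sum_def tendsto_iff eventually_finite_subsets_at_top using \<open>e > 0\<close>
    by (metis subset_UNIV zero_less_power)
  have "dist (?s Y) f < e" if "finite Y" "X \<subseteq> Y" for Y
  proof -
    have sub: "ell2_coeff (f - ?s Y) x = (if x \<in> Y then 0 else ell2_coeff f x)" for x
      using \<open>finite Y\<close> by (simp add: ell2_coeff_diff ell2_coeff_truncate)
    have "(norm (f - ?s Y))\<^sup>2 = (\<Sum>\<^sub>\<infinity>x\<in>UNIV - Y. (cmod (ell2_coeff f x))\<^sup>2)"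
      unfolding norm_ell2_square sub by (rule infsum_cong_neutral) auto
    also have "\<dots> = (norm f)\<^sup>2 - (\<Sum>x\<in>Y. (cmod (ell2_coeff f x))\<^sup>2)"
      unfolding norm_ell2_square
      by (subst infsum_Diff) (use \<open>finite Y\<close> in \<open>auto intro: summable_ell2_coeff\<close>)
    also have "\<dots> < e\<^sup>2"
      using close [OF that] by (auto simp: dist_real_def)
    finally show ?thesis
      using \<open>e > 0\<close> by (metis dist_commute dist_norm power_less_imp_less_base less_imp_le)
  qed
  then show "\<exists>X. finite X \<and> X \<subseteq> UNIV \<and>
      (\<forall>Y. finite Y \<and> X \<subseteq> Y \<and> Y \<subseteq> UNIV \<longrightarrow> dist (?s Y) f < e)"
    using X by blast
qed


section \<open>Adjoints of operators\<close>

text \<open>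
  Operators are continuous and real-linear by their type. Adjoints with respect to \<^const>\<open>cinner\<close>
  exist only for the complex-linear ones.
\<close>

definition complex_linear :: "('a ell2 \<Rightarrow>\<^sub>L 'a ell2) \<Rightarrow> bool"
  where "complex_linear x \<longleftrightarrow> (\<forall>c \<xi>. x (scaleC c \<xi>) = scaleC c (x \<xi>))"

lemma adj_eqI:
  fixes x y :: "'a ell2 \<Rightarrow>\<^sub>L 'a ell2"
  assumes "\<And>\<xi> \<eta>. cinner (x \<xi>) \<eta> = cinner \<xi> (y \<eta>)"
  shows "adj x = y"
  unfolding adj_def
proof (rule the_equality)
  show "\<forall>\<xi> \<eta>. cinner (x \<xi>) \<eta> = cinner \<xi> (y \<eta>)" using assms by blast
  fix z :: "'a ell2 \<Rightarrow>\<^sub>L 'a ell2" assume z: "\<forall>\<xi> \<eta>. cinner (x \<xi>) \<eta> = cinner \<xi> (z \<eta>)"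
  show "z = y"
  proof (rule blinfun_eqI, rule ell2_eqI)
    fix \<eta> h
    have "cinner (delta h) (z \<eta>) = cinner (delta h) (y \<eta>)" using z assms by metis
    then show "ell2_coeff (z \<eta>) h = ell2_coeff (y \<eta>) h" by (simp add: cinner_delta_left)
  qed
qed

text \<open>
  The adjoint of \<open>x\<close> is given by its matrix coefficients; the vector of coefficients is
  square-summable by testing \<open>x\<close> on its finite truncations.
\<close>

lemma adjoint_exists:
  fixes x :: "'a ell2 \<Rightarrow>\<^sub>L 'a ell2"
  assumes x: "complex_linear x"
  obtains y :: "'a ell2 \<Rightarrow>\<^sub>L 'a ell2"
  where "\<And>\<xi> \<eta>. cinner (x \<xi>) \<eta> = cinner \<xi> (y \<eta>)" "\<And>\<eta>. norm (y \<eta>) \<le> norm x * norm \<eta>"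
proof -
  define c where "c \<eta> h = cinner \<eta> (x (delta h))" for \<eta> :: "'a ell2" and h
  \<comment> \<open>\<open>\<zeta>\<close> below is the truncation to \<open>F\<close> of the prospective vector \<open>x\<^sup>*\<eta>\<close>\<close>
  have bound: "(\<Sum>h\<in>F. (cmod (c \<eta> h))\<^sup>2) \<le> (norm x * norm \<eta>)\<^sup>2" if "finite F" for F \<eta>
  proof -
    define s where "s = (\<Sum>h\<in>F. (cmod (c \<eta> h))\<^sup>2)"
    define \<zeta> where "\<zeta> = (\<Sum>h\<in>F. scaleC (c \<eta> h) (delta h))"
    have "s \<ge> 0" unfolding s_def by (rule sum_nonneg) simp
    have \<zeta>: "(norm \<zeta>)\<^sup>2 = s"
      unfolding \<zeta>_def s_def by (rule norm_finite_support [OF that])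
    have "x \<zeta> \<bullet> \<eta> = (\<Sum>h\<in>F. scaleC (c \<eta> h) (x (delta h)) \<bullet> \<eta>)"
      using x by (simp add: \<zeta>_def blinfun.sum_right inner_sum_left complex_linear_def)
    also have "\<dots> = (\<Sum>h\<in>F. (cmod (c \<eta> h))\<^sup>2)"
    proof (rule sum.cong [OF refl])
      fix h
      have "cinner (scaleC (c \<eta> h) (x (delta h))) \<eta> = c \<eta> h * cnj (c \<eta> h)"
        by (simp add: cinner_scaleC_left c_def cinner_commute [of \<eta> "x (delta h)"])
      then show "scaleC (c \<eta> h) (x (delta h)) \<bullet> \<eta> = (cmod (c \<eta> h))\<^sup>2"
        by (simp add: inner_ell2_def complex_mult_cnj cmod_power2)
    qed
    finally have "s = x \<zeta> \<bullet> \<eta>" by (simp add: s_def)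
    also have "\<dots> \<le> norm (x \<zeta>) * norm \<eta>" by (rule norm_cauchy_schwarz)
    also have "\<dots> \<le> (norm x * norm \<zeta>) * norm \<eta>"
      by (intro mult_right_mono norm_blinfun norm_ge_zero)
    finally have "norm \<zeta> * norm \<zeta> \<le> norm \<zeta> * (norm x * norm \<eta>)"
      using \<zeta> by (simp add: power2_eq_square mult_ac)
    then have "norm \<zeta> \<le> norm x * norm \<eta>"
      by (cases "norm \<zeta> = 0") (auto simp: mult_le_cancel_left)
    then have "(norm \<zeta>)\<^sup>2 \<le> (norm x * norm \<eta>)\<^sup>2" by (rule power_mono) simp
    then show ?thesis by (simp add: \<zeta> s_def)
  qed
  have summ: "(\<lambda>h. (cmod (c \<eta> h))\<^sup>2) summable_on UNIV" for \<eta>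
    by (rule nonneg_bdd_above_summable_on) (auto intro!: bdd_aboveI2 bound)
  define Y where "Y \<eta> = Abs_ell2 (c \<eta>)" for \<eta>
  have coeff: "ell2_coeff (Y \<eta>) = c \<eta>" for \<eta>
    unfolding Y_def by (rule Abs_ell2_inverse) (use summ in simp)
  have normY: "norm (Y \<eta>) \<le> norm x * norm \<eta>" for \<eta>
  proof (rule power2_le_imp_le)
    show "(norm (Y \<eta>))\<^sup>2 \<le> (norm x * norm \<eta>)\<^sup>2"
      unfolding norm_ell2_square coeff
      by (rule infsum_le_finite_sums [OF summ]) (use bound in auto)
  qed simp
  have "bounded_linear Y"
  proof (rule bounded_linear_intro [where K = "norm x"])
    show "Y (\<xi> + \<eta>) = Y \<xi> + Y \<eta>" for \<xi> \<eta>
      by (rule ell2_eqI) (simp add: coeff ell2_coeff_simps c_def cinner_add_left)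
    show "Y (r *\<^sub>R \<eta>) = r *\<^sub>R Y \<eta>" for r \<eta>
      by (rule ell2_eqI) (simp add: coeff ell2_coeff_simps c_def scaleR_ell2_def cinner_scaleC_left)
    show "norm (Y \<eta>) \<le> norm \<eta> * norm x" for \<eta> using normY by (simp add: mult.commute)
  qed
  then obtain y where y: "\<And>\<eta>. blinfun_apply y \<eta> = Y \<eta>"
    by (metis bounded_linear_Blinfun_apply)
  have yc: "scaleC a (Y \<eta>) = Y (scaleC a \<eta>)" for a \<eta>
    by (rule ell2_eqI) (simp add: coeff ell2_coeff_simps c_def cinner_scaleC_left)
  have real: "x \<xi> \<bullet> \<eta> = \<xi> \<bullet> Y \<eta>" for \<xi> \<eta>
  proof -
    let ?t = "\<lambda>h. scaleC (ell2_coeff \<xi> h) (delta h)"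
    have "bounded_linear (\<lambda>\<xi>. x \<xi> \<bullet> \<eta>)" "bounded_linear (\<lambda>\<xi>. \<xi> \<bullet> Y \<eta>)"
      by (intro bounded_linear_intros)+
    then have sums: "((\<lambda>h. x (?t h) \<bullet> \<eta>) has_sum (x \<xi> \<bullet> \<eta>)) UNIV"
      "((\<lambda>h. ?t h \<bullet> Y \<eta>) has_sum (\<xi> \<bullet> Y \<eta>)) UNIV"
      by (auto intro: has_sum_bounded_linear [OF _ has_sum_deltas])
    have "x (?t h) \<bullet> \<eta> = ?t h \<bullet> Y \<eta>" for h
    proof -
      have "cinner (x (delta h)) \<eta> = cnj (c \<eta> h)"
        unfolding c_def by (rule cinner_commute)
      then show ?thesis
        using x by (simp add: inner_ell2_def complex_linear_def cinner_scaleC_left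
            cinner_delta_left coeff)
    qed
    then show ?thesis using has_sum_unique sums by simp
  qed
  have "cinner (x \<xi>) \<eta> = cinner \<xi> (y \<eta>)" for \<xi> \<eta>
    using x unfolding cinner_eq_inner y complex_linear_def by (metis real)
  then show thesis using that y normY by metis
qed

lemma
  fixes x :: "'a ell2 \<Rightarrow>\<^sub>L 'a ell2"
  assumes "complex_linear x"
  shows cinner_adj: "cinner (x \<xi>) \<eta> = cinner \<xi> (adj x \<eta>)"
    and norm_adj_apply: "norm (adj x \<eta>) \<le> norm x * norm \<eta>"
proof -
  obtain y where y: "\<And>\<xi> \<eta>. cinner (x \<xi>) \<eta> = cinner \<xi> (blinfun_apply y \<eta>)"
    "\<And>\<eta>. norm (blinfun_apply y \<eta>) \<le> norm x * norm \<eta>"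
    using adjoint_exists [OF assms] by blast
  then have "adj x = y" by (intro adj_eqI)
  with y show "cinner (x \<xi>) \<eta> = cinner \<xi> (adj x \<eta>)" "norm (adj x \<eta>) \<le> norm x * norm \<eta>"
    by simp_all
qed

lemma inner_adj: "complex_linear (x :: 'a ell2 \<Rightarrow>\<^sub>L 'a ell2) \<Longrightarrow> x \<xi> \<bullet> \<eta> = \<xi> \<bullet> adj x \<eta>"
  by (simp add: inner_ell2_def cinner_adj)

lemma norm_adj: "complex_linear x \<Longrightarrow> norm (adj x) \<le> norm x"
  by (rule norm_blinfun_bound) (use norm_adj_apply in auto)

lemma complex_linear_adj: "complex_linear x \<Longrightarrow> complex_linear (adj x)"
  unfolding complex_linear_def [of "adj x"]
proof (intro allI ell2_eqI)
  fix c \<xi> h assume "complex_linear x"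
  then have "cinner (delta h) (adj x (scaleC c \<xi>)) = cinner (delta h) (scaleC c (adj x \<xi>))"
    by (simp flip: cinner_adj add: cinner_scaleC_right)
  then show "ell2_coeff (adj x (scaleC c \<xi>)) h = ell2_coeff (scaleC c (adj x \<xi>)) h"
    by (simp add: cinner_delta_left)
qed

lemma adj_adj: "complex_linear x \<Longrightarrow> adj (adj x) = x"
  by (rule adj_eqI) (metis cinner_adj cinner_commute)

lemma complex_linear_add: "complex_linear x \<Longrightarrow> complex_linear y \<Longrightarrow> complex_linear (x + y)"
  and complex_linear_diff: "complex_linear x \<Longrightarrow> complex_linear y \<Longrightarrow> complex_linear (x - y)"
  and complex_linear_zero: "complex_linear 0"
  and complex_linear_scaleC: "complex_linear x \<Longrightarrow> complex_linear (scaleC_op c x)"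
  and complex_linear_compose: "complex_linear x \<Longrightarrow> complex_linear y \<Longrightarrow> complex_linear (x o\<^sub>L y)"
  by (auto simp: complex_linear_def blinfun.add_left blinfun.diff_left scaleC_add scaleC_diff
      scaleC_op_apply scaleC_scaleC scaleC_zero mult.commute)

lemma cinner_add_right: "cinner h (f + g) = cinner h f + cinner h g"
  by (subst (1 2 3) cinner_commute) (simp add: cinner_add_left)

lemma adj_add: "complex_linear x \<Longrightarrow> complex_linear y \<Longrightarrow> adj (x + y) = adj x + adj y"
  by (rule adj_eqI) (simp add: blinfun.add_left cinner_add_left cinner_add_right cinner_adj)

lemma adj_scaleC: "complex_linear x \<Longrightarrow> adj (scaleC_op c x) = scaleC_op (cnj c) (adj x)"
  by (rule adj_eqI) (simp add: scaleC_op_apply cinner_scaleC_left cinner_scaleC_right cinner_adj)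

lemma adj_compose:
  "complex_linear x \<Longrightarrow> complex_linear y \<Longrightarrow> adj (x o\<^sub>L y) = adj y o\<^sub>L adj x"
  by (rule adj_eqI) (simp add: cinner_adj)

lemma minus_op_eq: "x - y = x + scaleC_op (- 1) y"
  by (rule blinfun_eqI, rule ell2_eqI)
    (simp add: blinfun.diff_left blinfun.add_left scaleC_op_apply ell2_coeff_simps)

lemma scaleR_op_eq: "r *\<^sub>R x = scaleC_op (complex_of_real r) x"
  by (rule blinfun_eqI) (simp add: blinfun.scaleR_left scaleC_op_apply scaleR_ell2_def)

lemma adj_diff: "complex_linear x \<Longrightarrow> complex_linear y \<Longrightarrow> adj (x - y) = adj x - adj y"
  by (simp add: minus_op_eq adj_add adj_scaleC complex_linear_scaleC)

lemma scaleC_op_add: "scaleC_op c (x + y) = scaleC_op c x + scaleC_op c y"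
  and scaleC_op_add_scalar: "scaleC_op (c + d) x = scaleC_op c x + scaleC_op d x"
  and scaleC_op_zero: "scaleC_op c 0 = 0"
  and scaleC_op_zero_scalar: "scaleC_op 0 x = 0"
  and scaleC_op_scaleC_op: "scaleC_op c (scaleC_op d x) = scaleC_op (c * d) x"
  and scaleC_op_compose_left: "scaleC_op c x o\<^sub>L y = scaleC_op c (x o\<^sub>L y)"
  by (rule blinfun_eqI, rule ell2_eqI,
      simp add: scaleC_op_apply blinfun.add_left ell2_coeff_simps algebra_simps)+

lemma scaleC_op_compose_right: "complex_linear x \<Longrightarrow> x o\<^sub>L scaleC_op c y = scaleC_op c (x o\<^sub>L y)"
  by (rule blinfun_eqI) (simp add: scaleC_op_apply complex_linear_def)

lemma scaleC_op_one: "scaleC_op 1 x = x"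
  by (rule blinfun_eqI, rule ell2_eqI) (simp add: scaleC_op_apply ell2_coeff_simps)

lemma norm_scaleC_op: "norm (scaleC_op c x) \<le> cmod c * norm x"
proof (rule norm_blinfun_bound)
  show "norm (scaleC_op c x \<xi>) \<le> cmod c * norm x * norm \<xi>" for \<xi>
    by (simp add: scaleC_op_apply norm_scaleC mult.assoc mult_left_mono norm_blinfun)
qed simp

lemma blinfun_compose_add_left: "(x + y) o\<^sub>L z = (x o\<^sub>L z) + (y o\<^sub>L z)"
  and blinfun_compose_add_right: "x o\<^sub>L (y + z) = (x o\<^sub>L y) + (x o\<^sub>L z)"
  and blinfun_compose_diff_left: "(x - y) o\<^sub>L z = (x o\<^sub>L z) - (y o\<^sub>L z)"
  and blinfun_compose_diff_right: "x o\<^sub>L (y - z) = (x o\<^sub>L y) - (x o\<^sub>L z)"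
  by (rule blinfun_eqI, simp add: blinfun.bilinear_simps)+

lemma norm_ell2_coeff_le: "cmod (ell2_coeff f x) \<le> norm f"
proof -
  have "(\<Sum>\<^sub>\<infinity>y\<in>{x}. (cmod (ell2_coeff f y))\<^sup>2) \<le> (norm f)\<^sup>2"
    unfolding norm_ell2_square by (rule infsum_mono_neutral) (auto intro: summable_ell2_coeff)
  then have "(cmod (ell2_coeff f x))\<^sup>2 \<le> (norm f)\<^sup>2" by simp
  then show ?thesis by (rule power2_le_imp_le) simp
qed

lemma continuous_ell2_coeff: "continuous_on UNIV (\<lambda>f. ell2_coeff f x)"
proof -
  have "bounded_linear (\<lambda>f. ell2_coeff f x)"
    by (rule bounded_linear_intro [where K = 1])
      (auto simp: ell2_coeff_simps norm_ell2_coeff_le scaleR_conv_of_real)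
  then show ?thesis by (rule linear_continuous_on)
qed


section \<open>Right-invariant operators\<close>

text \<open>
  These are the complex-linear operators on \<open>\<ell>\<^sup>2(G)\<close> whose matrix coefficients are invariant under right
  translation, which are the operators commuting with the right regular representation. As in the
  case of \<open>L(G)\<close>, an operator on \<open>\<ell>\<^sup>2(G)\<close> is extended by 0 to all of \<^typ>\<open>'a ell2\<close>.
\<close>

definition right_invariant :: "('a, 'm) monoid_scheme \<Rightarrow> ('a ell2 \<Rightarrow>\<^sub>L 'a ell2) set"
  where "right_invariant G = {x. complex_linear x \<and>
    (\<forall>\<xi> k. k \<notin> carrier G \<longrightarrow> ell2_coeff (x \<xi>) k = 0) \<and>
    (\<forall>h. h \<notin> carrier G \<longrightarrow> x (delta h) = 0) \<and>
    (\<forall>g\<in>carrier G. \<forall>h\<in>carrier G. \<forall>k\<in>carrier G.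
       ell2_coeff (x (delta (h \<otimes>\<^bsub>G\<^esub> g))) (k \<otimes>\<^bsub>G\<^esub> g) = ell2_coeff (x (delta h)) k)}"

lemma right_invariantD:
  assumes "x \<in> right_invariant G"
  shows "complex_linear x"
    and "k \<notin> carrier G \<Longrightarrow> ell2_coeff (x \<xi>) k = 0"
    and "h \<notin> carrier G \<Longrightarrow> x (delta h) = 0"
    and "\<lbrakk>g \<in> carrier G; h \<in> carrier G; k \<in> carrier G\<rbrakk> \<Longrightarrow>
      ell2_coeff (x (delta (h \<otimes>\<^bsub>G\<^esub> g))) (k \<otimes>\<^bsub>G\<^esub> g) = ell2_coeff (x (delta h)) k"
  using assms by (auto simp: right_invariant_def)

lemma
  assumes "x \<in> right_invariant G"
  shows right_invariant_scaleC: "scaleC_op c x \<in> right_invariant G"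
    and right_invariant_add: "y \<in> right_invariant G \<Longrightarrow> x + y \<in> right_invariant G"
    and right_invariant_diff: "y \<in> right_invariant G \<Longrightarrow> x - y \<in> right_invariant G"
    and right_invariant_scaleR: "r *\<^sub>R x \<in> right_invariant G"
proof -
  show sc: "scaleC_op c x \<in> right_invariant G" for c
    using assms by (auto simp: right_invariant_def complex_linear_scaleC scaleC_op_apply
        ell2_coeff_simps scaleC_zero)
  then show "r *\<^sub>R x \<in> right_invariant G"
    by (simp add: scaleR_op_eq)
  show "x + y \<in> right_invariant G" if "y \<in> right_invariant G"
    using assms that by (auto simp: right_invariant_def complex_linear_add blinfun.add_left
        ell2_coeff_simps)
  show "x - y \<in> right_invariant G" if "y \<in> right_invariant G"
    using assms that by (auto simp: right_invariant_def complex_linear_diff blinfun.diff_left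
        ell2_coeff_simps)
qed

lemma right_invariant_zero: "0 \<in> right_invariant G"
  by (auto simp: right_invariant_def complex_linear_zero ell2_coeff_simps)

lemma norm2_eq: "complex_linear x \<Longrightarrow> norm2 G x = norm (x (delta \<one>\<^bsub>G\<^esub>))"
  unfolding norm2_def tr_def norm_ell2_def inner_ell2_def
  by (subst cinner_commute) (simp flip: cinner_adj)

lemma ell2_coeff_adj:
  "complex_linear x \<Longrightarrow> ell2_coeff (adj x (delta h)) k = cnj (ell2_coeff (x (delta k)) h)"
  by (metis cinner_adj cinner_commute cinner_delta_left cinner_delta_right)

context group
begin

lemma right_invariant_adj:
  assumes x: "x \<in> right_invariant G"
  shows "adj x \<in> right_invariant G"
proof -
  have cl: "complex_linear x" by (rule right_invariantD [OF x])
  have "ell2_coeff (adj x \<xi>) k = 0" if "k \<notin> carrier G" for \<xi> k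
  proof -
    have "cinner (x (delta k)) \<xi> = cinner (delta k) (adj x \<xi>)" by (rule cinner_adj [OF cl])
    then have "cnj (ell2_coeff (adj x \<xi>) k) = cinner 0 \<xi>"
      using that right_invariantD(3) [OF x] by (simp add: cinner_delta_left)
    also have "\<dots> = 0" using cinner_scaleC_left [of 0 0 \<xi>] by (simp add: scaleC_zero)
    finally show ?thesis by simp
  qed
  moreover have "adj x (delta h) = 0" if "h \<notin> carrier G" for h
    by (rule ell2_eqI) (simp add: ell2_coeff_adj [OF cl] right_invariantD(2) [OF x that] ell2_coeff_simps)
  ultimately show ?thesis
    using x by (auto simp: right_invariant_def complex_linear_adj ell2_coeff_adj)
qed

lemma bij_right_translation:
  assumes "g \<in> carrier G"
  shows "bij_betw (\<lambda>m. m \<otimes> g) (carrier G) (carrier G)"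
  by (rule bij_betwI [where g = "\<lambda>m. m \<otimes> inv g"]) (use assms in \<open>auto simp: m_assoc\<close>)

lemma right_invariant_compose:
  assumes x: "x \<in> right_invariant G" and y: "y \<in> right_invariant G"
  shows "x o\<^sub>L y \<in> right_invariant G"
proof -
  have clx: "complex_linear x" and cly: "complex_linear y"
    using right_invariantD(1) x y by auto
  have ax: "adj x \<in> right_invariant G" by (rule right_invariant_adj [OF x])
  have coeff: "ell2_coeff (x (y (delta h))) k =
      (\<Sum>\<^sub>\<infinity>m\<in>carrier G. ell2_coeff (y (delta h)) m * cnj (ell2_coeff (adj x (delta k)) m))" for h k
  proof -
    have "ell2_coeff (x (y (delta h))) k = cinner (y (delta h)) (adj x (delta k))"
      by (simp flip: cinner_delta_right add: cinner_adj [OF clx])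
    also have "\<dots> = (\<Sum>\<^sub>\<infinity>m. ell2_coeff (y (delta h)) m * cnj (ell2_coeff (adj x (delta k)) m))"
      by (rule cinner.rep_eq)
    also have "\<dots> = (\<Sum>\<^sub>\<infinity>m\<in>carrier G. ell2_coeff (y (delta h)) m * cnj (ell2_coeff (adj x (delta k)) m))"
      by (rule infsum_cong_neutral) (auto simp: right_invariantD(2) [OF y])
    finally show ?thesis .
  qed
  have "ell2_coeff (x (y (delta (h \<otimes> g)))) (k \<otimes> g) = ell2_coeff (x (y (delta h))) k"
    if "g \<in> carrier G" "h \<in> carrier G" "k \<in> carrier G" for g h k
    unfolding coeff
    by (subst infsum_reindex_bij_betw [OF bij_right_translation [OF \<open>g \<in> carrier G\<close>], symmetric],
        rule infsum_cong) (simp add: that right_invariantD(4) [OF y] right_invariantD(4) [OF ax])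
  then show ?thesis
    using x y by (auto simp: right_invariant_def complex_linear_compose)
qed

text \<open>The tracial property of the vector state given by \<open>\<delta>\<^sub>e\<close>.\<close>

lemma norm2_adj:
  assumes x: "x \<in> right_invariant G"
  shows "norm2 G (adj x) = norm2 G x"
proof -
  have cl: "complex_linear x" by (rule right_invariantD [OF x])
  have coeff: "ell2_coeff (adj x (delta \<one>)) k = cnj (ell2_coeff (x (delta \<one>)) (inv k))"
    if "k \<in> carrier G" for k
    using right_invariantD(4) [OF x, of k "\<one>" "inv k"] that
    by (simp add: ell2_coeff_adj [OF cl])
  have bij: "bij_betw (\<lambda>k. inv k) (carrier G) (carrier G)"
    by (rule bij_betwI [where g = "\<lambda>k. inv k"]) auto
  have "(norm (adj x (delta \<one>)))\<^sup>2 = (\<Sum>\<^sub>\<infinity>k\<in>carrier G. (cmod (ell2_coeff (adj x (delta \<one>)) k))\<^sup>2)"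
    unfolding norm_ell2_square
    by (rule infsum_cong_neutral) (auto simp: right_invariantD(2) [OF right_invariant_adj [OF x]])
  also have "\<dots> = (\<Sum>\<^sub>\<infinity>k\<in>carrier G. (cmod (ell2_coeff (x (delta \<one>)) (inv k)))\<^sup>2)"
    by (rule infsum_cong) (simp add: coeff)
  also have "\<dots> = (\<Sum>\<^sub>\<infinity>k\<in>carrier G. (cmod (ell2_coeff (x (delta \<one>)) k))\<^sup>2)"
    by (rule infsum_reindex_bij_betw [OF bij])
  also have "\<dots> = (norm (x (delta \<one>)))\<^sup>2"
    unfolding norm_ell2_square by (rule infsum_cong_neutral) (auto simp: right_invariantD(2) [OF x])
  finally show ?thesis
    by (simp add: norm2_eq cl complex_linear_adj)
qed

lemma norm2_compose_left:
  assumes "x \<in> right_invariant G" "y \<in> right_invariant G"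
  shows "norm2 G (x o\<^sub>L y) \<le> norm x * norm2 G y"
  using assms by (simp add: norm2_eq right_invariantD complex_linear_compose norm_blinfun)

lemma norm2_nonneg: "x \<in> right_invariant G \<Longrightarrow> 0 \<le> norm2 G x"
  by (simp add: norm2_eq right_invariantD)

lemma norm2_compose_right:
  assumes x: "x \<in> right_invariant G" and y: "y \<in> right_invariant G"
  shows "norm2 G (x o\<^sub>L y) \<le> norm2 G x * norm y"
proof -
  have "norm2 G (x o\<^sub>L y) = norm2 G (adj y o\<^sub>L adj x)"
    using norm2_adj [OF right_invariant_compose [OF x y]] x y
    by (simp add: adj_compose right_invariantD)
  also have "\<dots> \<le> norm (adj y) * norm2 G (adj x)"
    by (intro norm2_compose_left right_invariant_adj x y)
  also have "\<dots> \<le> norm y * norm2 G x"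
    unfolding norm2_adj [OF x]
    by (intro mult_right_mono norm_adj norm2_nonneg) (use x y in \<open>auto simp: right_invariantD\<close>)
  finally show ?thesis by (simp add: mult.commute)
qed

lemma norm2_triangle:
  assumes "x \<in> right_invariant G" "y \<in> right_invariant G"
  shows "norm2 G (x + y) \<le> norm2 G x + norm2 G y"
  using assms
  by (simp add: norm2_eq right_invariantD complex_linear_add blinfun.add_left norm_triangle_ineq)

lemma norm2_scaleC: "x \<in> right_invariant G \<Longrightarrow> norm2 G (scaleC_op c x) = cmod c * norm2 G x"
  by (simp add: norm2_eq right_invariantD complex_linear_scaleC scaleC_op_apply norm_scaleC)

lemma norm2_scaleR: "x \<in> right_invariant G \<Longrightarrow> norm2 G (r *\<^sub>R x) = \<bar>r\<bar> * norm2 G x"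
  by (simp add: scaleR_op_eq norm2_scaleC)

lemma norm2_le_norm: "x \<in> right_invariant G \<Longrightarrow> norm2 G x \<le> norm x"
  using norm_blinfun [of x "delta \<one>"] by (simp add: norm2_eq right_invariantD norm_delta)


section \<open>The group algebra\<close>

lemma coeff_left_regular:
  "g \<in> carrier G \<Longrightarrow> ell2_coeff (left_regular G g \<xi>) h =
    (if h \<in> carrier G then ell2_coeff \<xi> (inv g \<otimes> h) else 0)"
  by (simp add: left_regular_apply [OF is_group] ell2_coeff_translate [OF is_group])

lemma norm_left_regular: "g \<in> carrier G \<Longrightarrow> norm (left_regular G g) \<le> 1"
  by (rule norm_blinfun_bound)
    (auto simp: left_regular_apply [OF is_group] norm_translate [OF is_group])

lemma right_invariant_left_regular:
  assumes g: "g \<in> carrier G"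
  shows "left_regular G g \<in> right_invariant G"
proof -
  have "inv g \<otimes> (k \<otimes> l) = h \<otimes> l \<longleftrightarrow> inv g \<otimes> k = h"
    if "l \<in> carrier G" "h \<in> carrier G" "k \<in> carrier G" for h k l
    using that g by (simp add: m_assoc [symmetric])
  moreover have "complex_linear (left_regular G g)"
    unfolding complex_linear_def
    by (intro allI ell2_eqI) (simp add: coeff_left_regular g ell2_coeff_simps)
  moreover have "left_regular G g (delta h) = 0" if "h \<notin> carrier G" for h
    using that g by (intro ell2_eqI) (auto simp: coeff_left_regular ell2_coeff_simps)
  ultimately show ?thesis
    using g by (auto simp: right_invariant_def coeff_left_regular ell2_coeff_delta)
qed

lemma left_regular_mult:
  assumes "g \<in> carrier G" "h \<in> carrier G"
  shows "left_regular G g o\<^sub>L left_regular G h = left_regular G (g \<otimes> h)"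
  using assms
  by (intro blinfun_eqI ell2_eqI) (simp add: coeff_left_regular inv_mult_group m_assoc)

lemma adj_left_regular:
  assumes g: "g \<in> carrier G"
  shows "adj (left_regular G g) = left_regular G (inv g)"
proof (rule adj_eqI)
  fix \<xi> \<eta>
  have bij: "bij_betw (\<lambda>m. g \<otimes> m) (carrier G) (carrier G)"
    by (rule bij_betwI [where g = "\<lambda>m. inv g \<otimes> m"]) (use g in \<open>auto simp: m_assoc [symmetric]\<close>)
  have "cinner (left_regular G g \<xi>) \<eta> =
      (\<Sum>\<^sub>\<infinity>k\<in>carrier G. ell2_coeff \<xi> (inv g \<otimes> k) * cnj (ell2_coeff \<eta> k))"
    unfolding cinner.rep_eq by (rule infsum_cong_neutral) (auto simp: coeff_left_regular g)
  also have "\<dots> = (\<Sum>\<^sub>\<infinity>m\<in>carrier G. ell2_coeff \<xi> (inv g \<otimes> (g \<otimes> m)) * cnj (ell2_coeff \<eta> (g \<otimes> m)))"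
    by (rule infsum_reindex_bij_betw [OF bij, symmetric])
  also have "\<dots> = (\<Sum>\<^sub>\<infinity>m\<in>carrier G. ell2_coeff \<xi> m * cnj (ell2_coeff \<eta> (g \<otimes> m)))"
    by (rule infsum_cong) (simp add: g m_assoc [symmetric])
  also have "\<dots> = cinner \<xi> (left_regular G (inv g) \<eta>)"
    unfolding cinner.rep_eq by (rule infsum_cong_neutral) (auto simp: coeff_left_regular g)
  finally show "cinner (left_regular G g \<xi>) \<eta> = cinner \<xi> (left_regular G (inv g) \<eta>)" .
qed

lemma right_invariant_sum: "(\<And>i. i \<in> I \<Longrightarrow> f i \<in> right_invariant G) \<Longrightarrow> (\<Sum>i\<in>I. f i) \<in> right_invariant G"
  by (induction I rule: infinite_finite_induct)
    (auto intro: right_invariant_add simp: right_invariant_zero)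

lemma group_algebra_right_invariant: "group_algebra G \<subseteq> right_invariant G"
  by (auto simp: group_algebra_def
      intro!: right_invariant_sum right_invariant_scaleC right_invariant_left_regular)

lemma group_algebra_subset_vna: "group_algebra G \<subseteq> group_vna G"
  unfolding group_vna_def by (rule closure_of_subset) (simp add: strong_operator_topology_topspace)

text \<open>
  Right invariance passes to strong operator limits. This inclusion is in fact an equality, but
  only this direction is needed.
\<close>

lemma group_vna_right_invariant: "group_vna G \<subseteq> right_invariant G"
proof
  fix x assume x: "x \<in> group_vna G"
  have eq: "p (x \<xi>) = q (x \<eta>)"
    if "continuous_on UNIV p" "continuous_on UNIV q"
      "\<And>y. y \<in> right_invariant G \<Longrightarrow> p (blinfun_apply y \<xi>) = q (blinfun_apply y \<eta>)"
    for p q :: "'a ell2 \<Rightarrow> 'c::real_normed_vector" and \<xi> \<eta>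
  proof (rule forall_in_closure_of_eq [of x strong_operator_topology "group_algebra G" euclidean])
    show "x \<in> strong_operator_topology closure_of group_algebra G"
      using x by (simp add: group_vna_def)
    show "continuous_map strong_operator_topology euclidean (\<lambda>x. p (blinfun_apply x \<xi>))"
      "continuous_map strong_operator_topology euclidean (\<lambda>x. q (blinfun_apply x \<eta>))"
      using continuous_map_compose [OF strong_operator_topology_continuous_evaluation, of euclidean p]
        continuous_map_compose [OF strong_operator_topology_continuous_evaluation, of euclidean q] that
      by (simp_all add: o_def)
  qed (use that group_algebra_right_invariant in auto)
  have id: "continuous_on UNIV (\<lambda>\<xi>::'a ell2. \<xi>)" by (rule continuous_on_id)
  have sc: "continuous_on UNIV (scaleC c :: 'a ell2 \<Rightarrow> _)" for c
    by (rule linear_continuous_on [OF bounded_linear_scaleC])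
  have "complex_linear x"
    unfolding complex_linear_def
    by (intro allI eq [OF id sc]) (auto dest!: right_invariantD(1) simp: complex_linear_def)
  moreover have "ell2_coeff (x \<xi>) k = 0" if "k \<notin> carrier G" for \<xi> k
    using eq [OF continuous_ell2_coeff continuous_on_const] that right_invariantD(2) by metis
  moreover have "x (delta h) = 0" if "h \<notin> carrier G" for h
    using eq [OF id continuous_on_const] that right_invariantD(3) by metis
  moreover have "ell2_coeff (x (delta (h \<otimes> g))) (k \<otimes> g) = ell2_coeff (x (delta h)) k"
    if "g \<in> carrier G" "h \<in> carrier G" "k \<in> carrier G" for g h k
    by (rule eq [OF continuous_ell2_coeff continuous_ell2_coeff]) (use that right_invariantD(4) in metis)
  ultimately show "x \<in> right_invariant G"
    by (auto simp: right_invariant_def)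
qed

text \<open>The finitely supported vectors \<open>v \<delta>\<^sub>e\<close> with \<open>v \<in> \<complex>[G]\<close> are dense in \<open>\<ell>\<^sup>2(G)\<close>.\<close>

lemma group_algebra_dense:
  assumes supp: "\<And>k. k \<notin> carrier G \<Longrightarrow> ell2_coeff \<zeta> k = 0" and "\<epsilon> > 0"
  obtains v where "v \<in> group_algebra G" "norm (v (delta \<one>) - \<zeta>) < \<epsilon>"
proof -
  obtain X where X: "finite X" "dist (\<Sum>h\<in>X. scaleC (ell2_coeff \<zeta> h) (delta h)) \<zeta> < \<epsilon>"
    using has_sum_deltas [of \<zeta>] \<open>\<epsilon> > 0\<close>
    unfolding has_sum_def tendsto_iff eventually_finite_subsets_at_top by blast
  define F where "F = X \<inter> carrier G"
  have F: "finite F" "F \<subseteq> carrier G" using X by (auto simp: F_def)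
  define v where "v = (\<Sum>g\<in>F. scaleC_op (ell2_coeff \<zeta> g) (left_regular G g))"
  have "v (delta \<one>) = (\<Sum>h\<in>F. scaleC (ell2_coeff \<zeta> h) (delta h))"
    unfolding v_def blinfun.sum_left
    by (rule sum.cong) (use F left_regular_delta [OF is_group] in \<open>auto simp: scaleC_op_apply\<close>)
  also have "\<dots> = (\<Sum>h\<in>X. scaleC (ell2_coeff \<zeta> h) (delta h))"
    by (rule ell2_eqI) (use X F supp in \<open>auto simp: ell2_coeff_truncate F_def\<close>)
  finally have "norm (v (delta \<one>) - \<zeta>) < \<epsilon>" using X by (simp add: dist_norm)
  moreover have "v \<in> group_algebra G"
    unfolding group_algebra_def v_def using F by blast
  ultimately show thesis using that by blast
qed

end

section \<open>Formal polynomials in group words\<close>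

text \<open>
  A list of pairs of a scalar and a word stands for a formal linear combination of words. At a
  tuple \<open>g\<close> in a group \<open>G\<close> it takes a value in \<open>\<complex>[G]\<close>, so that the same polynomial can be
  evaluated in two groups. The formal operations below evaluate to scalar multiples, adjoints and
  products of operators; concatenation of lists evaluates to the sum.
\<close>

type_synonym gpoly = "(complex \<times> gterm) list"

definition gpoly_vars :: "gpoly \<Rightarrow> nat set"
  where "gpoly_vars p = (\<Union>(c, w)\<in>set p. gterm_vars w)"

definition gpoly_val :: "('a, 'm) monoid_scheme \<Rightarrow> 'a list \<Rightarrow> gpoly \<Rightarrow> 'a ell2 \<Rightarrow>\<^sub>L 'a ell2"
  where "gpoly_val G g p = (\<Sum>(c, w)\<leftarrow>p. scaleC_op c (left_regular G (gterm_val G g w)))"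

definition gpoly_scale :: "complex \<Rightarrow> gpoly \<Rightarrow> gpoly"
  where "gpoly_scale c p = map (\<lambda>(d, w). (c * d, w)) p"

definition gpoly_adj :: "gpoly \<Rightarrow> gpoly"
  where "gpoly_adj p = map (\<lambda>(c, w). (cnj c, GInv w)) p"

definition gpoly_mult :: "gpoly \<Rightarrow> gpoly \<Rightarrow> gpoly"
  where "gpoly_mult p q = concat (map (\<lambda>(c, v). map (\<lambda>(d, w). (c * d, GMult v w)) q) p)"

lemma gpoly_vars_simps [simp]:
  "gpoly_vars [] = {}"
  "gpoly_vars ((c, w) # p) = gterm_vars w \<union> gpoly_vars p"
  "gpoly_vars (p @ q) = gpoly_vars p \<union> gpoly_vars q"
  "gpoly_vars (gpoly_scale c p) = gpoly_vars p"
  "gpoly_vars (gpoly_adj p) = gpoly_vars p"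
  by (auto simp: gpoly_vars_def gpoly_scale_def gpoly_adj_def)

lemma gpoly_vars_mult: "gpoly_vars (gpoly_mult p q) \<subseteq> gpoly_vars p \<union> gpoly_vars q"
  unfolding gpoly_vars_def gpoly_mult_def by fastforce

lemma gpoly_val_simps [simp]:
  "gpoly_val G g [] = 0"
  "gpoly_val G g ((c, w) # p) = scaleC_op c (left_regular G (gterm_val G g w)) + gpoly_val G g p"
  "gpoly_val G g (p @ q) = gpoly_val G g p + gpoly_val G g q"
  by (simp_all add: gpoly_val_def)

lemma gpoly_val_scale: "gpoly_val G g (gpoly_scale c p) = scaleC_op c (gpoly_val G g p)"
  by (induction p) (auto simp: gpoly_scale_def scaleC_op_zero scaleC_op_add scaleC_op_scaleC_op)

lemma gterm_val_append:
  "gterm_vars w \<subseteq> {..<length g} \<Longrightarrow> gterm_val G (g @ h) w = gterm_val G g w"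
  by (induction w) (auto simp: nth_append)

lemma gpoly_val_append_tuple:
  "gpoly_vars p \<subseteq> {..<length g} \<Longrightarrow> gpoly_val G (g @ h) p = gpoly_val G g p"
  by (induction p) (auto simp: gterm_val_append)

context group
begin

lemma gterm_val_closed:
  "g \<in> lists (carrier G) \<Longrightarrow> gterm_vars w \<subseteq> {..<length g} \<Longrightarrow> gterm_val G g w \<in> carrier G"
  by (induction w) (auto simp: in_lists_conv_set)

lemma gpoly_val_right_invariant:
  "g \<in> lists (carrier G) \<Longrightarrow> gpoly_vars p \<subseteq> {..<length g} \<Longrightarrow> gpoly_val G g p \<in> right_invariant G"
  by (induction p)
    (auto intro!: right_invariant_add right_invariant_scaleC right_invariant_left_regular
      gterm_val_closed right_invariant_zero)

lemma gpoly_val_mult: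
  assumes g: "g \<in> lists (carrier G)"
    and p: "gpoly_vars p \<subseteq> {..<length g}" and q: "gpoly_vars q \<subseteq> {..<length g}"
  shows "gpoly_val G g (gpoly_mult p q) = gpoly_val G g p o\<^sub>L gpoly_val G g q"
proof -
  have mono: "gpoly_val G g (map (\<lambda>(d, w). (c * d, GMult v w)) q) =
      scaleC_op c (left_regular G (gterm_val G g v)) o\<^sub>L gpoly_val G g q"
    if v: "gterm_vars v \<subseteq> {..<length g}" for c v
    using q
  proof (induction q)
    case (Cons x q)
    obtain d w where x: "x = (d, w)" by (cases x)
    have w: "gterm_val G g w \<in> carrier G" and v': "gterm_val G g v \<in> carrier G"
      using Cons.prems v g by (auto simp: x intro: gterm_val_closed)
    have "complex_linear (left_regular G (gterm_val G g v))"
      by (rule right_invariantD right_invariant_left_regular v')+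
    then show ?case
      using Cons w v'
      by (simp add: x blinfun_compose_add_right scaleC_op_compose_left scaleC_op_compose_right
          scaleC_op_scaleC_op left_regular_mult [symmetric] mult.commute)
  qed simp
  show ?thesis
    using p by (induction p) (auto simp: gpoly_mult_def mono blinfun_compose_add_left)
qed

lemma gpoly_val_adj:
  assumes g: "g \<in> lists (carrier G)"
  shows "gpoly_vars p \<subseteq> {..<length g} \<Longrightarrow> gpoly_val G g (gpoly_adj p) = adj (gpoly_val G g p)"
proof (induction p)
  case Nil
  have "adj 0 = (0 :: 'a ell2 \<Rightarrow>\<^sub>L 'a ell2)"
    by (rule adj_eqI) (metis cinner_scaleC_left cinner_scaleC_right complex_cnj_zero mult_zero_left
        scaleC_zero zero_blinfun.rep_eq)
  then show ?case by (simp add: gpoly_adj_def)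
next
  case (Cons x p)
  obtain c w where x: "x = (c, w)" by (cases x)
  have w: "gterm_val G g w \<in> carrier G"
    using Cons.prems g by (auto simp: x intro: gterm_val_closed)
  have cl: "complex_linear (left_regular G (gterm_val G g w))"
    by (rule right_invariantD right_invariant_left_regular w)+
  have "complex_linear (gpoly_val G g p)"
    by (rule right_invariantD(1) [OF gpoly_val_right_invariant]) (use Cons.prems g in \<open>auto simp: x\<close>)
  then show ?case
    using Cons w cl
    by (simp add: x gpoly_adj_def adj_add adj_scaleC complex_linear_scaleC adj_left_regular)
qed

lemma group_algebra_add_monomial:
  assumes "x \<in> group_algebra G" "g \<in> carrier G"
  shows "scaleC_op c (left_regular G g) + x \<in> group_algebra G"
proof -
  obtain F d where F: "finite F" "F \<subseteq> carrier G"
    and x: "x = (\<Sum>h\<in>F. scaleC_op (d h) (left_regular G h))"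
    using assms by (auto simp: group_algebra_def)
  define d' where "d' h = (if h = g then c else 0) + (if h \<in> F then d h else 0)" for h
  have "(\<Sum>h\<in>insert g F. scaleC_op (d' h) (left_regular G h)) =
      (\<Sum>h\<in>insert g F. scaleC_op (if h = g then c else 0) (left_regular G h)) +
      (\<Sum>h\<in>insert g F. scaleC_op (if h \<in> F then d h else 0) (left_regular G h))"
    by (simp add: d'_def scaleC_op_add_scalar flip: sum.distrib)
  also have "(\<Sum>h\<in>insert g F. scaleC_op (if h = g then c else 0) (left_regular G h)) =
      (\<Sum>h\<in>{g}. scaleC_op c (left_regular G h))"
    by (rule sum.mono_neutral_cong_right) (use F in \<open>auto simp: scaleC_op_zero_scalar\<close>)
  also have "(\<Sum>h\<in>insert g F. scaleC_op (if h \<in> F then d h else 0) (left_regular G h)) = x"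
    unfolding x
    by (rule sum.mono_neutral_cong_right) (use F in \<open>auto simp: scaleC_op_zero_scalar\<close>)
  finally have "(\<Sum>h\<in>insert g F. scaleC_op (d' h) (left_regular G h)) =
      scaleC_op c (left_regular G g) + x"
    by simp
  then show ?thesis
    unfolding group_algebra_def using F assms by (metis (mono_tags, lifting) finite_insert
        insert_subset mem_Collect_eq)
qed

lemma gpoly_val_in_group_algebra:
  assumes "g \<in> lists (carrier G)"
  shows "gpoly_vars p \<subseteq> {..<length g} \<Longrightarrow> gpoly_val G g p \<in> group_algebra G"
proof (induction p)
  case Nil
  show ?case by (auto simp: group_algebra_def intro: exI [of _ "{}"])
next
  case (Cons x p)
  then show ?case
    using assms by (cases x) (auto intro!: group_algebra_add_monomial gterm_val_closed)
qed

lemma group_algebra_support: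
  assumes "x \<in> group_algebra G"
  obtains F where "finite F" "F \<subseteq> carrier G"
    "\<And>g. F \<subseteq> set g \<Longrightarrow> \<exists>p. gpoly_vars p \<subseteq> {..<length g} \<and> gpoly_val G g p = x"
proof -
  obtain F c where F: "finite F" "F \<subseteq> carrier G"
    and x: "x = (\<Sum>h\<in>F. scaleC_op (c h) (left_regular G h))"
    using assms by (auto simp: group_algebra_def)
  have "\<exists>p. gpoly_vars p \<subseteq> {..<length g} \<and> gpoly_val G g p = x" if g: "F \<subseteq> set g" for g
    using F(1) g unfolding x
  proof (induction F rule: finite_induct)
    case empty
    show ?case by (rule exI [of _ "[]"]) simp
  next
    case (insert h F)
    then obtain p i where "gpoly_vars p \<subseteq> {..<length g}"
      "gpoly_val G g p = (\<Sum>h\<in>F. scaleC_op (c h) (left_regular G h))" "i < length g" "g ! i = h"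
      by (auto simp: in_set_conv_nth)
    with insert show ?case
      by (intro exI [of _ "(c h, GVar i) # p"]) auto
  qed
  with F show thesis using that by blast
qed

lemma group_algebra_common:
  assumes "x \<in> group_algebra G" "y \<in> group_algebra G"
  obtains g p q where "g \<in> lists (carrier G)"
    "gpoly_vars p \<subseteq> {..<length g}" "gpoly_val G g p = x"
    "gpoly_vars q \<subseteq> {..<length g}" "gpoly_val G g q = y"
proof -
  obtain E where E: "finite E" "E \<subseteq> carrier G"
    "\<And>g. E \<subseteq> set g \<Longrightarrow> \<exists>p. gpoly_vars p \<subseteq> {..<length g} \<and> gpoly_val G g p = x"
    using group_algebra_support [OF assms(1)] by blast
  obtain F where F: "finite F" "F \<subseteq> carrier G"
    "\<And>g. F \<subseteq> set g \<Longrightarrow> \<exists>p. gpoly_vars p \<subseteq> {..<length g} \<and> gpoly_val G g p = y"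
    using group_algebra_support [OF assms(2)] by blast
  obtain g where g: "set g = E \<union> F" using E F finite_list by (metis finite_UnI)
  moreover obtain p q where "gpoly_vars p \<subseteq> {..<length g}" "gpoly_val G g p = x"
    "gpoly_vars q \<subseteq> {..<length g}" "gpoly_val G g q = y"
    using E(3) F(3) g by blast
  moreover have "g \<in> lists (carrier G)"
    using g E F by (auto simp: in_lists_conv_set)
  ultimately show thesis using that by blast
qed

lemma
  assumes "x \<in> group_algebra G" "y \<in> group_algebra G"
  shows group_algebra_add: "x + y \<in> group_algebra G"
    and group_algebra_compose: "x o\<^sub>L y \<in> group_algebra G"
proof -
  obtain g p q where g: "g \<in> lists (carrier G)"
    "gpoly_vars p \<subseteq> {..<length g}" "gpoly_val G g p = x"
    "gpoly_vars q \<subseteq> {..<length g}" "gpoly_val G g q = y"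
    using group_algebra_common [OF assms] .
  have "gpoly_val G g (p @ q) \<in> group_algebra G" "gpoly_val G g (gpoly_mult p q) \<in> group_algebra G"
    by (rule gpoly_val_in_group_algebra; use g gpoly_vars_mult [of p q] in auto)+
  then show "x + y \<in> group_algebra G" "x o\<^sub>L y \<in> group_algebra G"
    using g by (simp_all add: gpoly_val_mult)
qed

lemma
  assumes "x \<in> group_algebra G"
  shows group_algebra_adj: "adj x \<in> group_algebra G"
    and group_algebra_scaleR: "r *\<^sub>R x \<in> group_algebra G"
proof -
  obtain g p where g: "g \<in> lists (carrier G)"
    "gpoly_vars p \<subseteq> {..<length g}" "gpoly_val G g p = x"
    using group_algebra_common [OF assms assms] .
  have "gpoly_val G g (gpoly_adj p) \<in> group_algebra G"
    "gpoly_val G g (gpoly_scale (complex_of_real r) p) \<in> group_algebra G"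
    by (rule gpoly_val_in_group_algebra; use g in auto)+
  then show "adj x \<in> group_algebra G" "r *\<^sub>R x \<in> group_algebra G"
    using g by (simp_all add: gpoly_val_adj gpoly_val_scale scaleR_op_eq)
qed

end


section \<open>Approximation by contractions in the group algebra\<close>

primrec blinfun_pow :: "('a::real_normed_vector \<Rightarrow>\<^sub>L 'a) \<Rightarrow> nat \<Rightarrow> 'a \<Rightarrow>\<^sub>L 'a" where
  "blinfun_pow T 0 = id_blinfun"
| "blinfun_pow T (Suc n) = T o\<^sub>L blinfun_pow T n"

lemma blinfun_pow_commute: "blinfun_pow T n (T \<xi>) = T (blinfun_pow T n \<xi>)"
  by (induction n) auto

lemma norm_blinfun_pow:
  assumes "norm T \<le> r"
  shows "norm (blinfun_pow T n \<xi>) \<le> r ^ n * norm \<xi>"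
proof (induction n)
  case (Suc n)
  have "0 \<le> r" using assms norm_ge_zero order_trans by blast
  have "norm (T (blinfun_pow T n \<xi>)) \<le> norm T * norm (blinfun_pow T n \<xi>)" by (rule norm_blinfun)
  also have "\<dots> \<le> r * (r ^ n * norm \<xi>)"
    by (intro mult_mono assms Suc norm_ge_zero \<open>0 \<le> r\<close>)
  finally show ?case by simp
qed simp

text \<open>
  With \<open>M = \<parallel>y\<parallel>\<close> and \<open>T = (M\<^sup>2 - y\<^sup>*y) / (1 + M\<^sup>2)\<close>, we have \<open>1 + y\<^sup>*y = (1 + M\<^sup>2) (1 - T)\<close>, and \<open>T\<close>
  has norm less than 1. The Neumann series in \<open>T\<close> therefore yields the resolvent \<open>(1 + y\<^sup>*y)\<^sup>-\<^sup>1\<close>;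
  only its partial sums, which are polynomials in \<open>y\<^sup>*y\<close>, are used.
\<close>

definition resolvent_step :: "('a ell2 \<Rightarrow>\<^sub>L 'a ell2) \<Rightarrow> 'a ell2 \<Rightarrow>\<^sub>L 'a ell2"
  where "resolvent_step y = (1 / (1 + (norm y)\<^sup>2)) *\<^sub>R ((norm y)\<^sup>2 *\<^sub>R id_blinfun - (adj y o\<^sub>L y))"

definition resolvent_sum :: "('a ell2 \<Rightarrow>\<^sub>L 'a ell2) \<Rightarrow> nat \<Rightarrow> 'a ell2 \<Rightarrow>\<^sub>L 'a ell2"
  where "resolvent_sum y n =
    (1 / (1 + (norm y)\<^sup>2)) *\<^sub>R (\<Sum>j<n. blinfun_pow (resolvent_step y) j)"

lemma norm_eq_adj: "complex_linear x \<Longrightarrow> norm (adj x) = norm x"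
  by (metis adj_adj complex_linear_adj norm_adj order_antisym)

lemma norm_one_plus_square:
  assumes y: "complex_linear y"
  shows "norm \<eta> \<le> norm (\<eta> + adj y (y \<eta>))" (is ?thesis1)
    and "2 * norm (y \<eta>) \<le> norm (\<eta> + adj y (y \<eta>))" (is ?thesis2)
proof -
  have yy: "\<eta> \<bullet> adj y (y \<eta>) = (norm (y \<eta>))\<^sup>2"
    using inner_adj [OF y, of \<eta> "y \<eta>"] by (simp add: power2_norm_eq_inner)
  have expand: "(norm (\<eta> + adj y (y \<eta>)))\<^sup>2 =
      (norm \<eta>)\<^sup>2 + 2 * (norm (y \<eta>))\<^sup>2 + (norm (adj y (y \<eta>)))\<^sup>2"
    by (simp add: power2_norm_eq_inner inner_add_left inner_add_right inner_commute
        yy [unfolded power2_norm_eq_inner])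
  show ?thesis1
    by (rule power2_le_imp_le) (simp_all add: expand)
  have "(norm (y \<eta>))\<^sup>2 \<le> norm \<eta> * norm (adj y (y \<eta>))"
    unfolding yy [symmetric] by (rule norm_cauchy_schwarz)
  moreover have "0 \<le> (norm \<eta> - norm (adj y (y \<eta>)))\<^sup>2" by simp
  ultimately have "(2 * norm (y \<eta>))\<^sup>2 \<le> (norm (\<eta> + adj y (y \<eta>)))\<^sup>2"
    unfolding expand by (simp add: power2_diff power_mult_distrib)
  \<comment> \<open>the square of the norm of \<open>\<eta> + y\<^sup>*y\<eta>\<close> dominates \<open>2 \<parallel>y\<eta>\<parallel>\<^sup>2 + 2 \<parallel>\<eta>\<parallel> \<parallel>y\<^sup>*y\<eta>\<parallel>\<close>\<close>
  then show ?thesis2 by (rule power2_le_imp_le) simp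
qed

lemma norm_resolvent_step:
  assumes y: "complex_linear y"
  shows "norm (resolvent_step y) \<le> (norm y)\<^sup>2 / (1 + (norm y)\<^sup>2)"
proof (rule norm_blinfun_bound)
  fix \<eta>
  let ?M = "norm y"
  have yy: "\<eta> \<bullet> adj y (y \<eta>) = (norm (y \<eta>))\<^sup>2"
    using inner_adj [OF y, of \<eta> "y \<eta>"] by (simp add: power2_norm_eq_inner)
  have "norm (adj y (y \<eta>)) \<le> ?M * norm (y \<eta>)" by (rule norm_adj_apply [OF y])
  then have "(norm (adj y (y \<eta>)))\<^sup>2 \<le> ?M\<^sup>2 * (norm (y \<eta>))\<^sup>2"
    by (metis norm_ge_zero power_mono power_mult_distrib)
  moreover have "(norm (?M\<^sup>2 *\<^sub>R \<eta> - adj y (y \<eta>)))\<^sup>2 =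
      (?M\<^sup>2 * norm \<eta>)\<^sup>2 - 2 * ?M\<^sup>2 * (norm (y \<eta>))\<^sup>2 + (norm (adj y (y \<eta>)))\<^sup>2"
    by (simp add: power2_norm_eq_inner inner_diff_left inner_diff_right inner_commute
        yy [unfolded power2_norm_eq_inner] power_mult_distrib)
  moreover have "0 \<le> ?M\<^sup>2 * (norm (y \<eta>))\<^sup>2" by simp
  ultimately have "(norm (?M\<^sup>2 *\<^sub>R \<eta> - adj y (y \<eta>)))\<^sup>2 \<le> (?M\<^sup>2 * norm \<eta>)\<^sup>2" by linarith
  then have "norm (?M\<^sup>2 *\<^sub>R \<eta> - adj y (y \<eta>)) \<le> ?M\<^sup>2 * norm \<eta>"
    by (rule power2_le_imp_le) simp
  then show "norm (resolvent_step y \<eta>) \<le> ?M\<^sup>2 / (1 + ?M\<^sup>2) * norm \<eta>"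
    by (simp add: resolvent_step_def blinfun.bilinear_simps divide_right_mono)
qed simp

lemma resolvent_step_apply:
  "(1 / (1 + (norm y)\<^sup>2)) *\<^sub>R (\<eta> + adj y (y \<eta>)) = \<eta> - resolvent_step y \<eta>"
proof -
  let ?k = "1 / (1 + (norm y)\<^sup>2)"
  have "?k + ?k * (norm y)\<^sup>2 = 1"
    by (metis add.commute add_divide_distrib add_nonneg_pos divide_self_if less_irrefl mult.commute
        mult.right_neutral times_divide_eq_right zero_le_power2 zero_less_one)
  then have "?k *\<^sub>R \<eta> + (?k * (norm y)\<^sup>2) *\<^sub>R \<eta> = \<eta>"
    by (metis scaleR_add_left scaleR_one)
  then have "?k *\<^sub>R \<eta> = \<eta> - (?k * (norm y)\<^sup>2) *\<^sub>R \<eta>"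
    by (simp only: eq_diff_eq)
  then show ?thesis
    by (simp add: resolvent_step_def blinfun.bilinear_simps scaleR_add_right scaleR_diff_right)
qed

lemma resolvent_sum_left:
  "resolvent_sum y n \<xi> + adj y (y (resolvent_sum y n \<xi>)) = \<xi> - blinfun_pow (resolvent_step y) n \<xi>"
proof -
  let ?k = "1 / (1 + (norm y)\<^sup>2)" and ?p = "\<lambda>j. blinfun_pow (resolvent_step y) j \<xi>"
  have "resolvent_sum y n \<xi> + adj y (y (resolvent_sum y n \<xi>)) =
      (\<Sum>j<n. ?k *\<^sub>R (?p j + adj y (y (?p j))))"
    by (simp add: resolvent_sum_def blinfun.bilinear_simps blinfun.sum_left blinfun.sum_right
        scaleR_add_right sum.distrib scaleR_sum_right)
  also have "\<dots> = (\<Sum>j<n. ?p j - ?p (Suc j))"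
    by (simp add: resolvent_step_apply)
  also have "\<dots> = \<xi> - ?p n"
    by (subst sum_lessThan_telescope') simp
  finally show ?thesis .
qed

lemma resolvent_sum_right:
  "resolvent_sum y n (\<xi> + adj y (y \<xi>)) = \<xi> - blinfun_pow (resolvent_step y) n \<xi>"
proof -
  let ?k = "1 / (1 + (norm y)\<^sup>2)" and ?p = "\<lambda>j. blinfun_pow (resolvent_step y) j"
  have "resolvent_sum y n (\<xi> + adj y (y \<xi>)) = (\<Sum>j<n. ?p j (?k *\<^sub>R (\<xi> + adj y (y \<xi>))))"
    by (simp add: resolvent_sum_def blinfun.scaleR_left blinfun.scaleR_right blinfun.sum_left
        scaleR_sum_right)
  also have "\<dots> = (\<Sum>j<n. ?p j \<xi> - ?p (Suc j) \<xi>)"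
    unfolding resolvent_step_apply by (simp add: blinfun.diff_right blinfun_pow_commute)
  also have "\<dots> = \<xi> - ?p n \<xi>"
    by (subst sum_lessThan_telescope') simp
  finally show ?thesis .
qed

lemma resolvent_step_intertwine:
  assumes y: "complex_linear y"
  shows "y (blinfun_pow (resolvent_step y) n \<xi>) = blinfun_pow (resolvent_step (adj y)) n (y \<xi>)"
proof (induction n)
  case (Suc n)
  have "y (resolvent_step y \<eta>) = resolvent_step (adj y) (y \<eta>)" for \<eta>
    by (simp add: resolvent_step_def norm_eq_adj adj_adj y blinfun.bilinear_simps)
  with Suc show ?case by simp
qed simp

lemma resolvent_sum_intertwine:
  "complex_linear y \<Longrightarrow> y (resolvent_sum y n \<xi>) = resolvent_sum (adj y) n (y \<xi>)"
  by (simp add: resolvent_sum_def norm_eq_adj resolvent_step_intertwine blinfun.bilinear_simps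
      blinfun.sum_left blinfun.sum_right)

context group
begin

text \<open>
  An approximate preimage of \<open>x\<close> under the map \<open>w \<mapsto> 2 w (1 + w\<^sup>*w)\<^sup>-\<^sup>1\<close>, found by iterating the
  contraction \<open>w \<mapsto> x (1 + w\<^sup>*w) / 2\<close> of the unit ball.
\<close>

lemma approximate_preimage:
  assumes x: "x \<in> right_invariant G" and s: "norm x \<le> s" "s < 1" and "\<epsilon> > 0"
  obtains w where "w \<in> right_invariant G" "norm w \<le> 1"
    "norm (x + (x o\<^sub>L (adj w o\<^sub>L w)) - 2 *\<^sub>R w) \<le> \<epsilon>"
proof -
  define w where "w = rec_nat 0 (\<lambda>_ w. (1 / 2) *\<^sub>R (x + (x o\<^sub>L (adj w o\<^sub>L w))))"
  have w0: "w 0 = 0" and wSuc: "w (Suc k) = (1 / 2) *\<^sub>R (x + (x o\<^sub>L (adj (w k) o\<^sub>L w k)))" for k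
    by (simp_all add: w_def)
  have ri: "w k \<in> right_invariant G" for k
    by (induction k) (auto simp: w0 wSuc right_invariant_zero intro!: right_invariant_scaleR
        right_invariant_add right_invariant_compose right_invariant_adj x)
  then have cl: "complex_linear (w k)" for k by (rule right_invariantD)
  have s0: "0 \<le> s" using s norm_ge_zero order_trans by blast
  have nw: "norm (w k) \<le> 1" for k
  proof (induction k)
    case (Suc k)
    have "norm (x o\<^sub>L (adj (w k) o\<^sub>L w k)) \<le> norm x * (norm (adj (w k)) * norm (w k))"
      by (meson mult_left_mono norm_blinfun_compose norm_ge_zero order_trans)
    also have "\<dots> \<le> 1 * (1 * 1)"
      by (intro mult_mono) (use Suc s s0 norm_adj [OF cl, of k] in auto)
    finally have "norm (x + (x o\<^sub>L (adj (w k) o\<^sub>L w k))) \<le> 1 + 1"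
      by (intro norm_triangle_le add_mono) (use s in auto)
    then show ?case by (simp add: wSuc)
  qed (simp add: w0)
  have step: "norm (w (Suc k) - w k) \<le> s ^ k" for k
  proof (induction k)
    case 0
    show ?case using s by (simp add: wSuc w0)
  next
    case (Suc k)
    let ?d = "w (Suc k) - w k"
    have "w (Suc (Suc k)) - w (Suc k) =
        (1 / 2) *\<^sub>R (x o\<^sub>L ((adj (w (Suc k)) o\<^sub>L w (Suc k)) - (adj (w k) o\<^sub>L w k)))"
      by (simp only: wSuc [of "Suc k"] wSuc [of k, THEN arg_cong [where f = "\<lambda>u. v - u" for v]])
        (simp add: blinfun_compose_diff_right scaleR_diff_right scaleR_add_right)
    also have "(adj (w (Suc k)) o\<^sub>L w (Suc k)) - (adj (w k) o\<^sub>L w k) =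
        (adj (w (Suc k)) o\<^sub>L ?d) + (adj ?d o\<^sub>L w k)"
      by (simp add: blinfun_compose_diff_right blinfun_compose_diff_left adj_diff cl)
    finally have eq: "w (Suc (Suc k)) - w (Suc k) =
        (1 / 2) *\<^sub>R (x o\<^sub>L ((adj (w (Suc k)) o\<^sub>L ?d) + (adj ?d o\<^sub>L w k)))" .
    have a: "norm (adj (w (Suc k)) o\<^sub>L ?d) \<le> 1 * norm ?d"
      by (rule order_trans [OF norm_blinfun_compose mult_right_mono])
        (use nw norm_adj [OF cl, of "Suc k"] order_trans in auto)
    have b: "norm (adj ?d o\<^sub>L w k) \<le> norm ?d * 1"
      by (rule order_trans [OF norm_blinfun_compose mult_mono])
        (use nw norm_adj [OF complex_linear_diff [OF cl cl], of "Suc k" k] in auto)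
    have "norm (w (Suc (Suc k)) - w (Suc k)) \<le>
        (1 / 2) * (norm x * norm ((adj (w (Suc k)) o\<^sub>L ?d) + (adj ?d o\<^sub>L w k)))"
      unfolding eq by (simp add: norm_blinfun_compose)
    also have "\<dots> \<le> (1 / 2) * (s * (2 * norm ?d))"
      by (intro mult_left_mono mult_mono norm_triangle_le s s0) (use a b in auto)
    also have "\<dots> \<le> s * s ^ k"
      using Suc s0 by (simp add: mult_left_mono)
    finally show ?case by simp
  qed
  obtain k where k: "s ^ k < \<epsilon> / 2"
    using real_arch_pow_inv [of "\<epsilon> / 2" s] \<open>\<epsilon> > 0\<close> s by auto
  have "x + (x o\<^sub>L (adj (w k) o\<^sub>L w k)) - 2 *\<^sub>R w k = 2 *\<^sub>R (w (Suc k) - w k)"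
    by (simp add: wSuc scaleR_diff_right)
  then have "norm (x + (x o\<^sub>L (adj (w k) o\<^sub>L w k)) - 2 *\<^sub>R w k) \<le> \<epsilon>"
    using step [of k] k by simp
  then show thesis using that ri nw by blast
qed

text \<open>By the tracial property, the factor \<open>1 + w\<^sup>*w\<close> on the right may be moved to the left.\<close>

lemma norm2_le_one_plus_square:
  assumes a: "a \<in> right_invariant G" and w: "w \<in> right_invariant G"
  shows "norm2 G a \<le> norm2 G (a + (a o\<^sub>L (adj w o\<^sub>L w)))"
proof -
  note cl = right_invariantD(1) [OF a] right_invariantD(1) [OF w]
  have "norm2 G a = norm (adj a (delta \<one>))"
    using norm2_adj [OF a] by (simp add: norm2_eq complex_linear_adj cl)
  also have "\<dots> \<le> norm (adj a (delta \<one>) + adj w (w (adj a (delta \<one>))))"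
    by (rule norm_one_plus_square [OF cl(2)])
  also have "\<dots> = norm2 G (adj (a + (a o\<^sub>L (adj w o\<^sub>L w))))"
    by (simp add: norm2_eq adj_add adj_compose adj_adj complex_linear_adj complex_linear_add
        complex_linear_compose cl blinfun.add_left)
  also have "\<dots> = norm2 G (a + (a o\<^sub>L (adj w o\<^sub>L w)))"
    by (intro norm2_adj right_invariant_add right_invariant_compose right_invariant_adj a w)
  finally show ?thesis .
qed

text \<open>
  The resolvent sum itself involves the identity of \<^typ>\<open>'a ell2\<close> and thus need not be in \<open>\<complex>[G]\<close>.
\<close>

lemma group_algebra_resolvent:
  assumes y: "y \<in> group_algebra G"
  shows "y o\<^sub>L resolvent_sum y n \<in> group_algebra G"
proof -
  have cl: "complex_linear y"
    using y group_algebra_right_invariant right_invariantD(1) by blast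
  have zero: "0 \<in> group_algebra G"
    using gpoly_val_in_group_algebra [of "[]" "[]"] by simp
  have pow: "y o\<^sub>L blinfun_pow (resolvent_step y) j \<in> group_algebra G" for j
  proof (induction j)
    case (Suc j)
    let ?a = "y o\<^sub>L blinfun_pow (resolvent_step y) j"
    have "y o\<^sub>L blinfun_pow (resolvent_step y) (Suc j) =
        (1 / (1 + (norm y)\<^sup>2)) *\<^sub>R ((norm y)\<^sup>2 *\<^sub>R ?a + (- 1) *\<^sub>R (y o\<^sub>L (adj y o\<^sub>L ?a)))"
      by (rule blinfun_eqI) (simp add: resolvent_step_def blinfun.bilinear_simps)
    also have "\<dots> \<in> group_algebra G"
      by (intro group_algebra_scaleR group_algebra_add group_algebra_compose group_algebra_adj
          Suc y)
    finally show ?case .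
  next
    case 0
    have "y o\<^sub>L id_blinfun = y" by (rule blinfun_eqI) simp
    with y show ?case by simp
  qed
  have "y o\<^sub>L (\<Sum>j<n. blinfun_pow (resolvent_step y) j) \<in> group_algebra G"
    by (induction n) (auto simp: zero blinfun_compose_add_right intro!: group_algebra_add pow)
  then have "(1 / (1 + (norm y)\<^sup>2)) *\<^sub>R (y o\<^sub>L (\<Sum>j<n. blinfun_pow (resolvent_step y) j)) \<in> group_algebra G"
    by (rule group_algebra_scaleR)
  moreover have "(1 / (1 + (norm y)\<^sup>2)) *\<^sub>R (y o\<^sub>L (\<Sum>j<n. blinfun_pow (resolvent_step y) j)) =
      y o\<^sub>L resolvent_sum y n"
    by (rule blinfun_eqI) (simp add: resolvent_sum_def blinfun.bilinear_simps)
  ultimately show ?thesis by simp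
qed

text \<open>
  The density theorem of Kaplansky, for strict contractions and for approximation in the 2-norm.
  Let \<open>f(y) = 2 y (1 + y\<^sup>*y)\<^sup>-\<^sup>1\<close>, which is always a contraction. If \<open>f(w) = x\<close> and \<open>y\<close> is close to \<open>w\<close>
  in the 2-norm, then \<open>f(y)\<close> is close to \<open>x\<close>, however large the operator norm of \<open>y\<close> is, because
  \<open>(f(y) - f(w)) (1 + w\<^sup>*w) = 2 (1 + yy\<^sup>*)\<^sup>-\<^sup>1 (y - w) + f(y) (w - y)\<^sup>* w\<close>
  and right multiplication by \<open>1 + w\<^sup>*w\<close> does not decrease the 2-norm. Here \<open>y \<in> \<complex>[G]\<close> may be any element
  with \<open>y \<delta>\<^sub>e\<close> close to \<open>w \<delta>\<^sub>e\<close>; no control of its operator norm is needed.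
\<close>

lemma kaplansky_strict:
  assumes x: "x \<in> right_invariant G" and s: "norm x \<le> s" "s < 1" and "\<epsilon> > 0"
  obtains z where "z \<in> group_algebra G" "norm z \<le> 1" "norm2 G (x - z) < \<epsilon>"
proof -
  obtain w where w: "w \<in> right_invariant G" "norm w \<le> 1"
    and e': "norm (x + (x o\<^sub>L (adj w o\<^sub>L w)) - 2 *\<^sub>R w) \<le> \<epsilon> / 4"
    using approximate_preimage [OF x s, of "\<epsilon> / 4"] \<open>\<epsilon> > 0\<close> by auto
  define e where "e = x + (x o\<^sub>L (adj w o\<^sub>L w)) - 2 *\<^sub>R w"
  \<comment> \<open>the errors below add up to at most \<open>9 \<delta> + \<epsilon> / 4\<close>\<close>
  define \<delta> where "\<delta> = min 1 (\<epsilon> / 20)"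
  have \<delta>: "0 < \<delta>" "\<delta> \<le> 1" "\<delta> \<le> \<epsilon> / 20" using \<open>\<epsilon> > 0\<close> by (auto simp: \<delta>_def)
  obtain y where y: "y \<in> group_algebra G" and ywd: "norm (y (delta \<one>) - w (delta \<one>)) < \<delta>"
    using group_algebra_dense [of "w (delta \<one>)", OF _ \<delta>(1)] right_invariantD(2) [OF w(1)] by metis
  have yri: "y \<in> right_invariant G" using y group_algebra_right_invariant by blast
  have cly: "complex_linear y" and clw: "complex_linear w"
    using yri w right_invariantD(1) by auto
  have yw: "norm2 G (w - y) \<le> \<delta>"
    using ywd by (simp add: norm2_eq complex_linear_diff cly clw blinfun.diff_left norm_minus_commute)
  define q where "q = (norm y)\<^sup>2 / (1 + (norm y)\<^sup>2)"
  have "q < 1" unfolding q_def by (simp add: add_pos_nonneg)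
  then obtain n where n: "q ^ n < \<delta>"
    using real_arch_pow_inv [of \<delta> q] \<delta> by auto
  have pow: "norm (blinfun_pow (resolvent_step y) n \<xi>) \<le> \<delta> * norm \<xi>"
    and pow': "norm (blinfun_pow (resolvent_step (adj y)) n \<xi>) \<le> \<delta> * norm \<xi>" for \<xi>
  proof -
    have "q ^ n * norm \<xi> \<le> \<delta> * norm \<xi>" using n by (simp add: mult_right_mono)
    then show "norm (blinfun_pow (resolvent_step y) n \<xi>) \<le> \<delta> * norm \<xi>"
      "norm (blinfun_pow (resolvent_step (adj y)) n \<xi>) \<le> \<delta> * norm \<xi>"
      using norm_blinfun_pow [OF norm_resolvent_step [OF cly], of n \<xi>]
        norm_blinfun_pow [OF norm_resolvent_step [OF complex_linear_adj [OF cly]], of n \<xi>]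
      by (auto simp: norm_eq_adj cly simp flip: q_def)
  qed
  \<comment> \<open>\<open>z\<close> approximates \<open>f(y)\<close>; its norm may exceed 1 by \<open>\<delta>\<close>, which is corrected at the end\<close>
  define z where "z = 2 *\<^sub>R (y o\<^sub>L resolvent_sum y n)"
  have zga: "z \<in> group_algebra G"
    unfolding z_def by (intro group_algebra_scaleR group_algebra_resolvent y)
  then have zri: "z \<in> right_invariant G" using group_algebra_right_invariant by blast
  have nz: "norm z \<le> 1 + \<delta>"
  proof (rule norm_blinfun_bound)
    fix \<xi>
    have "norm (z \<xi>) = 2 * norm (y (resolvent_sum y n \<xi>))"
      by (simp add: z_def blinfun.scaleR_left)
    also have "\<dots> \<le> norm (\<xi> - blinfun_pow (resolvent_step y) n \<xi>)"
      using norm_one_plus_square(2) [OF cly] resolvent_sum_left by metis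
    also have "\<dots> \<le> norm \<xi> + \<delta> * norm \<xi>"
      using norm_triangle_ineq4 pow by (metis add_left_mono order_trans)
    finally show "norm (z \<xi>) \<le> (1 + \<delta>) * norm \<xi>" by (simp add: algebra_simps)
  qed (use \<delta> in simp)
  \<comment> \<open>\<open>?R\<close> approximates \<open>(1 + yy\<^sup>*)\<^sup>-\<^sup>1\<close>, with residual \<open>?P = 1 - (1 + yy\<^sup>*) ?R\<close>\<close>
  let ?R = "resolvent_sum (adj y) n" and ?P = "blinfun_pow (resolvent_step (adj y)) n"
  have nR: "norm (?R \<xi>) \<le> 2 * norm \<xi>" for \<xi>
  proof -
    have "norm (?R \<xi>) \<le> norm (\<xi> - ?P \<xi>)"
      using norm_one_plus_square(1) [OF complex_linear_adj [OF cly]] resolvent_sum_left by metis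
    also have "\<dots> \<le> norm \<xi> + \<delta> * norm \<xi>"
      using norm_triangle_ineq4 pow' by (metis add_left_mono order_trans)
    also have "\<dots> \<le> 2 * norm \<xi>" using \<delta> mult_right_mono [of \<delta> 1 "norm \<xi>"] by simp
    finally show ?thesis .
  qed
  define b where "b = z o\<^sub>L (adj (w - y) o\<^sub>L w)"
  have nb: "norm (b (delta \<one>)) \<le> 2 * \<delta>"
  proof -
    have wy: "w - y \<in> right_invariant G" by (intro right_invariant_diff w yri)
    have bri: "adj (w - y) o\<^sub>L w \<in> right_invariant G"
      by (intro right_invariant_compose right_invariant_adj wy w)
    have "norm (b (delta \<one>)) = norm2 G b"
      unfolding b_def by (metis norm2_eq right_invariantD(1) right_invariant_compose bri zri)
    also have "\<dots> \<le> norm z * norm2 G (adj (w - y) o\<^sub>L w)"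
      unfolding b_def by (rule norm2_compose_left [OF zri bri])
    also have "\<dots> \<le> 2 * (norm2 G (w - y) * 1)"
    proof (intro mult_mono)
      show "norm2 G (adj (w - y) o\<^sub>L w) \<le> norm2 G (w - y) * 1"
        using norm2_compose_right [OF right_invariant_adj [OF wy] w(1)]
          mult_left_mono [OF w(2) norm2_nonneg [OF wy]]
        unfolding norm2_adj [OF wy] by (rule order_trans)
    qed (use nz \<delta> norm2_nonneg [OF bri] in auto)
    finally show ?thesis using yw by simp
  qed
  have ri: "(z - x) + ((z - x) o\<^sub>L (adj w o\<^sub>L w)) \<in> right_invariant G"
    by (intro right_invariant_add right_invariant_diff right_invariant_compose
        right_invariant_adj zri x w)
  have "norm2 G (z - x) \<le> norm2 G ((z - x) + ((z - x) o\<^sub>L (adj w o\<^sub>L w)))"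
    by (intro norm2_le_one_plus_square right_invariant_diff zri x w)
  also have "\<dots> = norm (((z - x) + ((z - x) o\<^sub>L (adj w o\<^sub>L w))) (delta \<one>))"
    by (rule norm2_eq [OF right_invariantD(1) [OF ri]])
  also have "((z - x) + ((z - x) o\<^sub>L (adj w o\<^sub>L w))) (delta \<one>) =
      2 *\<^sub>R ?R (y (delta \<one>) - w (delta \<one>)) + b (delta \<one>) - 2 *\<^sub>R ?P (w (delta \<one>)) - e (delta \<one>)"
  proof -
    have zR: "z \<xi> = 2 *\<^sub>R ?R (y \<xi>)" for \<xi>
      by (simp add: z_def blinfun.scaleR_left resolvent_sum_intertwine cly)
    define \<omega> where "\<omega> = w (delta \<one>)"
    have "?P \<omega> = \<omega> - ?R (\<omega> + y (adj y \<omega>))"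
      using resolvent_sum_right [of "adj y" n \<omega>] by (simp add: adj_adj cly)
    then show ?thesis
      by (simp add: b_def e_def adj_diff clw cly blinfun.bilinear_simps scaleR_add_right
          scaleR_diff_right zR flip: \<omega>_def)
  qed
  also have "norm \<dots> \<le> 2 * (2 * \<delta>) + 2 * \<delta> + 2 * \<delta> + \<epsilon> / 4"
  proof (intro norm_triangle_le_diff norm_triangle_le add_mono)
    show "norm (2 *\<^sub>R ?R (y (delta \<one>) - w (delta \<one>))) \<le> 2 * (2 * \<delta>)"
      using nR [of "y (delta \<one>) - w (delta \<one>)"] ywd by simp
    have "norm (?P (w (delta \<one>))) \<le> \<delta> * norm (w (delta \<one>))" by (rule pow')
    also have "norm (w (delta \<one>)) \<le> 1"
      using norm_blinfun [of w "delta \<one>"] w(2) by (simp add: norm_delta)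
    finally show "norm (2 *\<^sub>R ?P (w (delta \<one>))) \<le> 2 * \<delta>" using \<delta> by simp
    show "norm (e (delta \<one>)) \<le> \<epsilon> / 4"
      using norm_blinfun [of e "delta \<one>"] e' by (simp add: norm_delta e_def)
  qed (rule nb)
  finally have zx: "norm2 G (z - x) \<le> 8 * \<delta> + \<epsilon> / 4" by simp
  define z' where "z' = (1 / (1 + \<delta>)) *\<^sub>R z"
  have z'ga: "z' \<in> group_algebra G" unfolding z'_def by (rule group_algebra_scaleR [OF zga])
  have nz': "norm z' \<le> 1" using nz \<delta> by (simp add: z'_def)
  have z'ri: "z' \<in> right_invariant G" using z'ga group_algebra_right_invariant by blast
  have zz: "z' - z = (- \<delta>) *\<^sub>R z'"
  proof -
    have "z = (1 + \<delta>) *\<^sub>R z'" using \<delta> by (simp add: z'_def)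
    then show ?thesis by (simp add: scaleR_add_left)
  qed
  have "norm2 G (z' - z) = \<delta> * norm2 G z'"
    using \<delta> by (simp only: zz norm2_scaleR [OF z'ri] abs_minus_cancel abs_of_pos)
  also have "\<dots> \<le> \<delta>" using norm2_le_norm [OF z'ri] nz' \<delta> by (simp add: mult_left_le)
  finally have "norm2 G ((z' - z) + (z - x)) \<le> \<delta> + (8 * \<delta> + \<epsilon> / 4)"
    using norm2_triangle [of "z' - z" "z - x"] zx
    by (smt (verit) right_invariant_diff z'ri zri x)
  also have "\<dots> < \<epsilon>" using \<delta> \<open>\<epsilon> > 0\<close> by simp
  finally have "norm2 G (z' - x) < \<epsilon>" by simp
  moreover have "norm2 G (x - z') = norm2 G (z' - x)"
    using x z'ri
    by (simp add: norm2_eq right_invariantD complex_linear_diff blinfun.diff_left norm_minus_commute)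
  ultimately show thesis using that [OF z'ga nz'] by simp
qed

lemma kaplansky:
  assumes x: "x \<in> right_invariant G" and r: "norm x \<le> r" and "\<epsilon> > 0"
  obtains z where "z \<in> group_algebra G" "norm z \<le> r" "norm2 G (x - z) < \<epsilon>"
proof (cases "r = 0")
  case True
  have "0 \<in> group_algebra G"
    using gpoly_val_in_group_algebra [of "[]" "[]"] by simp
  then show thesis
    using that [of 0] True r \<open>\<epsilon> > 0\<close> by (simp add: norm2_eq complex_linear_zero)
next
  case False
  then have r0: "r > 0" using r norm_ge_zero [of x] by linarith
  \<comment> \<open>shrinking \<open>x / r\<close> by the factor \<open>s\<close> moves \<open>x\<close> by at most \<open>\<epsilon> / 2\<close>\<close>
  define s where "s = max (1 / 2) (1 - \<epsilon> / (2 * r))"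
  have s: "0 < s" "s < 1" "(1 - s) * r \<le> \<epsilon> / 2"
    using r0 \<open>\<epsilon> > 0\<close> by (auto simp: s_def max_def field_simps)
  have x': "(s / r) *\<^sub>R x \<in> right_invariant G" by (rule right_invariant_scaleR [OF x])
  have "norm ((s / r) *\<^sub>R x) \<le> s"
    using r r0 s by (simp add: divide_simps mult_left_mono)
  then obtain z where z: "z \<in> group_algebra G" "norm z \<le> 1"
    "norm2 G ((s / r) *\<^sub>R x - z) < \<epsilon> / (2 * r)"
    using kaplansky_strict [OF x' _ s(2), of "\<epsilon> / (2 * r)"] \<open>\<epsilon> > 0\<close> r0 by auto
  have zri: "z \<in> right_invariant G" using z group_algebra_right_invariant by blast
  have "x - r *\<^sub>R z = (1 - s) *\<^sub>R x + r *\<^sub>R ((s / r) *\<^sub>R x - z)"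
    using r0 by (simp add: scaleR_diff_right scaleR_diff_left)
  then have "norm2 G (x - r *\<^sub>R z) \<le> norm2 G ((1 - s) *\<^sub>R x) + norm2 G (r *\<^sub>R ((s / r) *\<^sub>R x - z))"
    by (simp add: norm2_triangle right_invariant_scaleR right_invariant_diff x zri)
  also have "\<dots> = (1 - s) * norm2 G x + r * norm2 G ((s / r) *\<^sub>R x - z)"
    using r0 s
    by (simp add: norm2_scaleR right_invariant_scaleR right_invariant_diff x zri)
  also have "\<dots> < \<epsilon> / 2 + \<epsilon> / 2"
  proof (rule add_le_less_mono)
    have "norm2 G x \<le> r" using norm2_le_norm [OF x] r by simp
    then show "(1 - s) * norm2 G x \<le> \<epsilon> / 2"
      using s mult_left_mono [of "norm2 G x" r "1 - s"] by linarith
    show "r * norm2 G ((s / r) *\<^sub>R x - z) < \<epsilon> / 2"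
      using z(3) r0 by (simp add: field_simps)
  qed
  finally have "norm2 G (x - r *\<^sub>R z) < \<epsilon>" by simp
  moreover have "norm (r *\<^sub>R z) \<le> r" using z(2) r0 by (simp add: mult_left_le)
  ultimately show thesis using that group_algebra_scaleR [OF z(1)] by blast
qed

end

section \<open>Transfer between groups\<close>

lemma qf_equivD:
  assumes "qf_equiv G g H h" "gterm_vars v \<subseteq> {..<length g}" "gterm_vars w \<subseteq> {..<length g}"
  shows "gterm_val G g v = gterm_val G g w \<longleftrightarrow> gterm_val H h v = gterm_val H h w"
  using assms spec [of "\<lambda>\<phi>. gform_vars \<phi> \<subseteq> {..<length g} \<longrightarrow> (gform_sat G g \<phi> \<longleftrightarrow> gform_sat H h \<phi>)" "GEq v w"]
  by (simp add: qf_equiv_def)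

lemma (in group) tr_gpoly_Cons:
  assumes "g \<in> lists (carrier G)" "gterm_vars w \<subseteq> {..<length g}"
  shows "tr G (gpoly_val G g ((c, w) # p)) =
    (if gterm_val G g w = gterm_val G g GOne then c else 0) + tr G (gpoly_val G g p)"
  using assms
  by (simp add: tr_def blinfun.add_left scaleC_op_apply cinner_delta_right ell2_coeff_simps
      left_regular_delta [OF is_group] gterm_val_closed)

text \<open>
  The trace of a value of a formal polynomial is the sum of the coefficients of those words whose
  value is trivial, and so only depends on the quantifier-free type of the tuple.
\<close>

lemma tr_gpoly_eq:
  assumes "group G" "group H" and g: "g \<in> lists (carrier G)" and h: "h \<in> lists (carrier H)"
    and len: "length h = length g" and qf: "qf_equiv G g H h"
  shows "gpoly_vars p \<subseteq> {..<length g} \<Longrightarrow> tr G (gpoly_val G g p) = tr H (gpoly_val H h p)"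
proof (induction p)
  case Nil
  then show ?case by (simp add: tr_def cinner_delta_right ell2_coeff_simps)
next
  case (Cons x p)
  obtain c w where x: "x = (c, w)" by (cases x)
  with Cons.prems have w: "gterm_vars w \<subseteq> {..<length g}" by simp
  have "gterm_val G g w = gterm_val G g GOne \<longleftrightarrow> gterm_val H h w = gterm_val H h GOne"
    by (rule qf_equivD [OF qf w]) simp
  then show ?case
    unfolding x group.tr_gpoly_Cons [OF \<open>group G\<close> g w]
      group.tr_gpoly_Cons [OF \<open>group H\<close> h w [folded len]]
    using Cons by (simp add: x)
qed

lemma norm2_gpoly_eq:
  assumes "group G" "group H" and g: "g \<in> lists (carrier G)" and h: "h \<in> lists (carrier H)"
    and len: "length h = length g" and qf: "qf_equiv G g H h" and p: "gpoly_vars p \<subseteq> {..<length g}"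
  shows "norm2 G (gpoly_val G g p) = norm2 H (gpoly_val H h p)"
proof -
  have "tr G (gpoly_val G g (gpoly_mult (gpoly_adj p) p)) = tr H (gpoly_val H h (gpoly_mult (gpoly_adj p) p))"
    by (rule tr_gpoly_eq [OF assms(1-6)]) (use p gpoly_vars_mult [of "gpoly_adj p" p] in auto)
  then show ?thesis
    using p len
    by (simp add: norm2_def group.gpoly_val_mult [OF \<open>group G\<close> g] group.gpoly_val_adj [OF \<open>group G\<close> g]
        group.gpoly_val_mult [OF \<open>group H\<close> h] group.gpoly_val_adj [OF \<open>group H\<close> h])
qed

lemma is_zero_None: "is_zero (None :: 'o::wellorder option)"
  by (simp add: is_zero_def)

lemma not_is_zero_Some: "\<not> is_zero (Some (\<alpha> :: 'o::wellorder))"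
  unfolding is_zero_def using less_option_None_Some by blast

text \<open>
  In the order type \<open>1 + \<alpha>\<close>, level 0 of the classical game is represented by \<^const>\<open>None\<close>, and level
  \<open>1 + \<beta>\<close> by \<open>Some \<beta>\<close>.
\<close>

lemma bf_equiv_tuple_Some_qf:
  assumes "bf_equiv_tuple (Some (\<alpha> :: 'o::wellorder)) G g H h" "d \<in> lists (carrier H)"
  obtains c where "c \<in> lists (carrier G)" "length c = length d" "qf_equiv G (g @ c) H (h @ d)"
proof -
  have "(None :: 'o option) \<in> {..<Some \<alpha>}" by simp
  then obtain c where "c \<in> lists (carrier G)" "length c = length d"
    "bf_equiv_tuple (None :: 'o option) G (g @ c) H (h @ d)"
    using assms not_is_zero_Some bf_equiv_tuple.simps [of "Some \<alpha>" G g H h] by metis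
  then show thesis
    using that is_zero_None bf_equiv_tuple.simps [of "None :: 'o option" G "g @ c" H "h @ d"] by metis
qed

lemma bf_equiv_tuple_Some_less:
  assumes "bf_equiv_tuple (Some (\<alpha> :: 'o::wellorder)) G g H h" "\<beta> < \<alpha>" "c \<in> lists (carrier G)"
  obtains d where "d \<in> lists (carrier H)" "length d = length c"
    "bf_equiv_tuple (Some \<beta>) G (g @ c) H (h @ d)"
proof -
  have "Some \<beta> \<in> {..<Some \<alpha>}" using assms by simp
  then show thesis
    using that assms not_is_zero_Some bf_equiv_tuple.simps [of "Some \<alpha>" G g H h] by metis
qed

lemma bf_equiv_tuple_Some_imp_qf:
  assumes "bf_equiv_tuple (Some (\<alpha> :: 'o::wellorder)) G g H h"
  shows "qf_equiv G g H h"
  using bf_equiv_tuple_Some_qf [OF assms, of "[]"] by auto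

lemma qf_equiv_sym: "length a = length b \<Longrightarrow> qf_equiv G a H b \<Longrightarrow> qf_equiv H b G a"
  by (simp add: qf_equiv_def)

lemma bf_equiv_tuple_sym:
  "length a = length b \<Longrightarrow> bf_equiv_tuple \<alpha> G a H b \<Longrightarrow> bf_equiv_tuple \<alpha> H b G a"
proof (induction \<alpha> arbitrary: a b rule: less_induct)
  case (less \<alpha>)
  show ?case
  proof (cases "is_zero \<alpha>")
    case True
    with less.prems show ?thesis
      by (simp add: bf_equiv_tuple.simps [of \<alpha>] qf_equiv_sym)
  next
    case False
    have "bf_equiv_tuple \<beta> H (b @ d) G (a @ c)"
      if "\<beta> < \<alpha>" "length d = length c" "bf_equiv_tuple \<beta> G (a @ c) H (b @ d)" for \<beta> c d
      using that less.prems by (intro less.IH) auto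
    then show ?thesis
      using False less.prems(2) unfolding bf_equiv_tuple.simps [of \<alpha>]
      by (simp only: if_False) (metis lessThan_iff)
  qed
qed

lemma (in group) gpoly_val_compose_one:
  assumes g: "g \<in> lists (carrier G)"
  shows "gpoly_vars p \<subseteq> {..<length g} \<Longrightarrow> gpoly_val G g p o\<^sub>L left_regular G \<one> = gpoly_val G g p"
proof (induction p)
  case (Cons x p)
  obtain c w where x: "x = (c, w)" by (cases x)
  have "gterm_val G g w \<in> carrier G"
    using Cons.prems by (intro gterm_val_closed [OF g]) (simp add: x)
  then show ?case
    using Cons by (simp add: x blinfun_compose_add_left scaleC_op_compose_left left_regular_mult)
qed simp

text \<open>
  One level of the back-and-forth relation suffices to transfer bounds on the operator norm, which
  is a supremum over finitely supported vectors: the support of a test vector in \<open>\<ell>\<^sup>2(H)\<close> is matched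
  by a tuple in \<open>G\<close> with the same quantifier-free type. This is the reason for the summand 1 in
  \<open>1 + \<alpha>\<close>.
\<close>

lemma norm_gpoly_transfer:
  assumes G: "group G" and H: "group H" and g: "g \<in> lists (carrier G)" and h: "h \<in> lists (carrier H)"
    and len: "length h = length g" and bf: "bf_equiv_tuple (Some (\<alpha> :: 'o::wellorder)) G g H h"
    and p: "gpoly_vars p \<subseteq> {..<length g}" and r: "norm (gpoly_val G g p) \<le> r"
  shows "norm (gpoly_val H h p) \<le> r"
proof -
  interpret G: group G by fact
  interpret H: group H by fact
  have r0: "0 \<le> r" using r norm_ge_zero order_trans by blast
  let ?x = "gpoly_val G g p" and ?y = "gpoly_val H h p"
  have vecs: "norm (?y \<zeta>) \<le> r * norm \<zeta>"
    if supp: "\<And>k. k \<notin> carrier H \<Longrightarrow> ell2_coeff \<zeta> k = 0" for \<zeta>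
  proof (rule field_le_epsilon)
    fix e :: real assume "e > 0"
    define \<epsilon> where "\<epsilon> = e / (r + norm ?y + 1)"
    have pos: "r + norm ?y + 1 > 0" using r0 by (simp add: add_nonneg_pos)
    have "\<epsilon> > 0" using \<open>e > 0\<close> pos by (simp add: \<epsilon>_def)
    obtain v where v: "v \<in> group_algebra H" "norm (v (delta \<one>\<^bsub>H\<^esub>) - \<zeta>) < \<epsilon>"
      using H.group_algebra_dense [OF supp \<open>\<epsilon> > 0\<close>] by blast
    obtain F where F: "finite F" "F \<subseteq> carrier H"
      "\<And>g. F \<subseteq> set g \<Longrightarrow> \<exists>p. gpoly_vars p \<subseteq> {..<length g} \<and> gpoly_val H g p = v"
      using H.group_algebra_support [OF v(1)] by blast
    obtain d where d: "set d = F" using finite_list [OF F(1)] by blast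
    then have dl: "d \<in> lists (carrier H)" using F by (auto simp: in_lists_conv_set)
    obtain q where q: "gpoly_vars q \<subseteq> {..<length (h @ d)}" "gpoly_val H (h @ d) q = v"
      using F(3) [of "h @ d"] d by auto
    obtain c where c: "c \<in> lists (carrier G)" "length c = length d" "qf_equiv G (g @ c) H (h @ d)"
      using bf_equiv_tuple_Some_qf [OF bf dl] .
    have gc: "g @ c \<in> lists (carrier G)" and hd: "h @ d \<in> lists (carrier H)"
      using g h c dl by auto
    have len': "length (h @ d) = length (g @ c)" using len c by simp
    have q': "gpoly_vars q \<subseteq> {..<length (g @ c)}" and p': "gpoly_vars p \<subseteq> {..<length (g @ c)}"
      using q p len' by auto
    have pq: "gpoly_vars (gpoly_mult p q) \<subseteq> {..<length (g @ c)}"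
      using gpoly_vars_mult [of p q] p' q' by blast
    let ?v = "gpoly_val G (g @ c) q"
    have vri: "v \<in> right_invariant H" using v(1) H.group_algebra_right_invariant by blast
    have vri': "?v \<in> right_invariant G" by (rule G.gpoly_val_right_invariant [OF gc q'])
    have xri: "?x \<in> right_invariant G" by (rule G.gpoly_val_right_invariant [OF g p])
    have yri: "?y \<in> right_invariant H" by (rule H.gpoly_val_right_invariant [OF h]) (use p len in simp)
    have xe: "gpoly_val G (g @ c) p = ?x" by (rule gpoly_val_append_tuple [OF p])
    have ye: "gpoly_val H (h @ d) p = ?y" by (rule gpoly_val_append_tuple) (use p len in simp)
    have "norm (?y (v (delta \<one>\<^bsub>H\<^esub>))) = norm2 H (?y o\<^sub>L v)"
      using right_invariantD(1) [OF vri] right_invariantD(1) [OF yri]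
      by (simp add: norm2_eq complex_linear_compose)
    also have "\<dots> = norm2 H (gpoly_val H (h @ d) (gpoly_mult p q))"
      using q(1) p' len' by (simp add: H.gpoly_val_mult [OF hd] q(2) ye)
    also have "\<dots> = norm2 G (gpoly_val G (g @ c) (gpoly_mult p q))"
      by (rule norm2_gpoly_eq [OF G H gc hd len' c(3) pq, symmetric])
    also have "\<dots> = norm2 G (?x o\<^sub>L ?v)"
      by (simp only: G.gpoly_val_mult [OF gc p' q'] xe)
    also have "\<dots> \<le> norm ?x * norm2 G ?v" by (rule G.norm2_compose_left [OF xri vri'])
    also have "\<dots> \<le> r * norm2 G ?v" by (intro mult_right_mono r G.norm2_nonneg vri')
    also have "norm2 G ?v = norm2 H v"
      using norm2_gpoly_eq [OF G H gc hd len' c(3) q'] q(2) by simp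
    also have "norm2 H v = norm (v (delta \<one>\<^bsub>H\<^esub>))"
      by (rule norm2_eq [OF right_invariantD(1) [OF vri]])
    also have "\<dots> \<le> norm \<zeta> + \<epsilon>"
      using v(2) norm_triangle_ineq2 [of "v (delta \<one>\<^bsub>H\<^esub>)" \<zeta>] by linarith
    finally have yv: "norm (?y (v (delta \<one>\<^bsub>H\<^esub>))) \<le> r * (norm \<zeta> + \<epsilon>)"
      using r0 by (simp add: mult_left_mono)
    have "norm (?y (\<zeta> - v (delta \<one>\<^bsub>H\<^esub>))) \<le> norm ?y * norm (\<zeta> - v (delta \<one>\<^bsub>H\<^esub>))"
      by (rule norm_blinfun)
    also have "\<dots> \<le> norm ?y * \<epsilon>"
      by (intro mult_left_mono) (use v(2) in \<open>auto simp: norm_minus_commute\<close>)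
    finally have "norm (?y \<zeta>) \<le> r * (norm \<zeta> + \<epsilon>) + norm ?y * \<epsilon>"
      using yv norm_triangle_ineq [of "?y (v (delta \<one>\<^bsub>H\<^esub>))" "?y (\<zeta> - v (delta \<one>\<^bsub>H\<^esub>))"]
      by (simp add: blinfun.diff_right)
    also have "\<dots> \<le> r * norm \<zeta> + (r + norm ?y + 1) * \<epsilon>"
      using \<open>\<epsilon> > 0\<close> by (simp add: algebra_simps)
    also have "\<dots> = r * norm \<zeta> + e" using pos by (simp add: \<epsilon>_def)
    finally show "norm (?y \<zeta>) \<le> r * norm \<zeta> + e" .
  qed
  show ?thesis
  proof (rule norm_blinfun_bound [OF r0])
    fix \<xi>
    \<comment> \<open>\<open>?\<zeta>\<close> is the orthogonal projection of \<open>\<xi>\<close> to \<open>\<ell>\<^sup>2(H)\<close>\<close>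
    let ?\<zeta> = "left_regular H \<one>\<^bsub>H\<^esub> \<xi>"
    have "?y o\<^sub>L left_regular H \<one>\<^bsub>H\<^esub> = ?y"
      using H.gpoly_val_compose_one [OF h] p len by simp
    then have "?y \<xi> = ?y ?\<zeta>" by (metis blinfun_apply_blinfun_compose)
    moreover have "norm (?y ?\<zeta>) \<le> r * norm ?\<zeta>"
      by (rule vecs) (simp add: H.coeff_left_regular)
    moreover have "norm ?\<zeta> \<le> norm \<xi>"
      by (simp add: left_regular_apply [OF H] norm_translate [OF H])
    ultimately show "norm (?y \<xi>) \<le> r * norm \<xi>"
      using r0 mult_left_mono [of "norm ?\<zeta>" "norm \<xi>" r] by simp
  qed
qed


section \<open>Weak moduli and continuity of the distances\<close>

text \<open>
  A weak modulus is continuous at 0 along sequences supported in \<open>{..<m}\<close>: subadditivity reduces this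
  to continuity in each argument.
\<close>

lemma weak_modulus_small:
  assumes \<Omega>: "weak_modulus \<Omega>" and "\<epsilon> > 0"
  obtains \<eta> :: real where "\<eta> > 0"
    "\<And>\<delta>. \<delta> \<in> nonneg_seqs \<Longrightarrow> (\<And>i. i < m \<Longrightarrow> \<delta> i < \<eta>) \<Longrightarrow> (\<And>i. m \<le> i \<Longrightarrow> \<delta> i = 0) \<Longrightarrow> \<Omega> \<delta> \<le> ennreal \<epsilon>"
proof -
  have sub: "\<Omega> (\<lambda>i. \<delta> i + \<delta>' i) \<le> \<Omega> \<delta> + \<Omega> \<delta>'" if "\<delta> \<in> nonneg_seqs" "\<delta>' \<in> nonneg_seqs" for \<delta> \<delta>'
    using \<Omega> that by (auto simp: weak_modulus_def)
  have zero: "\<Omega> (\<lambda>_. 0) = 0" using \<Omega> by (auto simp: weak_modulus_def)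
  have "\<exists>\<eta>>0. \<forall>\<delta>\<in>nonneg_seqs. (\<forall>i<m. \<delta> i < \<eta>) \<longrightarrow> (\<forall>i\<ge>m. \<delta> i = 0) \<longrightarrow> \<Omega> \<delta> \<le> ennreal \<epsilon>"
    using \<open>\<epsilon> > 0\<close>
  proof (induction m arbitrary: \<epsilon>)
    case 0
    have "\<Omega> \<delta> \<le> ennreal \<epsilon>" if "\<forall>i\<ge>0. \<delta> i = 0" for \<delta>
    proof -
      have "\<delta> = (\<lambda>_. 0)" using that by auto
      then show ?thesis by (simp only: zero zero_le)
    qed
    then show ?case by (metis zero_less_one)
  next
    case (Suc m)
    obtain \<eta> where \<eta>: "\<eta> > 0"
      "\<And>\<delta>. \<delta> \<in> nonneg_seqs \<Longrightarrow> \<forall>i<m. \<delta> i < \<eta> \<Longrightarrow> \<forall>i\<ge>m. \<delta> i = 0 \<Longrightarrow> \<Omega> \<delta> \<le> ennreal (\<epsilon> / 2)"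
      using Suc.IH [of "\<epsilon> / 2"] Suc.prems by auto
    let ?f = "\<lambda>t. \<Omega> ((\<lambda>_. 0)(m := t))"
    have "(\<lambda>_. 0) \<in> nonneg_seqs" by (simp add: nonneg_seqs_def)
    then have "continuous_on {0..} ?f"
      using \<Omega> unfolding weak_modulus_def by blast
    then have "(?f \<longlongrightarrow> ?f 0) (at 0 within {0..})"
      by (simp add: continuous_on_def)
    moreover have "?f 0 = 0"
      using zero by (simp add: fun_upd_idem)
    ultimately have "\<forall>\<^sub>F t in at 0 within {0..}. ?f t < ennreal (\<epsilon> / 2)"
      using Suc.prems by (intro order_tendstoD(2)) auto
    then obtain \<theta> where \<theta>: "\<theta> > 0" "\<And>t. t \<ge> 0 \<Longrightarrow> t \<noteq> 0 \<Longrightarrow> t < \<theta> \<Longrightarrow> ?f t < ennreal (\<epsilon> / 2)"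
      unfolding eventually_at by (auto simp: dist_real_def)
    have \<theta>': "?f t \<le> ennreal (\<epsilon> / 2)" if "t \<ge> 0" "t < \<theta>" for t
      using \<theta>(2) [OF that(1) _ that(2)] \<open>?f 0 = 0\<close> by (cases "t = 0") auto
    have "\<Omega> \<delta> \<le> ennreal \<epsilon>"
      if \<delta>: "\<delta> \<in> nonneg_seqs" "\<forall>i<Suc m. \<delta> i < min \<eta> \<theta>" "\<forall>i\<ge>Suc m. \<delta> i = 0" for \<delta>
    proof -
      have "\<Omega> (\<lambda>i. (\<delta>(m := 0)) i + ((\<lambda>_. 0)(m := \<delta> m)) i) \<le> \<Omega> (\<delta>(m := 0)) + ?f (\<delta> m)"
        by (rule sub) (use \<delta> in \<open>auto simp: nonneg_seqs_def\<close>)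
      also have "(\<lambda>i. (\<delta>(m := 0)) i + ((\<lambda>_. 0)(m := \<delta> m)) i) = \<delta>" by auto
      also have "\<Omega> (\<delta>(m := 0)) + ?f (\<delta> m) \<le> ennreal (\<epsilon> / 2) + ennreal (\<epsilon> / 2)"
      proof (intro add_mono \<theta>' \<eta>)
        show "\<forall>i\<ge>m. (\<delta>(m := 0)) i = 0"
          using \<delta> by (metis Suc_leI fun_upd_apply le_neq_implies_less)
      qed (use \<delta> in \<open>auto simp: nonneg_seqs_def\<close>)
      also have "\<dots> = ennreal \<epsilon>"
        using Suc.prems by (simp flip: ennreal_plus)
      finally show ?thesis .
    qed
    then show ?case using \<eta>(1) \<theta>(1) by (intro exI [of _ "min \<eta> \<theta>"]) auto
  qed
  then show thesis using that by blast
qed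

lemma vna_language_simps:
  "fun_dom vna_language = vna_fun_dom" "fun_cod vna_language = vna_fun_cod"
  "fun_mod vna_language = vna_fun_mod" "pred_dom vna_language (VDist n) = [n, n]"
  "pred_mod vna_language P \<delta> = \<delta> ! 0 + \<delta> ! 1" "pred_bound vna_language (VDist n) = {0..2 * real n}"
  by (simp_all add: vna_language_def)

lemma group_vna_structure_simps:
  "sort_of (group_vna_structure G) n = {x \<in> group_vna G. norm x \<le> real n}"
  "fun_interp (group_vna_structure G) = vna_fun_interp G"
  "pred_interp (group_vna_structure G) (VDist n) xs = norm2 G (xs ! 0 - xs ! 1)"
  by (simp_all add: group_vna_structure_def)

text \<open>
  Tuples of operators in the balls of radii \<open>ss\<close>. Membership in \<open>L(G)\<close> is relaxed to right
  invariance, which is preserved by all function symbols for algebraic reasons and still entails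
  the estimates of the 2-norm behind the moduli.
\<close>

definition bounded_ops :: "('a, 'm) monoid_scheme \<Rightarrow> nat list \<Rightarrow> ('a ell2 \<Rightarrow>\<^sub>L 'a ell2) list \<Rightarrow> bool"
  where "bounded_ops G ss a \<longleftrightarrow>
    list_all2 (\<lambda>s x. x \<in> right_invariant G \<and> norm x \<le> real s) ss a"

context group
begin

lemma term_in_sort:
  assumes "has_sort vna_language ss t s" "bounded_ops G ss a"
  shows "mterm_val (group_vna_structure G) a t \<in> right_invariant G \<and>
    norm (mterm_val (group_vna_structure G) a t) \<le> real s"
  using assms(1)
proof (induction rule: has_sort.induct)
  case (1 i)
  then show ?case using assms(2) by (auto simp: bounded_ops_def list_all2_conv_all_nth)
next
  case (2 ts F)
  show ?case
  proof (cases F)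
    case (VMult m n)
    then obtain t u where ts: "ts = [t, u]"
      and t: "mterm_val (group_vna_structure G) a t \<in> right_invariant G"
        "norm (mterm_val (group_vna_structure G) a t) \<le> real m"
      and u: "mterm_val (group_vna_structure G) a u \<in> right_invariant G"
        "norm (mterm_val (group_vna_structure G) a u) \<le> real n"
      using 2 by (auto simp: vna_language_simps list_all2_Cons2)
    have "norm (mterm_val (group_vna_structure G) a t o\<^sub>L mterm_val (group_vna_structure G) a u)
        \<le> real m * real n"
      by (rule order_trans [OF norm_blinfun_compose mult_mono]) (use t u in auto)
    then show ?thesis
      using t u by (simp add: VMult ts vna_language_simps group_vna_structure_simps right_invariant_compose)
  next
    case (VScale c n)
    then obtain t where ts: "ts = [t]"
      and t: "mterm_val (group_vna_structure G) a t \<in> right_invariant G"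
        "norm (mterm_val (group_vna_structure G) a t) \<le> real n"
      using 2 by (auto simp: vna_language_simps list_all2_Cons2)
    have "norm (scaleC_op c (mterm_val (group_vna_structure G) a t)) \<le> cmod c * real n"
      by (rule order_trans [OF norm_scaleC_op mult_left_mono]) (use t in auto)
    also have "\<dots> \<le> real (nat \<lceil>cmod c * real n\<rceil>)" by (rule real_nat_ceiling_ge)
    finally show ?thesis
      using t by (simp add: VScale ts vna_language_simps group_vna_structure_simps right_invariant_scaleC)
  next
    case (VAdd m n)
    then obtain t u where ts: "ts = [t, u]"
      and t: "mterm_val (group_vna_structure G) a t \<in> right_invariant G"
        "norm (mterm_val (group_vna_structure G) a t) \<le> real m"
      and u: "mterm_val (group_vna_structure G) a u \<in> right_invariant G"
        "norm (mterm_val (group_vna_structure G) a u) \<le> real n"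
      using 2 by (auto simp: vna_language_simps list_all2_Cons2)
    then show ?thesis
      by (simp add: VAdd ts vna_language_simps group_vna_structure_simps right_invariant_add
          norm_triangle_le add_mono)
  next
    case (VAdj n)
    then obtain t where ts: "ts = [t]"
      and t: "mterm_val (group_vna_structure G) a t \<in> right_invariant G"
        "norm (mterm_val (group_vna_structure G) a t) \<le> real n"
      using 2 by (auto simp: vna_language_simps list_all2_Cons2)
    then show ?thesis
      by (simp add: VAdj ts vna_language_simps group_vna_structure_simps right_invariant_adj
          norm_eq_adj right_invariantD(1))
  next
    case (VIncl n k)
    then show ?thesis
      using 2 by (auto simp: vna_language_simps group_vna_structure_simps list_all2_Cons2)
  qed (use 2 in \<open>auto simp: vna_language_simps group_vna_structure_simps right_invariant_zero
      right_invariant_left_regular norm_left_regular\<close>)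
qed

lemma term_obeys_modulus:
  assumes "has_sort vna_language ss t s" and a: "bounded_ops G ss a" and a': "bounded_ops G ss a'"
    and \<delta>: "\<And>i. i < length ss \<Longrightarrow> norm2 G (a ! i - a' ! i) \<le> \<delta> i"
  shows "norm2 G (mterm_val (group_vna_structure G) a t - mterm_val (group_vna_structure G) a' t)
    \<le> mterm_mod vna_language t \<delta>"
  using assms(1)
proof (induction rule: has_sort.induct)
  case (1 i)
  then show ?case using \<delta> by simp
next
  case (2 ts F)
  let ?v = "mterm_val (group_vna_structure G) a" and ?v' = "mterm_val (group_vna_structure G) a'"
  let ?m = "\<lambda>t. mterm_mod vna_language t \<delta>"
  have ri: "?v t \<in> right_invariant G" "norm (?v t) \<le> real s"
    "?v' t \<in> right_invariant G" "norm (?v' t) \<le> real s" if "has_sort vna_language ss t s" for t s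
    using term_in_sort [OF that a] term_in_sort [OF that a'] by auto
  have zero: "norm2 G 0 = 0"
    by (simp add: norm2_eq complex_linear_zero)
  show ?case
  proof (cases F)
    case (VMult m n)
    then obtain t u where ts: "ts = [t, u]"
      and tu: "has_sort vna_language ss t m" "has_sort vna_language ss u n"
      and t: "norm2 G (?v t - ?v' t) \<le> ?m t" and u: "norm2 G (?v u - ?v' u) \<le> ?m u"
      using 2 by (auto simp: vna_language_simps list_all2_Cons2)
    note ri = ri [OF tu(1)] ri [OF tu(2)]
    have "(?v t o\<^sub>L ?v u) - (?v' t o\<^sub>L ?v' u) = ((?v t - ?v' t) o\<^sub>L ?v u) + (?v' t o\<^sub>L (?v u - ?v' u))"
      by (simp add: blinfun_compose_diff_left blinfun_compose_diff_right)
    then have "norm2 G ((?v t o\<^sub>L ?v u) - (?v' t o\<^sub>L ?v' u)) \<le>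
        norm2 G ((?v t - ?v' t) o\<^sub>L ?v u) + norm2 G (?v' t o\<^sub>L (?v u - ?v' u))"
      by (simp add: norm2_triangle right_invariant_compose right_invariant_diff ri)
    also have "\<dots> \<le> norm2 G (?v t - ?v' t) * norm (?v u) + norm (?v' t) * norm2 G (?v u - ?v' u)"
      by (intro add_mono norm2_compose_right norm2_compose_left right_invariant_diff ri)
    also have "\<dots> \<le> ?m t * real n + real m * ?m u"
    proof (intro add_mono mult_mono ri t u)
      show "0 \<le> ?m t" using t norm2_nonneg [OF right_invariant_diff] ri order_trans by blast
    qed (auto intro: norm2_nonneg right_invariant_diff ri)
    finally show ?thesis
      by (simp add: VMult ts vna_language_simps group_vna_structure_simps mult.commute)
  next
    case (VScale c n)
    then obtain t where ts: "ts = [t]" and hs: "has_sort vna_language ss t n"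
      and t: "norm2 G (?v t - ?v' t) \<le> ?m t"
      using 2 by (auto simp: vna_language_simps list_all2_Cons2)
    have "scaleC_op c (?v t) - scaleC_op c (?v' t) = scaleC_op c (?v t - ?v' t)"
      by (simp add: minus_op_eq scaleC_op_add scaleC_op_scaleC_op mult.commute)
    then show ?thesis
      using t by (simp add: VScale ts vna_language_simps group_vna_structure_simps norm2_scaleC
          right_invariant_diff ri [OF hs] mult_left_mono)
  next
    case (VAdd m n)
    then obtain t u where ts: "ts = [t, u]"
      and tu: "has_sort vna_language ss t m" "has_sort vna_language ss u n"
      and t: "norm2 G (?v t - ?v' t) \<le> ?m t" and u: "norm2 G (?v u - ?v' u) \<le> ?m u"
      using 2 by (auto simp: vna_language_simps list_all2_Cons2)
    have "norm2 G ((?v t - ?v' t) + (?v u - ?v' u)) \<le> ?m t + ?m u"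
      using norm2_triangle [OF right_invariant_diff right_invariant_diff] ri [OF tu(1)] ri [OF tu(2)] t u
      by (meson add_mono order_trans)
    then show ?thesis
      by (simp add: VAdd ts vna_language_simps group_vna_structure_simps algebra_simps)
  next
    case (VAdj n)
    then obtain t where ts: "ts = [t]" and hs: "has_sort vna_language ss t n"
      and t: "norm2 G (?v t - ?v' t) \<le> ?m t"
      using 2 by (auto simp: vna_language_simps list_all2_Cons2)
    have "adj (?v t) - adj (?v' t) = adj (?v t - ?v' t)"
      using ri [OF hs] by (simp add: adj_diff right_invariantD(1))
    then show ?thesis
      using t by (simp add: VAdj ts vna_language_simps group_vna_structure_simps norm2_adj
          right_invariant_diff ri [OF hs])
  next
    case (VIncl n k)
    then show ?thesis
      using 2 by (auto simp: vna_language_simps group_vna_structure_simps list_all2_Cons2)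
  qed (use 2 in \<open>auto simp: vna_language_simps group_vna_structure_simps zero\<close>)
qed

lemma norm2_diff_abs:
  assumes "x \<in> right_invariant G" "x' \<in> right_invariant G" "y \<in> right_invariant G" "y' \<in> right_invariant G"
  shows "\<bar>norm2 G (x - y) - norm2 G (x' - y')\<bar> \<le> norm2 G (x - x') + norm2 G (y - y')"
proof -
  have cl: "complex_linear x" "complex_linear x'" "complex_linear y" "complex_linear y'"
    using assms right_invariantD(1) by auto
  have "\<bar>norm (a - b) - norm (a' - b')\<bar> \<le> norm (a - a') + norm (b - b')" for a b a' b' :: "'a ell2"
    using norm_triangle_ineq3 [of "a - b" "a' - b'"] norm_triangle_ineq4 [of "a - a'" "b - b'"]
    by (simp add: algebra_simps)
  then show ?thesis
    by (simp add: norm2_eq complex_linear_diff cl blinfun.diff_left)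
qed

lemma atomic_obeys_modulus:
  assumes wf: "atomic_wf vna_language ss \<phi>" and a: "bounded_ops G ss a" and a': "bounded_ops G ss a'"
    and \<delta>: "\<And>i. i < length ss \<Longrightarrow> norm2 G (a ! i - a' ! i) \<le> \<delta> i"
  shows "atomic_val (group_vna_structure G) a \<phi> \<in> atomic_bound vna_language \<phi>" (is ?thesis1)
    and "\<bar>atomic_val (group_vna_structure G) a \<phi> - atomic_val (group_vna_structure G) a' \<phi>\<bar>
      \<le> atomic_mod vna_language \<phi> \<delta>" (is ?thesis2)
proof -
  obtain n where n: "atom_pred \<phi> = VDist n" by (cases "atom_pred \<phi>") auto
  then obtain t u where ts: "atom_args \<phi> = [t, u]"
    and tu: "has_sort vna_language ss t n" "has_sort vna_language ss u n"
    using wf by (auto simp: atomic_wf_def vna_language_simps list_all2_Cons2)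
  let ?v = "mterm_val (group_vna_structure G) a" and ?v' = "mterm_val (group_vna_structure G) a'"
  note t = term_in_sort [OF tu(1) a] term_in_sort [OF tu(1) a']
    and u = term_in_sort [OF tu(2) a] term_in_sort [OF tu(2) a']
  have "norm2 G (?v t - ?v u) \<le> norm (?v t - ?v u)"
    using t u by (intro norm2_le_norm right_invariant_diff) auto
  also have "\<dots> \<le> real n + real n"
    by (rule norm_triangle_le_diff) (use t u in auto)
  finally show ?thesis1
    using t u norm2_nonneg [OF right_invariant_diff, of "?v t" "?v u"]
    by (simp add: atomic_val_def atomic_bound_def n ts vna_language_simps group_vna_structure_simps)
  have "\<bar>norm2 G (?v t - ?v u) - norm2 G (?v' t - ?v' u)\<bar> \<le> norm2 G (?v t - ?v' t) + norm2 G (?v u - ?v' u)"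
    using t u by (intro norm2_diff_abs) auto
  also have "\<dots> \<le> mterm_mod vna_language t \<delta> + mterm_mod vna_language u \<delta>"
    by (intro add_mono term_obeys_modulus [OF tu(1) a a' \<delta>] term_obeys_modulus [OF tu(2) a a' \<delta>])
  finally show ?thesis2
    by (simp add: atomic_val_def atomic_mod_def n ts)
      (simp add: vna_language_simps group_vna_structure_simps)
qed

lemma basic_obeys_weak_modulus:
  assumes \<psi>: "\<psi> \<in> Omega_formulas vna_language \<Omega> ss"
    and a: "bounded_ops G ss a" and a': "bounded_ops G ss a'"
    and nonneg: "\<delta> \<in> nonneg_seqs" and \<delta>: "\<And>i. i < length ss \<Longrightarrow> norm2 G (a ! i - a' ! i) \<le> \<delta> i"
    and \<delta>': "\<And>i. i < length ss \<Longrightarrow> norm2 G (a' ! i - a ! i) \<le> \<delta> i"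
  shows "ennreal \<bar>basic_val (group_vna_structure G) a \<psi> - basic_val (group_vna_structure G) a' \<psi>\<bar>
    \<le> truncation \<Omega> (length ss) \<delta>"
proof -
  obtain f \<phi>s where \<psi>_eq: "\<psi> = Basic f \<phi>s" by (cases \<psi>)
  have wf: "atomic_wf vna_language ss (\<phi>s ! j)" if "j < length \<phi>s" for j
    using \<psi> that by (auto simp: Omega_formulas_def \<psi>_eq)
  let ?x = "\<lambda>a. \<lambda>j\<in>{..<length \<phi>s}. atomic_val (group_vna_structure G) a (\<phi>s ! j)"
  have mem: "?x a \<in> bounds_prod vna_language \<phi>s" "?x a' \<in> bounds_prod vna_language \<phi>s"
    using atomic_obeys_modulus(1) [OF wf a a' \<delta>] atomic_obeys_modulus(1) [OF wf a' a \<delta>']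
    by (auto simp: bounds_prod_def)
  have "ennreal \<bar>f (?x a) - f (?x a')\<bar> \<le> basic_mod vna_language \<psi> \<delta>"
    unfolding \<psi>_eq basic_mod.simps modulus_of_def
  proof (rule SUP_upper2 [where i = "(?x a, ?x a')"])
    show "(?x a, ?x a') \<in> {(x, y). x \<in> bounds_prod vna_language \<phi>s \<and> y \<in> bounds_prod vna_language \<phi>s \<and>
        (\<forall>j<length \<phi>s. \<bar>x j - y j\<bar> \<le> atomic_mod vna_language (\<phi>s ! j) \<delta>)}"
      using mem atomic_obeys_modulus(2) [OF wf a a' \<delta>] by auto
  qed simp
  also have "\<dots> \<le> truncation \<Omega> (length ss) \<delta>"
    using \<psi> nonneg by (auto simp: Omega_formulas_def)
  finally show ?thesis by (simp add: \<psi>_eq)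
qed

end

lemma INF_le_INF_add:
  fixes K :: ennreal
  assumes "\<And>d. d \<in> D \<Longrightarrow> f d \<le> g d + K"
  shows "(INF d\<in>D. f d) \<le> (INF d\<in>D. g d) + K"
proof (cases "K = top_class.top")
  case False
  have "(INF d\<in>D. f d) - K \<le> (INF d\<in>D. g d)"
  proof (rule INF_greatest)
    fix d assume "d \<in> D"
    then have "(INF d\<in>D. f d) \<le> g d + K" using assms INF_lower2 by metis
    then show "(INF d\<in>D. f d) - K \<le> g d" using False by (simp add: ennreal_minus_le_iff add.commute)
  qed
  then show ?thesis using False by (simp add: ennreal_minus_le_iff add.commute)
qed simp

lemma r_dist_zero: "is_zero \<alpha> \<Longrightarrow> r_dist L \<Omega> \<alpha> M N a b = r_zero L \<Omega> M N a b"
  by (simp add: r_dist.simps [of L \<Omega> \<alpha>])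

lemma r_dist_nonzero:
  "\<not> is_zero \<alpha> \<Longrightarrow> r_dist L \<Omega> \<alpha> M N a b = max
    (SUP \<beta>\<in>{..<\<alpha>}. SUP c\<in>tuples M. INF d\<in>tuples_of_sorts N (map fst c). r_dist L \<Omega> \<beta> M N (a @ c) (b @ d))
    (SUP \<beta>\<in>{..<\<alpha>}. SUP d\<in>tuples N. INF c\<in>tuples_of_sorts M (map fst d). r_dist L \<Omega> \<beta> M N (a @ c) (b @ d))"
  by (simp add: r_dist.simps [of L \<Omega> \<alpha>])

lemma r_dist_sym:
  "map fst a = map fst b \<Longrightarrow> r_dist L \<Omega> \<alpha> M N a b = r_dist L \<Omega> \<alpha> N M b a"
proof (induction \<alpha> arbitrary: a b rule: less_induct)
  case (less \<alpha>)
  show ?case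
  proof (cases "is_zero \<alpha>")
    case True
    then show ?thesis
      using less.prems by (simp add: r_dist_zero r_zero_def abs_minus_commute)
  next
    case False
    have IH: "r_dist L \<Omega> \<beta> M N (a @ c) (b @ d) = r_dist L \<Omega> \<beta> N M (b @ d) (a @ c)"
      if "\<beta> \<in> {..<\<alpha>}" "map fst c = map fst d" for \<beta> c d
      using that less.prems by (intro less.IH) auto
    have "(SUP \<beta>\<in>{..<\<alpha>}. SUP c\<in>tuples M. INF d\<in>tuples_of_sorts N (map fst c). r_dist L \<Omega> \<beta> M N (a @ c) (b @ d)) =
      (SUP \<beta>\<in>{..<\<alpha>}. SUP c\<in>tuples M. INF d\<in>tuples_of_sorts N (map fst c). r_dist L \<Omega> \<beta> N M (b @ d) (a @ c))"
      by (intro SUP_cong INF_cong refl IH) (auto simp: tuples_of_sorts_def)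
    moreover have "(SUP \<beta>\<in>{..<\<alpha>}. SUP d\<in>tuples N. INF c\<in>tuples_of_sorts M (map fst d). r_dist L \<Omega> \<beta> M N (a @ c) (b @ d)) =
      (SUP \<beta>\<in>{..<\<alpha>}. SUP d\<in>tuples N. INF c\<in>tuples_of_sorts M (map fst d). r_dist L \<Omega> \<beta> N M (b @ d) (a @ c))"
      by (intro SUP_cong INF_cong refl IH) (auto simp: tuples_of_sorts_def)
    ultimately show ?thesis
      using False by (simp only: r_dist_nonzero [OF False] max.commute)
  qed
qed

text \<open>The entrywise 2-norm distances of two tuples of operators, as an argument of a weak modulus.\<close>

definition gap ::
    "('a, 'm) monoid_scheme \<Rightarrow> (nat \<times> ('a ell2 \<Rightarrow>\<^sub>L 'a ell2)) list \<Rightarrow>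
     (nat \<times> ('a ell2 \<Rightarrow>\<^sub>L 'a ell2)) list \<Rightarrow> nat \<Rightarrow> real"
  where "gap G a a' i = (if i < length a then norm2 G (snd (a ! i) - snd (a' ! i)) else 0)"

context group
begin

lemma tuples_vna_nth:
  assumes "a \<in> tuples (group_vna_structure G)" "i < length a"
  shows "snd (a ! i) \<in> group_vna G" "norm (snd (a ! i)) \<le> real (fst (a ! i))"
    "snd (a ! i) \<in> right_invariant G"
proof -
  have "a ! i \<in> {(s, x). x \<in> sort_of (group_vna_structure G) s}"
    using assms by (auto simp: tuples_def in_lists_conv_set)
  then show "snd (a ! i) \<in> group_vna G" "norm (snd (a ! i)) \<le> real (fst (a ! i))"
    by (auto simp: group_vna_structure_simps)
  then show "snd (a ! i) \<in> right_invariant G"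
    using group_vna_right_invariant by blast
qed

lemma bounded_ops_tuples:
  "a \<in> tuples (group_vna_structure G) \<Longrightarrow> bounded_ops G (map fst a) (map snd a)"
  by (simp add: bounded_ops_def list_all2_conv_all_nth tuples_vna_nth)

lemma gap_append_same:
  "length a = length a' \<Longrightarrow> gap G (a @ c) (a' @ c) = gap G a a'"
  by (rule ext) (auto simp: gap_def nth_append norm2_eq complex_linear_zero)

text \<open>
  The distance is uniformly continuous in its first tuple, with modulus \<open>\<Omega>\<close>: extending both tuples
  by the same entries does not change the gap.
\<close>

lemma r_dist_obeys_modulus:
  fixes N :: "(nat, vna_fun, vna_pred, 'y) metric_structure" and \<alpha> :: "'o::wellorder"
  shows "\<lbrakk>a \<in> tuples (group_vna_structure G); a' \<in> tuples (group_vna_structure G);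
      map fst a = map fst a'\<rbrakk> \<Longrightarrow>
    r_dist vna_language \<Omega> \<alpha> (group_vna_structure G) N a b
      \<le> r_dist vna_language \<Omega> \<alpha> (group_vna_structure G) N a' b + \<Omega> (gap G a a')"
proof (induction \<alpha> arbitrary: a a' b rule: less_induct)
  case (less \<alpha>)
  let ?M = "group_vna_structure G" and ?K = "\<Omega> (gap G a a')"
  let ?r = "\<lambda>\<beta>. r_dist vna_language \<Omega> \<beta> ?M N"
  have len: "length a = length a'" using less.prems(3) by (metis length_map)
  show ?case
  proof (cases "is_zero \<alpha>")
    case True
    have ri: "snd (a ! i) \<in> right_invariant G" "snd (a' ! i) \<in> right_invariant G"
      if "i < length a" for i
      using tuples_vna_nth(3) [OF less.prems(1)] tuples_vna_nth(3) [OF less.prems(2)] that len by auto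
    have nonneg: "gap G a a' \<in> nonneg_seqs"
      using ri by (auto simp: nonneg_seqs_def gap_def intro!: norm2_nonneg right_invariant_diff)
    have ops: "bounded_ops G (map fst a) (map snd a)" "bounded_ops G (map fst a) (map snd a')"
      using bounded_ops_tuples [OF less.prems(1)] bounded_ops_tuples [OF less.prems(2)] less.prems(3)
      by simp_all
    have "r_zero vna_language \<Omega> ?M N a b \<le> r_zero vna_language \<Omega> ?M N a' b + ?K"
      unfolding r_zero_def [of _ _ _ _ a]
    proof (rule SUP_least)
      fix \<psi> assume \<psi>: "\<psi> \<in> Omega_formulas vna_language \<Omega> (map fst a)"
      let ?v = "basic_val ?M (map snd a) \<psi>" and ?v' = "basic_val ?M (map snd a') \<psi>"
        and ?w = "basic_val N (map snd b) \<psi>"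
      have "ennreal \<bar>?v - ?w\<bar> \<le> ennreal (\<bar>?v' - ?w\<bar> + \<bar>?v - ?v'\<bar>)"
        by (rule ennreal_leI) linarith
      also have "\<dots> = ennreal \<bar>?v' - ?w\<bar> + ennreal \<bar>?v - ?v'\<bar>" by simp
      also have "\<dots> \<le> r_zero vna_language \<Omega> ?M N a' b + ?K"
      proof (rule add_mono)
        show "ennreal \<bar>?v' - ?w\<bar> \<le> r_zero vna_language \<Omega> ?M N a' b"
          unfolding r_zero_def using \<psi> less.prems(3) by (auto intro!: SUP_upper)
        have "ennreal \<bar>?v - ?v'\<bar> \<le> truncation \<Omega> (length (map fst a)) (gap G a a')"
        proof (rule basic_obeys_weak_modulus [OF \<psi> ops nonneg])
          fix i assume i: "i < length (map fst a)"
          then show "norm2 G (map snd a ! i - map snd a' ! i) \<le> gap G a a' i"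
            using len by (simp add: gap_def)
          have "norm2 G (snd (a' ! i) - snd (a ! i)) = norm2 G (snd (a ! i) - snd (a' ! i))"
            using right_invariantD(1) [OF ri(1)] right_invariantD(1) [OF ri(2)] i
            by (simp add: norm2_eq complex_linear_diff blinfun.diff_left norm_minus_commute)
          with i show "norm2 G (map snd a' ! i - map snd a ! i) \<le> gap G a a' i"
            using len by (simp add: gap_def)
        qed
        also have "\<dots> = ?K"
          unfolding truncation_def by (rule arg_cong [where f = \<Omega>]) (auto simp: gap_def)
        finally show "ennreal \<bar>?v - ?v'\<bar> \<le> ?K" .
      qed
      finally show "ennreal \<bar>?v - ?w\<bar> \<le> r_zero vna_language \<Omega> ?M N a' b + ?K" .
    qed
    then show ?thesis using True by (simp add: r_dist_zero)
  next
    case False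
    have IH: "?r \<beta> (a @ c) (b @ d) \<le> ?r \<beta> (a' @ c) (b @ d) + ?K"
      if "\<beta> \<in> {..<\<alpha>}" "c \<in> tuples ?M" for \<beta> c d
      using less.IH [of \<beta> "a @ c" "a' @ c" "b @ d"] that less.prems
      by (simp add: gap_append_same [OF len] tuples_def)
    have bound: "(INF d\<in>tuples_of_sorts N (map fst c). ?r \<beta> (a' @ c) (b @ d)) \<le> ?r \<alpha> a' b"
      if "\<beta> \<in> {..<\<alpha>}" "c \<in> tuples ?M" for \<beta> c
      unfolding r_dist_nonzero [OF False, of _ _ _ _ a']
      by (rule max.coboundedI1, rule SUP_upper2 [OF that(1)], rule SUP_upper2 [OF that(2)], rule order_refl)
    have bound': "(INF c\<in>tuples_of_sorts ?M (map fst d). ?r \<beta> (a' @ c) (b @ d)) \<le> ?r \<alpha> a' b"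
      if "\<beta> \<in> {..<\<alpha>}" "d \<in> tuples N" for \<beta> d
      unfolding r_dist_nonzero [OF False, of _ _ _ _ a']
      by (rule max.coboundedI2, rule SUP_upper2 [OF that(1)], rule SUP_upper2 [OF that(2)], rule order_refl)
    show ?thesis
      unfolding r_dist_nonzero [OF False, of _ _ _ _ a]
    proof (intro max.boundedI SUP_least)
      fix \<beta> c assume \<beta>: "\<beta> \<in> {..<\<alpha>}" and c: "c \<in> tuples ?M"
      have "(INF d\<in>tuples_of_sorts N (map fst c). ?r \<beta> (a @ c) (b @ d)) \<le>
          (INF d\<in>tuples_of_sorts N (map fst c). ?r \<beta> (a' @ c) (b @ d)) + ?K"
        by (intro INF_le_INF_add IH \<beta> c)
      also have "\<dots> \<le> ?r \<alpha> a' b + ?K" by (intro add_mono bound \<beta> c order_refl)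
      finally show "(INF d\<in>tuples_of_sorts N (map fst c). ?r \<beta> (a @ c) (b @ d)) \<le> ?r \<alpha> a' b + ?K" .
    next
      fix \<beta> d assume \<beta>: "\<beta> \<in> {..<\<alpha>}" and d: "d \<in> tuples N"
      have "(INF c\<in>tuples_of_sorts ?M (map fst d). ?r \<beta> (a @ c) (b @ d)) \<le>
          (INF c\<in>tuples_of_sorts ?M (map fst d). ?r \<beta> (a' @ c) (b @ d)) + ?K"
        by (intro INF_le_INF_add IH \<beta>) (simp add: tuples_of_sorts_def)
      also have "\<dots> \<le> ?r \<alpha> a' b + ?K" by (intro add_mono bound' \<beta> d order_refl)
      finally show "(INF c\<in>tuples_of_sorts ?M (map fst d). ?r \<beta> (a @ c) (b @ d)) \<le> ?r \<alpha> a' b + ?K" .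
    qed
  qed
qed

end


section \<open>The back-and-forth argument\<close>

text \<open>
  A tuple of formal polynomials tagged with sorts is evaluated at a tuple \<open>g\<close> of group elements. It
  is well-sorted at \<open>g\<close> if its words only use the variables for \<open>g\<close> and each value lies in the operator
  norm ball given by its sort.
\<close>

definition gpoly_tuple ::
    "('a, 'm) monoid_scheme \<Rightarrow> 'a list \<Rightarrow> (nat \<times> gpoly) list \<Rightarrow> (nat \<times> ('a ell2 \<Rightarrow>\<^sub>L 'a ell2)) list"
  where "gpoly_tuple G g q = map (\<lambda>(s, p). (s, gpoly_val G g p)) q"

definition well_sorted :: "('a, 'm) monoid_scheme \<Rightarrow> 'a list \<Rightarrow> (nat \<times> gpoly) list \<Rightarrow> bool"
  where "well_sorted G g q \<longleftrightarrow>
    (\<forall>(s, p)\<in>set q. gpoly_vars p \<subseteq> {..<length g} \<and> norm (gpoly_val G g p) \<le> real s)"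

lemma map_fst_gpoly_tuple [simp]: "map fst (gpoly_tuple G g q) = map fst q"
  and length_gpoly_tuple [simp]: "length (gpoly_tuple G g q) = length q"
  and gpoly_tuple_append: "gpoly_tuple G g (q @ q') = gpoly_tuple G g q @ gpoly_tuple G g q'"
  by (auto simp: gpoly_tuple_def)

lemma gpoly_tuple_append_tuple:
  "well_sorted G g q \<Longrightarrow> gpoly_tuple G (g @ e) q = gpoly_tuple G g q"
  by (auto simp: gpoly_tuple_def well_sorted_def gpoly_val_append_tuple)

lemma well_sorted_append_tuple:
  assumes "well_sorted G g q"
  shows "well_sorted G (g @ e) q"
  unfolding well_sorted_def
proof (clarify, rule conjI)
  fix s p assume "(s, p) \<in> set q"
  then have p: "gpoly_vars p \<subseteq> {..<length g}" "norm (gpoly_val G g p) \<le> real s"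
    using assms by (auto simp: well_sorted_def)
  then show "gpoly_vars p \<subseteq> {..<length (g @ e)}" by auto
  show "norm (gpoly_val G (g @ e) p) \<le> real s"
    using p by (simp add: gpoly_val_append_tuple)
qed

lemma (in group) gpoly_tuple_in_tuples:
  assumes "g \<in> lists (carrier G)" "well_sorted G g q"
  shows "gpoly_tuple G g q \<in> tuples (group_vna_structure G)"
  using assms gpoly_val_in_group_algebra [OF assms(1)] group_algebra_subset_vna
  by (fastforce simp: gpoly_tuple_def tuples_def in_lists_conv_set well_sorted_def
      group_vna_structure_simps)

lemma well_sorted_transfer:
  assumes "group G" "group H" "g \<in> lists (carrier G)" "h \<in> lists (carrier H)"
    and "length h = length g" and "bf_equiv_tuple (Some (\<alpha> :: 'o::wellorder)) G g H h"
    and "well_sorted G g q"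
  shows "well_sorted H h q"
  using assms norm_gpoly_transfer [OF assms(1-6)] by (fastforce simp: well_sorted_def)

text \<open>A term evaluated at formal polynomials is again a formal polynomial, uniformly in the group.\<close>

lemma term_of_gpolys:
  assumes "group G" "group H" and g: "g \<in> lists (carrier G)" and h: "h \<in> lists (carrier H)"
    and len: "length h = length g" and q: "\<forall>x\<in>set q. gpoly_vars (snd x) \<subseteq> {..<length g}"
    and t: "has_sort vna_language (map fst q) t s"
  shows "\<exists>p. gpoly_vars p \<subseteq> {..<length g} \<and>
    mterm_val (group_vna_structure G) (map snd (gpoly_tuple G g q)) t = gpoly_val G g p \<and>
    mterm_val (group_vna_structure H) (map snd (gpoly_tuple H h q)) t = gpoly_val H h p"
  using t
proof (induction rule: has_sort.induct)
  case (1 i)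
  then have "q ! i \<in> set q" by simp
  then have "gpoly_vars (snd (q ! i)) \<subseteq> {..<length g}" using q by blast
  with 1 show ?case
    by (intro exI [of _ "snd (q ! i)"]) (simp add: gpoly_tuple_def split_beta)
next
  case (2 ts F)
  interpret G: group G by fact
  interpret H: group H by fact
  have h_adj: "gpoly_vars p \<subseteq> {..<length g} \<Longrightarrow> gpoly_val H h (gpoly_adj p) = adj (gpoly_val H h p)" for p
    using H.gpoly_val_adj [OF h] len by simp
  have h_mult: "gpoly_vars p \<subseteq> {..<length g} \<Longrightarrow> gpoly_vars p' \<subseteq> {..<length g} \<Longrightarrow>
      gpoly_val H h (gpoly_mult p p') = gpoly_val H h p o\<^sub>L gpoly_val H h p'" for p p'
    using H.gpoly_val_mult [OF h] len by simp
  have mult_vars: "gpoly_vars p \<subseteq> {..<length g} \<Longrightarrow> gpoly_vars p' \<subseteq> {..<length g} \<Longrightarrow>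
      gpoly_vars (gpoly_mult p p') \<subseteq> {..<length g}" for p p'
    using gpoly_vars_mult [of p p'] by blast
  show ?case
  proof (cases F)
    case VZero
    with 2 show ?thesis
      by (intro exI [of _ "[]"]) (auto simp: vna_language_simps group_vna_structure_simps)
  next
    case VOne
    with 2 show ?thesis
      by (intro exI [of _ "[(1, GOne)]"])
        (auto simp: vna_language_simps group_vna_structure_simps scaleC_op_one)
  next
    case (VAdd m n)
    with 2 obtain p p' t u where "ts = [t, u]" and p: "gpoly_vars p \<subseteq> {..<length g}" "gpoly_vars p' \<subseteq> {..<length g}"
      "mterm_val (group_vna_structure G) (map snd (gpoly_tuple G g q)) t = gpoly_val G g p"
      "mterm_val (group_vna_structure H) (map snd (gpoly_tuple H h q)) t = gpoly_val H h p"
      "mterm_val (group_vna_structure G) (map snd (gpoly_tuple G g q)) u = gpoly_val G g p'"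
      "mterm_val (group_vna_structure H) (map snd (gpoly_tuple H h q)) u = gpoly_val H h p'"
      by (auto simp: vna_language_simps list_all2_Cons2)
    then show ?thesis
      by (intro exI [of _ "p @ p'"]) (simp add: VAdd group_vna_structure_simps)
  next
    case (VMult m n)
    with 2 obtain p p' t u where "ts = [t, u]" and p: "gpoly_vars p \<subseteq> {..<length g}" "gpoly_vars p' \<subseteq> {..<length g}"
      "mterm_val (group_vna_structure G) (map snd (gpoly_tuple G g q)) t = gpoly_val G g p"
      "mterm_val (group_vna_structure H) (map snd (gpoly_tuple H h q)) t = gpoly_val H h p"
      "mterm_val (group_vna_structure G) (map snd (gpoly_tuple G g q)) u = gpoly_val G g p'"
      "mterm_val (group_vna_structure H) (map snd (gpoly_tuple H h q)) u = gpoly_val H h p'"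
      by (auto simp: vna_language_simps list_all2_Cons2)
    then show ?thesis
      by (intro exI [of _ "gpoly_mult p p'"])
        (simp add: VMult group_vna_structure_simps G.gpoly_val_mult [OF g] h_mult mult_vars)
  next
    case (VScale c n)
    with 2 obtain p t where "ts = [t]" and p: "gpoly_vars p \<subseteq> {..<length g}"
      "mterm_val (group_vna_structure G) (map snd (gpoly_tuple G g q)) t = gpoly_val G g p"
      "mterm_val (group_vna_structure H) (map snd (gpoly_tuple H h q)) t = gpoly_val H h p"
      by (auto simp: vna_language_simps list_all2_Cons2)
    then show ?thesis
      by (intro exI [of _ "gpoly_scale c p"]) (simp add: VScale group_vna_structure_simps gpoly_val_scale)
  next
    case (VAdj n)
    with 2 obtain p t where "ts = [t]" and p: "gpoly_vars p \<subseteq> {..<length g}"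
      "mterm_val (group_vna_structure G) (map snd (gpoly_tuple G g q)) t = gpoly_val G g p"
      "mterm_val (group_vna_structure H) (map snd (gpoly_tuple H h q)) t = gpoly_val H h p"
      by (auto simp: vna_language_simps list_all2_Cons2)
    then show ?thesis
      by (intro exI [of _ "gpoly_adj p"])
        (simp add: VAdj group_vna_structure_simps G.gpoly_val_adj [OF g] h_adj)
  next
    case (VIncl n k)
    with 2 show ?thesis
      by (auto simp: vna_language_simps group_vna_structure_simps list_all2_Cons2)
  qed
qed

lemma r_zero_gpoly_tuple:
  assumes G: "group G" and H: "group H" and g: "g \<in> lists (carrier G)" and h: "h \<in> lists (carrier H)"
    and len: "length h = length g" and qf: "qf_equiv G g H h" and q: "well_sorted G g q"
  shows "r_zero vna_language \<Omega> (group_vna_structure G) (group_vna_structure H)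
    (gpoly_tuple G g q) (gpoly_tuple H h q) = 0"
proof -
  let ?a = "map snd (gpoly_tuple G g q)" and ?b = "map snd (gpoly_tuple H h q)"
  have vars: "\<forall>x\<in>set q. gpoly_vars (snd x) \<subseteq> {..<length g}"
    using q unfolding well_sorted_def by fastforce
  have atomic: "atomic_val (group_vna_structure G) ?a \<phi> = atomic_val (group_vna_structure H) ?b \<phi>"
    if wf: "atomic_wf vna_language (map fst q) \<phi>" for \<phi>
  proof -
    obtain n where n: "atom_pred \<phi> = VDist n" by (cases "atom_pred \<phi>") auto
    then obtain t u where ts: "atom_args \<phi> = [t, u]"
      and tu: "has_sort vna_language (map fst q) t n" "has_sort vna_language (map fst q) u n"
      using wf by (auto simp: atomic_wf_def vna_language_simps list_all2_Cons2)
    obtain p p' where p: "gpoly_vars p \<subseteq> {..<length g}" "gpoly_vars p' \<subseteq> {..<length g}"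
      "mterm_val (group_vna_structure G) ?a t = gpoly_val G g p"
      "mterm_val (group_vna_structure H) ?b t = gpoly_val H h p"
      "mterm_val (group_vna_structure G) ?a u = gpoly_val G g p'"
      "mterm_val (group_vna_structure H) ?b u = gpoly_val H h p'"
      using term_of_gpolys [OF G H g h len vars tu(1)] term_of_gpolys [OF G H g h len vars tu(2)]
      by blast
    have "norm2 G (gpoly_val G g (p @ gpoly_scale (- 1) p')) = norm2 H (gpoly_val H h (p @ gpoly_scale (- 1) p'))"
      by (rule norm2_gpoly_eq [OF G H g h len qf]) (use p in simp)
    then show ?thesis
      by (simp add: atomic_val_def n ts group_vna_structure_simps p minus_op_eq gpoly_val_scale)
  qed
  have "basic_val (group_vna_structure G) ?a \<psi> = basic_val (group_vna_structure H) ?b \<psi>"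
    if "\<psi> \<in> Omega_formulas vna_language \<Omega> (map fst q)" for \<psi>
  proof -
    obtain f \<phi>s where \<psi>: "\<psi> = Basic f \<phi>s" by (cases \<psi>)
    have "\<forall>\<phi>\<in>set \<phi>s. atomic_wf vna_language (map fst q) \<phi>"
      using that by (auto simp: \<psi> Omega_formulas_def)
    then have "(\<lambda>j\<in>{..<length \<phi>s}. atomic_val (group_vna_structure G) ?a (\<phi>s ! j)) =
        (\<lambda>j\<in>{..<length \<phi>s}. atomic_val (group_vna_structure H) ?b (\<phi>s ! j))"
      by (intro restrict_ext atomic) auto
    then show ?thesis by (simp add: \<psi>)
  qed
  then have "r_zero vna_language \<Omega> (group_vna_structure G) (group_vna_structure H)
      (gpoly_tuple G g q) (gpoly_tuple H h q) \<le> 0"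
    unfolding r_zero_def by (intro SUP_least) simp
  then show ?thesis by simp
qed

lemma (in group) approximate_tuple:
  assumes g: "g \<in> lists (carrier G)" and c: "c \<in> tuples (group_vna_structure G)" and "\<eta> > 0"
  obtains e q where "e \<in> lists (carrier G)" "map fst q = map fst c" "well_sorted G (g @ e) q"
    "\<And>i. i < length c \<Longrightarrow> norm2 G (snd (c ! i) - snd (gpoly_tuple G (g @ e) q ! i)) < \<eta>"
proof -
  have "\<forall>i\<in>{..<length c}. \<exists>z. z \<in> group_algebra G \<and> norm z \<le> real (fst (c ! i)) \<and>
      norm2 G (snd (c ! i) - z) < \<eta>"
    using kaplansky [OF tuples_vna_nth(3) [OF c] tuples_vna_nth(2) [OF c] \<open>\<eta> > 0\<close>]
    by (metis lessThan_iff)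
  then obtain z where z: "\<And>i. i < length c \<Longrightarrow> z i \<in> group_algebra G"
    "\<And>i. i < length c \<Longrightarrow> norm (z i) \<le> real (fst (c ! i))"
    "\<And>i. i < length c \<Longrightarrow> norm2 G (snd (c ! i) - z i) < \<eta>"
    unfolding bchoice_iff by auto
  have "\<forall>i\<in>{..<length c}. \<exists>F. finite F \<and> F \<subseteq> carrier G \<and>
      (\<forall>g. F \<subseteq> set g \<longrightarrow> (\<exists>p. gpoly_vars p \<subseteq> {..<length g} \<and> gpoly_val G g p = z i))"
    using group_algebra_support [OF z(1)] by (metis lessThan_iff)
  then obtain F where "\<forall>i\<in>{..<length c}. finite (F i) \<and> F i \<subseteq> carrier G \<and>
      (\<forall>g. F i \<subseteq> set g \<longrightarrow> (\<exists>p. gpoly_vars p \<subseteq> {..<length g} \<and> gpoly_val G g p = z i))"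
    unfolding bchoice_iff by blast
  then have F: "\<And>i. i < length c \<Longrightarrow> finite (F i)" "\<And>i. i < length c \<Longrightarrow> F i \<subseteq> carrier G"
    "\<And>i g. i < length c \<Longrightarrow> F i \<subseteq> set g \<Longrightarrow>
      \<exists>p. gpoly_vars p \<subseteq> {..<length g} \<and> gpoly_val G g p = z i"
    by blast+
  have "finite (\<Union>i<length c. F i)" using F(1) by auto
  then obtain e where e: "set e = (\<Union>i<length c. F i)" using finite_list by blast
  have "\<forall>i\<in>{..<length c}. \<exists>p. gpoly_vars p \<subseteq> {..<length (g @ e)} \<and> gpoly_val G (g @ e) p = z i"
  proof
    fix i assume i: "i \<in> {..<length c}"
    then have "F i \<subseteq> set (g @ e)" using e by auto
    with F(3) i show "\<exists>p. gpoly_vars p \<subseteq> {..<length (g @ e)} \<and> gpoly_val G (g @ e) p = z i"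
      by blast
  qed
  then obtain p where p: "\<And>i. i < length c \<Longrightarrow> gpoly_vars (p i) \<subseteq> {..<length (g @ e)}"
    "\<And>i. i < length c \<Longrightarrow> gpoly_val G (g @ e) (p i) = z i"
    unfolding bchoice_iff by auto
  define q where "q = map (\<lambda>i. (fst (c ! i), p i)) [0..<length c]"
  have "e \<in> lists (carrier G)" using e F(2) by (auto simp: in_lists_conv_set)
  moreover have "map fst q = map fst c" by (rule nth_equalityI) (simp_all add: q_def)
  moreover have "well_sorted G (g @ e) q"
    using p z(2) by (auto simp: well_sorted_def q_def)
  moreover have "norm2 G (snd (c ! i) - snd (gpoly_tuple G (g @ e) q ! i)) < \<eta>" if "i < length c" for i
    using that p(2) z(3) by (simp add: gpoly_tuple_def q_def)
  ultimately show thesis by (rule that)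
qed

text \<open>
  An arbitrary tuple \<open>c\<close> in \<open>L(G)\<close> is replaced by a tuple of formal polynomials at new group elements
  \<open>e\<close>, at the cost of a small gap. A response \<open>f\<close> to \<open>e\<close> in the game on groups yields the response to
  \<open>c\<close> in the metric game, by evaluating the same polynomials at \<open>f\<close>.
\<close>

lemma back_and_forth_step:
  fixes \<alpha> \<beta> :: "'o::wellorder"
  assumes \<Omega>: "weak_modulus \<Omega>" and G: "group G" and H: "group H"
    and g: "g \<in> lists (carrier G)" and h: "h \<in> lists (carrier H)"
    and len: "length h = length g" and bf: "bf_equiv_tuple (Some \<alpha>) G g H h"
    and q: "well_sorted G g q" and "\<beta> < \<alpha>" and c: "c \<in> tuples (group_vna_structure G)"
    and IH: "\<And>g' h' q'. \<lbrakk>g' \<in> lists (carrier G); h' \<in> lists (carrier H); length h' = length g';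
      bf_equiv_tuple (Some \<beta>) G g' H h'; well_sorted G g' q'\<rbrakk> \<Longrightarrow>
      r_dist vna_language \<Omega> \<beta> (group_vna_structure G) (group_vna_structure H)
        (gpoly_tuple G g' q') (gpoly_tuple H h' q') = 0"
  shows "(INF d\<in>tuples_of_sorts (group_vna_structure H) (map fst c).
    r_dist vna_language \<Omega> \<beta> (group_vna_structure G) (group_vna_structure H)
      (gpoly_tuple G g q @ c) (gpoly_tuple H h q @ d)) = 0"
proof -
  interpret G: group G by fact
  interpret H: group H by fact
  let ?M = "group_vna_structure G" and ?N = "group_vna_structure H"
  let ?r = "r_dist vna_language \<Omega> \<beta> ?M ?N"
  have "(INF d\<in>tuples_of_sorts ?N (map fst c). ?r (gpoly_tuple G g q @ c) (gpoly_tuple H h q @ d))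
      \<le> 0 + ennreal \<epsilon>" if "\<epsilon> > 0" for \<epsilon>
  proof -
    obtain \<eta> where \<eta>: "\<eta> > 0"
      "\<And>\<delta>. \<delta> \<in> nonneg_seqs \<Longrightarrow> (\<And>i. i < length q + length c \<Longrightarrow> \<delta> i < \<eta>) \<Longrightarrow>
        (\<And>i. length q + length c \<le> i \<Longrightarrow> \<delta> i = 0) \<Longrightarrow> \<Omega> \<delta> \<le> ennreal \<epsilon>"
      using weak_modulus_small [OF \<Omega> \<open>\<epsilon> > 0\<close>] by metis
    obtain e q' where e: "e \<in> lists (carrier G)" and q': "map fst q' = map fst c"
      and ws: "well_sorted G (g @ e) q'"
      and close: "\<And>i. i < length c \<Longrightarrow> norm2 G (snd (c ! i) - snd (gpoly_tuple G (g @ e) q' ! i)) < \<eta>"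
      using G.approximate_tuple [OF g c \<eta>(1)] by blast
    obtain f where f: "f \<in> lists (carrier H)" "length f = length e"
      and bf': "bf_equiv_tuple (Some \<beta>) G (g @ e) H (h @ f)"
      using bf_equiv_tuple_Some_less [OF bf \<open>\<beta> < \<alpha>\<close> e] .
    have ge: "g @ e \<in> lists (carrier G)" and hf: "h @ f \<in> lists (carrier H)"
      and len': "length (h @ f) = length (g @ e)"
      using g h e f len by auto
    have lc: "length q' = length c" using q' by (metis length_map)
    have qH: "well_sorted H h q" by (rule well_sorted_transfer [OF G H g h len bf q])
    have ws': "well_sorted G (g @ e) (q @ q')"
      using well_sorted_append_tuple [OF q, of e] ws by (auto simp: well_sorted_def)
    have wsH: "well_sorted H (h @ f) q'"
      by (rule well_sorted_transfer [OF G H ge hf len' bf' ws])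
    let ?a = "gpoly_tuple G g q" and ?b = "gpoly_tuple H h q"
      and ?c = "gpoly_tuple G (g @ e) q'" and ?d = "gpoly_tuple H (h @ f) q'"
    have a: "?a \<in> tuples ?M" by (rule G.gpoly_tuple_in_tuples [OF g q])
    have c': "?c \<in> tuples ?M" by (rule G.gpoly_tuple_in_tuples [OF ge ws])
    have ac: "?a @ c \<in> tuples ?M" "?a @ ?c \<in> tuples ?M"
      using a c c' by (auto simp: tuples_def)
    have d: "?d \<in> tuples_of_sorts ?N (map fst c)"
      using H.gpoly_tuple_in_tuples [OF hf wsH] q' by (simp add: tuples_of_sorts_def)
    have small: "\<Omega> (gap G (?a @ c) (?a @ ?c)) \<le> ennreal \<epsilon>"
    proof (rule \<eta>(2))
      have len_ac: "length (?a @ c) = length (?a @ ?c)" using lc by simp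
      then show "gap G (?a @ c) (?a @ ?c) \<in> nonneg_seqs"
        using G.tuples_vna_nth(3) [OF ac(1)] G.tuples_vna_nth(3) [OF ac(2)]
        by (auto simp: nonneg_seqs_def gap_def intro!: G.norm2_nonneg right_invariant_diff)
      have "norm2 G 0 = 0" by (simp add: norm2_eq complex_linear_zero)
      then show "gap G (?a @ c) (?a @ ?c) i < \<eta>" if "i < length q + length c" for i
        using close [of "i - length q"] \<eta>(1) that by (cases "i < length q") (auto simp: gap_def nth_append)
      show "gap G (?a @ c) (?a @ ?c) i = 0" if "length q + length c \<le> i" for i
        using that by (simp add: gap_def)
    qed
    have "?r (?a @ ?c) (?b @ ?d) = 0"
      using IH [OF ge hf len' bf' ws']
      by (simp add: gpoly_tuple_append gpoly_tuple_append_tuple q qH)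
    moreover have "?r (?a @ c) (?b @ ?d) \<le> ?r (?a @ ?c) (?b @ ?d) + \<Omega> (gap G (?a @ c) (?a @ ?c))"
      by (rule G.r_dist_obeys_modulus [OF ac]) (simp add: q')
    ultimately have "?r (?a @ c) (?b @ ?d) \<le> \<Omega> (gap G (?a @ c) (?a @ ?c))" by simp
    also have "\<dots> \<le> 0 + ennreal \<epsilon>" using small by simp
    finally have "?r (?a @ c) (?b @ ?d) \<le> 0 + ennreal \<epsilon>" .
    then show ?thesis by (rule INF_lower2 [OF d])
  qed
  then have "(INF d\<in>tuples_of_sorts ?N (map fst c). ?r (gpoly_tuple G g q @ c) (gpoly_tuple H h q @ d)) \<le> 0"
    by (rule ennreal_le_epsilon)
  then show ?thesis by simp
qed

text \<open>
  On tuples in the group algebras that are given by the same formal polynomials, the metric relation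
  of level \<open>\<alpha>\<close> follows from the classical relation of level \<open>1 + \<alpha>\<close>.
\<close>

lemma r_dist_gpoly_tuple:
  fixes \<alpha> :: "'o::wellorder"
  assumes \<Omega>: "weak_modulus \<Omega>" and G: "group G" and H: "group H"
  shows "\<lbrakk>g \<in> lists (carrier G); h \<in> lists (carrier H); length h = length g;
      bf_equiv_tuple (Some \<alpha>) G g H h; well_sorted G g q\<rbrakk> \<Longrightarrow>
    r_dist vna_language \<Omega> \<alpha> (group_vna_structure G) (group_vna_structure H)
      (gpoly_tuple G g q) (gpoly_tuple H h q) = 0"
proof (induction \<alpha> arbitrary: g h q rule: less_induct)
  case (less \<alpha>)
  let ?M = "group_vna_structure G" and ?N = "group_vna_structure H"
  let ?a = "gpoly_tuple G g q" and ?b = "gpoly_tuple H h q"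
  show ?case
  proof (cases "is_zero \<alpha>")
    case True
    then show ?thesis
      using r_zero_gpoly_tuple [OF G H less.prems(1-3) bf_equiv_tuple_Some_imp_qf [OF less.prems(4)] less.prems(5)]
      by (simp add: r_dist_zero)
  next
    case False
    have forward: "(INF d\<in>tuples_of_sorts ?N (map fst c). r_dist vna_language \<Omega> \<beta> ?M ?N (?a @ c) (?b @ d)) = 0"
      if "\<beta> \<in> {..<\<alpha>}" "c \<in> tuples ?M" for \<beta> c
      using that less.IH
      by (intro back_and_forth_step [OF \<Omega> G H less.prems]) auto
    have backward: "(INF c\<in>tuples_of_sorts ?M (map fst d). r_dist vna_language \<Omega> \<beta> ?M ?N (?a @ c) (?b @ d)) = 0"
      if \<beta>: "\<beta> \<in> {..<\<alpha>}" and d: "d \<in> tuples ?N" for \<beta> d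
    proof -
      have bf: "bf_equiv_tuple (Some \<alpha>) H h G g"
        by (rule bf_equiv_tuple_sym [OF less.prems(3) [symmetric] less.prems(4)])
      have q: "well_sorted H h q"
        by (rule well_sorted_transfer [OF G H less.prems])
      have IH: "r_dist vna_language \<Omega> \<beta> ?N ?M (gpoly_tuple H h' q') (gpoly_tuple G g' q') = 0"
        if h': "h' \<in> lists (carrier H)" and g': "g' \<in> lists (carrier G)" and len: "length g' = length h'"
          and bf': "bf_equiv_tuple (Some \<beta>) H h' G g'" and q': "well_sorted H h' q'" for g' h' q'
      proof -
        have "r_dist vna_language \<Omega> \<beta> ?M ?N (gpoly_tuple G g' q') (gpoly_tuple H h' q') = 0"
        proof (rule less.IH)
          show "\<beta> < \<alpha>" using \<beta> by simp
          show "bf_equiv_tuple (Some \<beta>) G g' H h'"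
            by (rule bf_equiv_tuple_sym [OF len [symmetric] bf'])
          show "well_sorted G g' q'"
            by (rule well_sorted_transfer [OF H G h' g' len bf' q'])
        qed (use g' h' len in auto)
        then show ?thesis by (subst r_dist_sym) simp_all
      qed
      have "(INF c\<in>tuples_of_sorts ?M (map fst d). r_dist vna_language \<Omega> \<beta> ?M ?N (?a @ c) (?b @ d)) =
        (INF c\<in>tuples_of_sorts ?M (map fst d). r_dist vna_language \<Omega> \<beta> ?N ?M (?b @ d) (?a @ c))"
        by (intro INF_cong refl r_dist_sym) (simp add: tuples_of_sorts_def)
      also have "\<dots> = 0"
        using \<beta> by (intro back_and_forth_step [OF \<Omega> H G less.prems(2,1) less.prems(3) [symmetric] bf q _ d IH]) auto
      finally show ?thesis .
    qed
    show ?thesis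
      unfolding r_dist_nonzero [OF False]
      by (rule antisym, intro max.boundedI SUP_least) (simp_all add: forward backward)
  qed
qed

theorem theorem4p1:
  fixes G :: "('a, 'm) monoid_scheme" and H :: "('b, 'n) monoid_scheme"
    and \<alpha> :: "'o::wellorder" and \<Omega> :: "(nat \<Rightarrow> real) \<Rightarrow> ennreal"
  assumes "group G" and "group H"
    and "bf_equiv (one_plus \<alpha>) G H"
    and "weak_modulus \<Omega>"
  shows "metric_bf_equiv vna_language \<Omega> \<alpha> (group_vna_structure G) (group_vna_structure H)"
proof -
  have "r_dist vna_language \<Omega> \<alpha> (group_vna_structure G) (group_vna_structure H)
      (gpoly_tuple G [] []) (gpoly_tuple H [] []) = 0"
    by (rule r_dist_gpoly_tuple [OF assms(4,1,2)])
      (use assms(3) in \<open>simp_all add: bf_equiv_def one_plus_def well_sorted_def\<close>)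
  then show ?thesis by (simp add: metric_bf_equiv_def gpoly_tuple_def)
qed

end
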